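(* Let $\mathcal{S}$ be the set of rational maps of degree $2$ over $\mathbb{Q}$ with squarefree resultant, and let $n\in[1,6]$. Then $$\mu_n(\mathcal{S})>\left(\prod_{p\geq 23}\frac{p^{12}-3p^{10}-2p^9+4p^8}{p^{12}(1-p^{-6})}\right)\cdot 0.33843144838\ldots>0.327,$$ where $0.33843144838\ldots=\prod_{p<20}\pi(\mathcal{S}_p)$, with $\pi(\mathcal{S}_p)$ the proportion of points $P\in\mathbb{P}^5(\mathbb{Z}/p^2\mathbb{Z})$ with $\mathrm{Res}(P)\not\equiv 0 \bmod p^2$. Therefore, with respect to the weak box densities, more than $32.7\%$ of rational maps of degree $2$ with rational coefficients have squarefree, hence globally minimal, resultant.
   Context: A degree-$2$ rational map $\phi(X/Y)=(aX^2+bXY+cY^2)/(dX^2+eXY+fY^2)$ over $\mathbb{Q}$ is identified with the point $(a,b,c,d,e,f)\in\mathbb{Z}^6$ with $\gcd=1$ and first nonzero coordinate positive (a point of $\mathbb{P}^5(\mathbb{Q})$); its resultant is $R=a^2f^2-abef-2acdf+ace^2+b^2df-bcde+c^2d^2$ evaluated at this point. Globally minimal means the resultant equals the minimal resultant $\prod_p p^{\epsilon_p(\phi)}$, where $\epsilon_p(\phi)$ is the minimum of $\mathrm{ord}_p\mathrm{Res}(A^{-1}\circ\phi\circ A)$ over $A\in\mathrm{PGL}_2(\mathbb{Q})$. For $\vec r=(r_1,\dots,r_6)$ let $\mathcal{S}(\vec r)$ be the points of $\mathcal{S}$ with $|C_i|\le r_i$ for all $i$, and similarly $\mathbb{P}^5(\mathbb{Q},\vec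 r)$. The $n$-th weak box density is $\mu_n(\mathcal{S})=\lim_{r_1,\dots,\hat r_n,\dots,r_6\to\infty}\lim_{r_n\to\infty}\#\mathcal{S}(\vec r)/\#\mathbb{P}^5(\mathbb{Q},\vec r)$ (defined via $\liminf$/$\limsup$ which agree), where the outer limit is over all $r_i$ with $i\neq n$. *)

theory Defs
  imports
    "HOL-Analysis.Analysis"
    "HOL-Computational_Algebra.Squarefree"
    "HOL-Number_Theory.Cong"
begin

text \<open>
  A sextuple \<open>(a, b, c, d, e, f)\<close> is a function \<open>C\<close> on the indices \<open>1, ..., 6\<close> (extensional outside).
  It encodes \<open>\<phi>(X/Y) = (a X^2 + b X Y + c Y^2) / (d X^2 + e X Y + f Y^2)\<close>.
\<close>

type_synonym sextuple = "nat \<Rightarrow> int"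

definition P5Q :: "sextuple set" where
  "P5Q = {C \<in> {1..6} \<rightarrow>\<^sub>E UNIV. Gcd (C ` {1..6}) = 1 \<and> C (LEAST i. i \<in> {1..6} \<and> C i \<noteq> 0) > 0}"

definition Res :: "sextuple \<Rightarrow> int" where
  "Res C = (let a = C 1; b = C 2; c = C 3; d = C 4; e = C 5; f = C 6 in
     a^2 * f^2 - a * b * e * f - 2 * a * c * d * f + a * c * e^2
     + b^2 * d * f - b * c * d * e + c^2 * d^2)"

text \<open>A point of \<open>P5Q\<close> defines a rational map of degree exactly 2 iff its resultant does not vanish.\<close>

definition rational_maps2 :: "sextuple set" where
  "rational_maps2 = {C \<in> P5Q. Res C \<noteq> 0}"

definition squarefree_res_maps :: "sextuple set" where
  "squarefree_res_maps = {C \<in> rational_maps2. squarefree (Res C)}"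


subsection \<open>Minimal resultant\<close>

definition hom_lift :: "sextuple \<Rightarrow> rat^2 \<Rightarrow> rat^2" where
  "hom_lift C v = vector
     [of_int (C 1) * (v$1)^2 + of_int (C 2) * (v$1) * (v$2) + of_int (C 3) * (v$2)^2,
      of_int (C 4) * (v$1)^2 + of_int (C 5) * (v$1) * (v$2) + of_int (C 6) * (v$2)^2]"

text \<open>
  \<open>is_conjugate A C D\<close>: the normalized point \<open>D\<close> represents \<open>A\<inverse> \<circ> \<phi> \<circ> A\<close>, where \<open>\<phi>\<close> is represented by \<open>C\<close>.
  Homogeneous lifts of a rational map are unique up to a nonzero scalar, and over the infinite
  field of rationals equality of quadratic forms is equality of the functions they define.
\<close>

definition is_conjugate :: "rat^2^2 \<Rightarrow> sextuple \<Rightarrow> sextuple \<Rightarrow> bool" where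
  "is_conjugate A C D \<longleftrightarrow> D \<in> P5Q \<and>
     (\<exists>k::rat. k \<noteq> 0 \<and> (\<forall>v. hom_lift D v = k *s (matrix_inv A *v hom_lift C (A *v v))))"

text \<open>
  The class of an invertible matrix in the projective linear group is all that matters below,
  since rescaling \<open>A\<close> does not change the relation \<open>is_conjugate A\<close>.
\<close>

definition min_res_exponent :: "nat \<Rightarrow> sextuple \<Rightarrow> nat" where
  "min_res_exponent p C =
     (LEAST k. \<exists>A D. invertible A \<and> is_conjugate A C D \<and> k = multiplicity (int p) (Res D))"

text \<open>Only primes dividing \<open>Res C\<close> can have a positive exponent, so the product is finite.\<close>

definition minimal_resultant :: "sextuple \<Rightarrow> nat" where
  "minimal_resultant C =
     (\<Prod>p | prime p \<and> min_res_exponent p C > 0. p ^ min_res_exponent p C)"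

text \<open>
  The minimal resultant is positive, whereas \<open>Res C\<close> may be negative (scaling the point by
  \<open>-1\<close> does not change it), so they are compared up to sign.
\<close>

definition globally_minimal :: "sextuple \<Rightarrow> bool" where
  "globally_minimal C \<longleftrightarrow> \<bar>Res C\<bar> = int (minimal_resultant C)"


subsection \<open>Weak box densities\<close>

definition box_points :: "sextuple set \<Rightarrow> (nat \<Rightarrow> real) \<Rightarrow> sextuple set" where
  "box_points S r = {C \<in> S. \<forall>i\<in>{1..6}. real_of_int \<bar>C i\<bar> \<le> r i}"

definition box_ratio :: "sextuple set \<Rightarrow> (nat \<Rightarrow> real) \<Rightarrow> real" where
  "box_ratio S r = real (card (box_points S r)) / real (card (box_points P5Q r))"

text \<open>
  All \<open>r i\<close> with \<open>i \<in> {1..6} - {n}\<close> tend to infinity, jointly and independently;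
  the remaining values of \<open>r\<close> are unconstrained.
\<close>

definition others_at_top :: "nat \<Rightarrow> (nat \<Rightarrow> real) filter" where
  "others_at_top n = (INF i\<in>{1..6} - {n}. filtercomap (\<lambda>r. r i) at_top)"

definition weak_lower_density :: "nat \<Rightarrow> sextuple set \<Rightarrow> ereal" where
  "weak_lower_density n S =
     Liminf (others_at_top n) (\<lambda>r. Liminf at_top (\<lambda>t. ereal (box_ratio S (r(n := t)))))"

definition weak_upper_density :: "nat \<Rightarrow> sextuple set \<Rightarrow> ereal" where
  "weak_upper_density n S =
     Limsup (others_at_top n) (\<lambda>r. Limsup at_top (\<lambda>t. ereal (box_ratio S (r(n := t)))))"

definition has_weak_box_density :: "nat \<Rightarrow> sextuple set \<Rightarrow> real \<Rightarrow> bool" where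
  "has_weak_box_density n S \<mu> \<longleftrightarrow>
     weak_lower_density n S = ereal \<mu> \<and> weak_upper_density n S = ereal \<mu>"


subsection \<open>Local proportions\<close>

text \<open>
  Projective 5-space over \<open>Z/N\<close>, used for \<open>N = p\<^sup>2\<close>: sextuples of residues in \<open>{0..<N}\<close>
  generating the unit ideal, modulo multiplication by units. (For a local ring such as \<open>Z/p\<^sup>2\<close>
  these are all points of projective space.)
\<close>

definition unimodular_sextuples :: "nat \<Rightarrow> sextuple set" where
  "unimodular_sextuples N =
     {C \<in> {1..6} \<rightarrow>\<^sub>E {0..<int N}. gcd (Gcd (C ` {1..6})) (int N) = 1}"

definition proj_rel :: "nat \<Rightarrow> (sextuple \<times> sextuple) set" where
  "proj_rel N = {(C, D). C \<in> unimodular_sextuples N \<and> D \<in> unimodular_sextuples N \<and>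
     (\<exists>u. coprime u (int N) \<and> (\<forall>i\<in>{1..6}. [D i = u * C i] (mod int N)))}"

definition P5_mod :: "nat \<Rightarrow> sextuple set set" where
  "P5_mod N = unimodular_sextuples N // proj_rel N"

text \<open>\<open>Res\<close> is homogeneous, so its vanishing does not depend on the representative \<open>C\<close>.\<close>

definition local_proportion :: "nat \<Rightarrow> real" where
  "local_proportion p =
     real (card {X \<in> P5_mod (p^2). \<forall>C\<in>X. \<not> [Res C = 0] (mod int (p^2))})
       / real (card (P5_mod (p^2)))"

end

theory Submission
  imports Defs
begin

text \<open>
  Up to sign, points of projective space are primitive integer vectors, and a squarefree resultant
  forces primitivity; so the density is the quotient of the densities of the vectors with squarefree
  resultant and of the primitive vectors, and both are computed by a sieve over the primes.
  The conditions at the primes up to \<open>M\<close> are periodic and contribute products of local densities.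

  The tail of the sieve is controlled because the resultant is quadratic in each coordinate, with
  discriminant \<open>g\<^sub>1 g\<^sub>2\<^sup>2\<close>, where \<open>g\<^sub>1\<close> is the discriminant of one of the two forms and \<open>g\<^sub>2\<close> is a
  minor of the coefficient matrix. If the other coordinates are fixed, then \<open>p\<^sup>2\<close> divides
  the resultant for at most two classes modulo \<open>p\<^sup>2\<close> if \<open>p\<close> does not divide the discriminant, and for at most
  one class modulo \<open>p\<close> if it does (and \<open>p\<close> does not divide all coefficients). Only primes \<open>p = O(T)\<close> matter
  for the interval \<open>[-T, T]\<close>, and there are \<open>o(T)\<close> of them, so in the inner limit the tail is at most
  \<open>2/M\<close> plus the sum of \<open>1/p\<close> over the primes \<open>p > M\<close> dividing \<open>g\<^sub>1 g\<^sub>2\<close>. The average of this sum over a box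
  is \<open>O(1/M)\<close>, as one sees by first averaging in the direction of the longest side involved.

  Minimality: conjugation multiplies the resultant by the square of a rational number, so the
  parity of its valuation at each prime is invariant.
\<close>

section \<open>Zeros of the resultant modulo the square of a prime\<close>

text \<open>The estimate on a single line is available only once \<open>r n\<close> is large in
  terms of that line. For fixed outer sides there are finitely many lines, so taking the inner limit
  first removes this obstacle; the outer limit is joint, and what it requires is an average over
  lines that is small uniformly in the shape of the five-dimensional box. Some lines admit no
  estimate, namely those with vanishing discriminant or with two coordinates sharing a large prime.
  They get weight at least 1, which makes the trivial bound sufficient, and they are shown to be
  rare.

  The local count is exact: modulo \<open>p^2\<close> there are
  \<open>2 p^10 + p^9 - 2 p^8 - p^7 + p^6\<close> vectors with resultant 0. The factor stated for
  \<open>p \<ge> 23\<close> lies strictly below the resulting local proportion, whence the strict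
  inequality; the bound 0.327 comes from 0.9665 for the product of these factors and 0.3384 for the
  primes below 20.\<close>

lemma sum_PiE_insert:
  assumes "x \<notin> S"
  shows "(\<Sum>C\<in>PiE (insert x S) T. F C) = (\<Sum>y\<in>T x. \<Sum>g\<in>PiE S T. F (g(x := y)))"
proof -
  have "(\<Sum>C\<in>PiE (insert x S) T. F C) = (\<Sum>z\<in>T x \<times> PiE S T. F ((\<lambda>(y, g). g(x := y)) z))"
    unfolding PiE_insert_eq
    by (subst sum.reindex) (use assms in \<open>auto simp: inj_combinator\<close>)
  also have "\<dots> = (\<Sum>y\<in>T x. \<Sum>g\<in>PiE S T. F (g(x := y)))"
    by (simp add: sum.cartesian_product case_prod_unfold)
  finally show ?thesis .
qed

text \<open>For a unit \<open>u\<close> the map \<open>x -> u x + w\<close> permutes the residues;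
  the periodicity of \<open>h\<close> allows its argument to stay unreduced.\<close>

lemma sum_affine_mod:
  fixes q u w :: int
  assumes q: "q > 0" and u: "coprime u q" and h: "\<And>x. h (x mod q) = h x"
  shows "(\<Sum>x\<in>{0..<q}. h (u * x + w)) = (\<Sum>x\<in>{0..<q}. h x)"
proof -
  have inj: "inj_on (\<lambda>x. (u * x + w) mod q) {0..<q}"
  proof (rule inj_onI)
    fix x y assume xy: "x \<in> {0..<q}" "y \<in> {0..<q}" "(u * x + w) mod q = (u * y + w) mod q"
    have "q dvd u * (x - y)"
      using xy(3) by (simp add: mod_eq_dvd_iff algebra_simps)
    then have "q dvd x - y"
      using u by (simp add: coprime_commute coprime_dvd_mult_right_iff)
    then have "x mod q = y mod q"
      by (simp add: mod_eq_dvd_iff)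
    then show "x = y" using xy by simp
  qed
  have "bij_betw (\<lambda>x. (u * x + w) mod q) {0..<q} {0..<q}"
    unfolding bij_betw_def
    using inj q endo_inj_surj[of "{0..<q}" "\<lambda>x. (u * x + w) mod q"] by (simp add: image_subset_iff)
  then have "(\<Sum>x\<in>{0..<q}. h ((u * x + w) mod q)) = (\<Sum>x\<in>{0..<q}. h x)"
    by (rule sum.reindex_bij_betw)
  then show ?thesis by (simp add: h)
qed

lemma sum_of_bool_dvd:
  "q > 0 \<Longrightarrow> (\<Sum>x\<in>{0..<q::int}. of_bool (q dvd x)) = (1::int)"
proof -
  assume q: "q > 0"
  have "(\<Sum>x\<in>{0..<q}. of_bool (q dvd x)) = (\<Sum>x\<in>{0..<q}. if x = 0 then 1 else (0::int))"
    by (rule sum.cong) (use q in \<open>auto dest: zdvd_imp_le simp: zdvd_not_zless\<close>)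
  then show ?thesis using q by simp
qed

lemma sum_of_bool_dvd_affine:
  fixes q u w :: int
  assumes "q > 0" "coprime u q"
  shows "(\<Sum>x\<in>{0..<q}. of_bool (q dvd u * x + w)) = (1::int)"
  using sum_affine_mod[OF assms, of "\<lambda>x. of_bool (q dvd x) :: int" w] assms(1)
  by (simp add: sum_of_bool_dvd dvd_mod_iff del: sum_of_bool_eq)

text \<open>The resultant as \<open>s^2 - t r\<close> in the three minors of the 2 by 3 coefficient
  matrix. The ring is arbitrary because conjugation is treated over the rationals and counting over
  the integers.\<close>

definition res6 :: "'a::comm_ring_1 \<Rightarrow> 'a \<Rightarrow> 'a \<Rightarrow> 'a \<Rightarrow> 'a \<Rightarrow> 'a \<Rightarrow> 'a" where
  "res6 a b c d e f = (a * f - c * d)^2 - (a * e - b * d) * (b * f - c * e)"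

lemma Res_res6: "Res C = res6 (C 1) (C 2) (C 3) (C 4) (C 5) (C 6)"
  by (simp add: Res_def res6_def Let_def algebra_simps power2_eq_square)

text \<open>Every product in a minor contains an entry of the first row, so \<open>m\<close> divides
  all minors and \<open>m^2\<close> their products. Thus a prime dividing all coordinates shows up
  as a square divisor of the resultant.\<close>

lemma square_dvd_Res:
  assumes "\<forall>i\<in>{1..6}. m dvd C i"
  shows "m^2 dvd Res C"
proof -
  have sq: "m^2 dvd x * y" if "m dvd x" "m dvd y" for x y
    using that by (simp add: power2_eq_square mult_dvd_mono)
  have d: "m dvd C 1" "m dvd C 2" "m dvd C 3" using assms by simp_all
  show ?thesis unfolding Res_res6 res6_def power2_eq_square[of "C 1 * C 6 - C 3 * C 4"]
    by (intro dvd_diff[of "m^2"] sq dvd_diff[of m] dvd_mult2 d)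
qed

locale prime_square =
  fixes p :: int
  assumes p: "prime p"
begin

declare sum_of_bool_eq [simp del]

definition "q = p^2"
abbreviation "Z \<equiv> {0..<q}"
abbreviation "Z6 \<equiv> {1..6::nat} \<rightarrow>\<^sub>E Z"
definition "U = {x\<in>Z. \<not> p dvd x}"
definition "N = {x\<in>Z. p dvd x}"

lemma p_gt_1: "p > 1" using p by (simp add: prime_gt_1_int)
lemma q_pos: "q > 0" using p_gt_1 by (simp add: q_def)
lemma p_dvd_q: "p dvd q" by (simp add: q_def)

lemma coprime_q: "coprime u q \<longleftrightarrow> \<not> p dvd u"
  using p prime_imp_coprime[of p u]
  by (auto simp: q_def coprime_commute) (meson coprime_common_divisor dvd_refl not_prime_unit)

lemma finite_UN [simp]: "finite U" "finite N" unfolding U_def N_def by (rule finite_subset[of _ "Z"]; force)+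

lemma card_N: "int (card N) = p"
proof -
  have "N = (\<lambda>k. p * k) ` {0..<p}"
    using p_gt_1 by (auto simp: N_def q_def power2_eq_square zero_le_mult_iff elim!: dvdE)
  moreover have "inj_on (\<lambda>k. p * k) {0..<p}" using p_gt_1 by (auto simp: inj_on_def)
  ultimately show ?thesis using p_gt_1 by (simp add: card_image)
qed

lemma sum_split: "(\<Sum>x\<in>Z. h x) = (\<Sum>x\<in>U. h x) + (\<Sum>x\<in>N. h x)"
proof -
  have "Z = U \<union> N" "U \<inter> N = {}" by (auto simp: U_def N_def)
  then show ?thesis by (simp add: sum.union_disjoint)
qed

lemma card_U: "int (card U) = p^2 - p"
  using sum_split[of "\<lambda>_. 1::int"] q_pos by (simp add: card_N q_def)

lemma sum_const_q: "(\<Sum>x\<in>Z. k) = q * k" for k :: int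
  using q_pos by simp

lemma dvd_q_unit: "\<not> p dvd u \<Longrightarrow> q dvd u * x \<longleftrightarrow> q dvd x"
  using coprime_q[of u] by (simp add: coprime_commute coprime_dvd_mult_right_iff)

lemma q_dvd_prod: "p dvd x \<Longrightarrow> p dvd y \<Longrightarrow> q dvd x * y"
  unfolding q_def power2_eq_square by (rule mult_dvd_mono)

lemma q_dvd_sq: "p dvd x \<Longrightarrow> q dvd x^2"
  unfolding q_def by (rule dvd_power_same)

definition T :: "int \<Rightarrow> int \<Rightarrow> int \<Rightarrow> int" where
  "T d e f = (\<Sum>a\<in>Z. \<Sum>b\<in>Z. \<Sum>c\<in>Z. of_bool (q dvd res6 a b c d e f))"

text \<open>The expression \<open>f u^2 - e u v + d v^2\<close> is the second form evaluated at
  \<open>(v, - u)\<close>.\<close>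

definition A :: "int \<Rightarrow> int \<Rightarrow> int \<Rightarrow> int" where
  "A d e f = (\<Sum>u\<in>Z. \<Sum>v\<in>Z. of_bool (q dvd f * u^2 - e * u * v + d * v^2))"

text \<open>For each \<open>z\<close> the substitution permutes the values of \<open>x\<close> and
  of \<open>y\<close> independently, so the shifts disappear and \<open>z\<close> only contributes a
  factor \<open>q\<close>.\<close>

lemma sum_substitute:
  fixes h :: "int \<Rightarrow> int \<Rightarrow> int"
  assumes u: "\<not> p dvd u" and v: "\<not> p dvd v"
    and h: "\<And>x y. h (x mod q) y = h x y" "\<And>x y. h x (y mod q) = h x y"
  shows "(\<Sum>z\<in>Z. \<Sum>x\<in>Z. \<Sum>y\<in>Z. h (u * x + f z) (v * y + g z)) = q * (\<Sum>x\<in>Z. \<Sum>y\<in>Z. h x y)"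
proof -
  have cp: "coprime u q" "coprime v q" using u v by (simp_all add: coprime_q)
  have "(\<Sum>z\<in>Z. \<Sum>x\<in>Z. \<Sum>y\<in>Z. h (u * x + f z) (v * y + g z)) = (\<Sum>z\<in>Z. \<Sum>x\<in>Z. \<Sum>y\<in>Z. h (u * x + f z) y)"
    by (intro sum.cong refl sum_affine_mod q_pos cp h)
  also have "\<dots> = (\<Sum>z\<in>Z. \<Sum>y\<in>Z. \<Sum>x\<in>Z. h x y)"
    by (subst (2) sum.swap, intro sum.cong refl sum_affine_mod q_pos cp h)
  also have "\<dots> = q * (\<Sum>y\<in>Z. \<Sum>x\<in>Z. h x y)"
    by (rule sum_const_q)
  also have "(\<Sum>y\<in>Z. \<Sum>x\<in>Z. h x y) = (\<Sum>x\<in>Z. \<Sum>y\<in>Z. h x y)"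
    by (rule sum.swap)
  finally show ?thesis .
qed

text \<open>
  For fixed second form with \<open>f\<close> a unit, \<open>f Res = f u\<^sup>2 - e u v + d v\<^sup>2\<close> in the minors
  \<open>u = a f - c d\<close> and \<open>v = b f - c e\<close>, which run independently through all residues.
\<close>

lemma T_f_unit:
  assumes "\<not> p dvd f"
  shows "T d e f = q * A d e f"
proof -
  define h where "h u v = (of_bool (q dvd f * u^2 - e * u * v + d * v^2) :: int)" for u v
  have hm: "h (u mod q) v = h u v" "h u (v mod q) = h u v" for u v
    unfolding h_def
    by (intro arg_cong[of _ _ of_bool] cong_dvd_iff cong_add cong_diff cong_mult cong_pow cong_refl; simp)+
  have eq: "of_bool (q dvd res6 a b c d e f) = h (f * a + (- c * d)) (f * b + (- c * e))" for a b c
  proof -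
    have "f * res6 a b c d e f = f * (f * a + (- c * d))^2 - e * (f * a + (- c * d)) * (f * b + (- c * e))
        + d * (f * b + (- c * e))^2"
      unfolding res6_def by (simp add: algebra_simps power2_eq_square)
    then show ?thesis unfolding h_def using dvd_q_unit[OF assms, of "res6 a b c d e f"] by simp
  qed
  have "T d e f = (\<Sum>c\<in>Z. \<Sum>a\<in>Z. \<Sum>b\<in>Z. h (f * a + (- c * d)) (f * b + (- c * e)))"
    unfolding T_def eq by (subst sum.swap, subst (2) sum.swap, rule refl)
  also have "\<dots> = q * A d e f"
    unfolding A_def h_def[symmetric] by (rule sum_substitute) (use assms hm in auto)
  finally show ?thesis .
qed

text \<open>Exchanging \<open>X\<close> and \<open>Y\<close> reverses both rows of coefficients and
  fixes the resultant; this reduces a unit \<open>d\<close> to the case of a unit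
  \<open>f\<close>.\<close>

lemma T_sym: "T d e f = T f e d"
proof -
  have eq: "res6 a b c d e f = res6 c b a f e d" for a b c
    by (simp add: res6_def algebra_simps power2_eq_square)
  have "T d e f = (\<Sum>a\<in>Z. \<Sum>c\<in>Z. \<Sum>b\<in>Z. of_bool (q dvd res6 c b a f e d))"
    unfolding T_def eq by (rule sum.cong[OF refl], rule sum.swap)
  also have "\<dots> = (\<Sum>c\<in>Z. \<Sum>a\<in>Z. \<Sum>b\<in>Z. of_bool (q dvd res6 c b a f e d))"
    by (rule sum.swap)
  also have "\<dots> = T f e d"
    unfolding T_def by (rule sum.cong[OF refl], rule sum.swap)
  finally show ?thesis .
qed

lemma T_d_unit: "\<not> p dvd d \<Longrightarrow> T d e f = q * A f e d"
  using T_f_unit[of d f e] T_sym[of d e f] by simp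

text \<open>Modulo \<open>p\<close> the second form is \<open>e X Y\<close>, so \<open>p\<close>
  divides the minor \<open>a f - c d\<close>, and its square drops out modulo \<open>p^2\<close>.
  What remains is the product of the two other minors, which are affine in \<open>a\<close> and in
  \<open>c\<close> with unit coefficients.\<close>

lemma T_e_unit:
  assumes e: "\<not> p dvd e" and d: "p dvd d" and f: "p dvd f"
  shows "T d e f = q * (\<Sum>u\<in>Z. \<Sum>v\<in>Z. of_bool (q dvd u * v))"
proof -
  define h where "h u v = (of_bool (q dvd u * v) :: int)" for u v
  have hm: "h (u mod q) v = h u v" "h u (v mod q) = h u v" for u v
    unfolding h_def
    by (intro arg_cong[of _ _ of_bool] cong_dvd_iff cong_add cong_diff cong_mult cong_pow cong_refl; simp)+
  have eq: "of_bool (q dvd res6 a b c d e f) = h (e * a + (- b * d)) (- e * c + b * f)" for a b c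
  proof -
    \<comment> \<open>This rests on
      \<open>e (a f - c d) = d (b f - c e) + f (a e - b d)\<close>.\<close>
    have "e^2 * res6 a b c d e f = (d * (b * f - c * e) + f * (a * e - b * d))^2 -
        e^2 * ((e * a + (- b * d)) * (- e * c + b * f))"
      unfolding res6_def by (simp add: algebra_simps power2_eq_square)
    moreover have "q dvd (d * (b * f - c * e) + f * (a * e - b * d))^2"
      using d f by (intro q_dvd_sq) auto
    ultimately have "q dvd e^2 * res6 a b c d e f \<longleftrightarrow> q dvd e^2 * ((e * a + (- b * d)) * (- e * c + b * f))"
      by (metis dvd_diff_commute diff_0_right dvd_diff_right_iff)
    moreover have "\<not> p dvd e^2" using e p by (simp add: prime_dvd_power_iff)
    ultimately show ?thesis unfolding h_def using dvd_q_unit[of "e^2"] by simp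
  qed
  have "T d e f = (\<Sum>b\<in>Z. \<Sum>a\<in>Z. \<Sum>c\<in>Z. h (e * a + (- b * d)) (- e * c + b * f))"
    unfolding T_def eq by (rule sum.swap)
  also have "\<dots> = q * (\<Sum>u\<in>Z. \<Sum>v\<in>Z. h u v)"
    by (rule sum_substitute) (use e hm in auto)
  finally show ?thesis unfolding h_def .
qed

lemma T_non_unit:
  assumes "p dvd e" "p dvd d" "p dvd f"
  shows "T d e f = q^3"
proof -
  have "q dvd res6 a b c d e f" for a b c
    unfolding res6_def by (intro dvd_diff q_dvd_sq q_dvd_prod) (use assms in auto)
  then show ?thesis unfolding T_def using q_pos by (simp add: power3_eq_cube)
qed

text \<open>A unit \<open>u\<close> forces \<open>v = 0\<close>, \<open>u = 0\<close> allows every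
  \<open>v\<close>, and for the other \<open>p - 1\<close> multiples \<open>u\<close> of
  \<open>p\<close> the condition is that \<open>p\<close> divides \<open>v\<close>.\<close>

lemma sum_uv: "(\<Sum>u\<in>Z. \<Sum>v\<in>Z. of_bool (q dvd u * v)) = 3 * p^2 - 2 * p"
proof -
  have u: "(\<Sum>v\<in>Z. of_bool (q dvd u * v)) = (1::int)" if "u \<in> U" for u
    using sum_of_bool_dvd_affine[OF q_pos, of u 0] that by (simp add: U_def coprime_q)
  have n: "(\<Sum>v\<in>Z. of_bool (q dvd u * v)) = of_bool (q dvd u) * (p^2 - p) + p" if "u \<in> N" for u
  proof -
    have "(\<Sum>v\<in>U. of_bool (q dvd u * v)) = (\<Sum>v\<in>U. of_bool (q dvd u) :: int)"
      by (rule sum.cong) (auto simp: U_def dvd_q_unit mult.commute[of u])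
    moreover have "(\<Sum>v\<in>N. of_bool (q dvd u * v)) = (\<Sum>v\<in>N. 1::int)"
      by (rule sum.cong) (use that in \<open>auto simp: N_def q_dvd_prod\<close>)
    ultimately show ?thesis by (simp add: sum_split card_U card_N)
  qed
  have "(\<Sum>u\<in>U. of_bool (q dvd u)) = (0::int)"
    by (rule sum.neutral) (auto simp: U_def dest: dvd_trans[OF p_dvd_q])
  then have n1: "(\<Sum>u\<in>N. of_bool (q dvd u)) = (1::int)"
    using sum_of_bool_dvd[OF q_pos] by (simp add: sum_split)
  have "(\<Sum>u\<in>Z. \<Sum>v\<in>Z. of_bool (q dvd u * v)) = (\<Sum>u\<in>U. 1) + (\<Sum>u\<in>N. of_bool (q dvd u) * (p^2 - p) + p)"
    using u n by (subst sum_split) simp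
  also have "\<dots> = (p^2 - p) + (p^2 - p) + p * p"
    by (simp add: card_U card_N sum.distrib n1 flip: sum_distrib_right)
  finally show ?thesis by (simp add: power2_eq_square)
qed

text \<open>Summing over \<open>d\<close> first makes the congruence linear with coefficient
  \<open>v^2\<close>: one solution for a unit \<open>v\<close>, none if \<open>p\<close> divides
  \<open>v\<close> but not \<open>u\<close>, all \<open>d\<close> if \<open>p\<close> divides
  both.\<close>

lemma sum_A_f_unit:
  assumes f: "\<not> p dvd f"
  shows "(\<Sum>d\<in>Z. A d e f) = q * (2 * p^2 - p)"
proof -
  let ?Q = "\<lambda>u v d. f * u^2 - e * u * v + d * v^2"
  define G where "G u v = (\<Sum>d\<in>Z. of_bool (q dvd ?Q u v d) :: int)" for u v
  have G_U: "G u v = 1" if "v \<in> U" for u v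
  proof -
    have "G u v = (\<Sum>d\<in>Z. of_bool (q dvd v^2 * d + (f * u^2 - e * u * v)))"
      unfolding G_def by (simp add: algebra_simps)
    also have "\<dots> = 1"
      by (rule sum_of_bool_dvd_affine) (use that p in \<open>auto simp: q_pos coprime_q U_def prime_dvd_power_iff\<close>)
    finally show ?thesis .
  qed
  have G_UN: "G u v = 0" if "v \<in> N" "u \<in> U" for u v
  proof -
    have "\<not> q dvd ?Q u v d" for d
    proof
      assume "q dvd ?Q u v d"
      then have "p dvd ?Q u v d" using p_dvd_q dvd_trans by blast
      moreover have "p dvd e * u * v" "p dvd d * v^2"
        using that by (auto simp: N_def power2_eq_square)
      ultimately have "p dvd f * u^2"
        by (metis diff_add_cancel dvd_add dvd_add_left_iff)
      then show False using f that p by (auto simp: U_def prime_dvd_mult_iff prime_dvd_power_iff)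
    qed
    then show ?thesis by (simp add: G_def)
  qed
  have G_NN: "G u v = q" if "v \<in> N" "u \<in> N" for u v
  proof -
    have "q dvd ?Q u v d" for d
      using that by (intro dvd_add dvd_diff dvd_mult q_dvd_sq q_dvd_prod) (auto simp: N_def)
    then show ?thesis using q_pos by (simp add: G_def)
  qed
  have "(\<Sum>d\<in>Z. A d e f) = (\<Sum>u\<in>Z. \<Sum>v\<in>Z. G u v)"
    unfolding A_def G_def by (subst sum.swap, subst (2) sum.swap, rule refl)
  also have "\<dots> = (\<Sum>u\<in>U. (\<Sum>v\<in>U. 1) + (\<Sum>v\<in>N. 0)) + (\<Sum>u\<in>N. (\<Sum>v\<in>U. 1) + (\<Sum>v\<in>N. q))"
    unfolding sum_split using G_U G_UN G_NN by simp
  also have "\<dots> = (p^2 - p) * (p^2 - p) + p * ((p^2 - p) + p * q)"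
    by (simp add: card_U card_N)
  finally show ?thesis by (simp add: q_def algebra_simps power2_eq_square)
qed

text \<open>Only multiples \<open>f\<close> of \<open>p\<close> are summed, since unit
  \<open>f\<close> is counted separately. For a unit \<open>v\<close> a solution \<open>f\<close> of
  this kind exists exactly when \<open>p\<close> divides \<open>d u^2 - e u v\<close>, and it is
  then unique. That condition holds for \<open>p\<close> residues \<open>e\<close> if
  \<open>u\<close> is a unit, and for all of them if \<open>p\<close> divides
  \<open>u\<close>.\<close>

lemma sum_A_d_unit:
  assumes d: "\<not> p dvd d"
  shows "(\<Sum>e\<in>Z. \<Sum>f\<in>N. A f e d) = (p^2 - p) * (p * q + (p^2 - p) * p) + q * p^3"
proof -
  define G where "G u v = (\<Sum>e\<in>Z. \<Sum>f\<in>N. of_bool (q dvd d * u^2 - e * u * v + f * v^2) :: int)" for u v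
  have inner: "(\<Sum>f\<in>N. of_bool (q dvd d * u^2 - e * u * v + f * v^2) :: int) = of_bool (p dvd d * u^2 - e * u * v)"
    if v: "v \<in> U" for u v e
  proof -
    have v2: "\<not> p dvd v^2" using v p by (auto simp: U_def prime_dvd_power_iff)
    define s where "s = d * u^2 - e * u * v"
    have iff: "p dvd f \<longleftrightarrow> p dvd s" if "q dvd s + f * v^2" for f
    proof -
      have "p dvd s + f * v^2" using that p_dvd_q dvd_trans by blast
      then have "p dvd s \<longleftrightarrow> p dvd f * v^2"
        using dvd_add_right_iff dvd_add_left_iff by blast
      then show ?thesis using v2 p by (simp add: prime_dvd_mult_iff)
    qed
    have "(\<Sum>f\<in>N. of_bool (q dvd s + f * v^2)) = (\<Sum>f\<in>N. of_bool (p dvd f) * of_bool (q dvd s + f * v^2) :: int)"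
      by (rule sum.cong) (auto simp: N_def)
    also have "\<dots> = (\<Sum>f\<in>Z. of_bool (p dvd f) * of_bool (q dvd s + f * v^2))"
    proof -
      have "(\<Sum>f\<in>U. of_bool (p dvd f) * of_bool (q dvd s + f * v^2)) = (0::int)"
        by (rule sum.neutral) (auto simp: U_def)
      then show ?thesis by (simp add: sum_split)
    qed
    also have "\<dots> = (\<Sum>f\<in>Z. of_bool (p dvd s) * of_bool (q dvd v^2 * f + s))"
      by (rule sum.cong) (use iff in \<open>auto simp: algebra_simps\<close>)
    also have "\<dots> = of_bool (p dvd s)"
      unfolding sum_distrib_left[symmetric]
      by (subst sum_of_bool_dvd_affine) (use v2 in \<open>auto simp: q_pos coprime_q\<close>)
    finally show ?thesis unfolding s_def .
  qed
  have G_UU: "G u v = p" if "v \<in> U" "u \<in> U" for u v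
  proof -
    have "G u v = (\<Sum>e\<in>Z. of_bool (p dvd - (u * v) * e + d * u^2))"
      unfolding G_def inner[OF that(1)] by (simp add: algebra_simps)
    also have "\<dots> = (\<Sum>e\<in>Z. of_bool (p dvd e))"
    proof (rule sum_affine_mod[of _ _ "\<lambda>x. of_bool (p dvd x)"])
      show "coprime (- (u * v)) q" using that p by (auto simp: coprime_q U_def prime_dvd_mult_iff)
      show "of_bool (p dvd x mod q) = (of_bool (p dvd x) :: int)" for x
        using p_dvd_q by (simp add: dvd_mod_iff)
    qed (rule q_pos)
    also have "\<dots> = (\<Sum>e\<in>U. 0) + (\<Sum>e\<in>N. 1)"
      unfolding sum_split by (intro arg_cong2[of _ _ _ _ "(+)"] sum.cong) (auto simp: U_def N_def)
    finally show ?thesis by (simp add: card_N)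
  qed
  have G_UN: "G u v = q" if "v \<in> U" "u \<in> N" for u v
  proof -
    have "G u v = (\<Sum>e\<in>Z. 1)"
      unfolding G_def inner[OF that(1)]
      by (rule sum.cong) (use that(2) in \<open>auto simp: N_def power2_eq_square\<close>)
    then show ?thesis using q_pos by simp
  qed
  have G_NU: "G u v = 0" if "v \<in> N" "u \<in> U" for u v
  proof -
    have "\<not> q dvd d * u^2 - e * u * v + f * v^2" for e f
    proof
      assume "q dvd d * u^2 - e * u * v + f * v^2"
      then have "p dvd d * u^2 - e * u * v + f * v^2" using p_dvd_q dvd_trans by blast
      moreover have "p dvd e * u * v" "p dvd f * v^2"
        using that by (auto simp: N_def power2_eq_square)
      ultimately have "p dvd d * u^2"
        by (metis diff_add_cancel dvd_add dvd_add_left_iff)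
      then show False using d that p by (auto simp: U_def prime_dvd_mult_iff prime_dvd_power_iff)
    qed
    then show ?thesis by (simp add: G_def)
  qed
  have G_NN: "G u v = q * p" if "v \<in> N" "u \<in> N" for u v
  proof -
    have "q dvd d * u^2 - e * u * v + f * v^2" for e f
      using that by (intro dvd_add dvd_diff dvd_mult q_dvd_sq q_dvd_prod) (auto simp: N_def)
    then show ?thesis using q_pos card_N by (simp add: G_def)
  qed
  have "(\<Sum>e\<in>Z. \<Sum>f\<in>N. A f e d) = (\<Sum>u\<in>Z. \<Sum>v\<in>Z. G u v)"
  proof -
    have "(\<Sum>e\<in>Z. \<Sum>f\<in>N. A f e d) = (\<Sum>e\<in>Z. \<Sum>u\<in>Z. \<Sum>v\<in>Z. \<Sum>f\<in>N. of_bool (q dvd d * u^2 - e * u * v + f * v^2))"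
      unfolding A_def by (subst (2) sum.swap, subst (3) sum.swap, rule refl)
    also have "\<dots> = (\<Sum>u\<in>Z. \<Sum>v\<in>Z. G u v)"
      unfolding G_def by (subst sum.swap, subst (2) sum.swap, rule refl)
    finally show ?thesis .
  qed
  also have "\<dots> = (\<Sum>u\<in>U. (\<Sum>v\<in>U. p) + (\<Sum>v\<in>N. 0)) + (\<Sum>u\<in>N. (\<Sum>v\<in>U. q) + (\<Sum>v\<in>N. q * p))"
    unfolding sum_split using G_UU G_UN G_NN G_NU by simp
  also have "\<dots> = (p^2 - p) * ((p^2 - p) * p) + p * ((p^2 - p) * q + p * (q * p))"
    by (simp add: card_U card_N)
  finally show ?thesis by (simp add: algebra_simps power3_eq_cube)
qed

text \<open>Second forms are sorted by the first unit among \<open>f\<close>, \<open>d\<close>,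
  \<open>e\<close>, with one remaining case where \<open>p\<close> divides all three.\<close>

lemma sum_T:
  "(\<Sum>d\<in>Z. \<Sum>e\<in>Z. \<Sum>f\<in>Z. T d e f) =
     2 * p^10 + p^9 - 2 * p^8 - p^7 + p^6"
proof -
  let ?S = "\<lambda>X Y W. \<Sum>d\<in>X. \<Sum>e\<in>Y. \<Sum>f\<in>W. T d e f"
  have f: "?S Z Z U = (p^2 - p) * (q * (q * (q * (2 * p^2 - p))))"
  proof -
    have "?S Z Z U = (\<Sum>f\<in>U. \<Sum>e\<in>Z. \<Sum>d\<in>Z. T d e f)"
      by (subst sum.swap, subst (2) sum.swap, rule sum.swap)
    also have "\<dots> = (\<Sum>f\<in>U. \<Sum>e\<in>Z. q * (q * (2 * p^2 - p)))"
    proof (intro sum.cong refl)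
      fix e f assume "f \<in> U"
      then have "\<not> p dvd f" by (simp add: U_def)
      then show "(\<Sum>d\<in>Z. T d e f) = q * (q * (2 * p^2 - p))"
        by (simp add: T_f_unit sum_A_f_unit flip: sum_distrib_left)
    qed
    finally show ?thesis using q_pos by (simp add: card_U)
  qed
  have d: "?S U Z N = (p^2 - p) * (q * ((p^2 - p) * (p * q + (p^2 - p) * p) + q * p^3))"
  proof -
    have "(\<Sum>e\<in>Z. \<Sum>f\<in>N. T d e f) = q * ((p^2 - p) * (p * q + (p^2 - p) * p) + q * p^3)" if "d \<in> U" for d
    proof -
      have "\<not> p dvd d" using that by (simp add: U_def)
      then show ?thesis by (simp add: T_d_unit sum_A_d_unit flip: sum_distrib_left)
    qed
    then show ?thesis by (simp add: card_U)
  qed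
  have e: "?S N U N = p * ((p^2 - p) * (p * (q * (3 * p^2 - 2 * p))))"
  proof -
    have "T d e f = q * (3 * p^2 - 2 * p)" if "d \<in> N" "e \<in> U" "f \<in> N" for d e f
      using that by (subst T_e_unit) (auto simp: U_def N_def sum_uv)
    then show ?thesis by (simp add: card_U card_N)
  qed
  have n: "?S N N N = p * (p * (p * q^3))"
  proof -
    have "T d e f = q^3" if "d \<in> N" "e \<in> N" "f \<in> N" for d e f
      using that by (subst T_non_unit) (auto simp: N_def)
    then show ?thesis by (simp add: card_N)
  qed
  have "?S Z Z Z =
      ?S Z Z U + ?S Z Z N"
    by (subst sum_split) (simp add: sum.distrib)
  also have "?S Z Z N =
      ?S U Z N + ?S N Z N"
    by (rule sum_split)
  also have "?S N Z N =
      ?S N U N + ?S N N N"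
    by (subst sum_split) (simp add: sum.distrib)
  finally have total: "?S Z Z Z =
      ?S Z Z U +
      (?S U Z N +
       (?S N U N + ?S N N N))" .
  show ?thesis
    unfolding total f d e n unfolding q_def by (simp add: algebra_simps eval_nat_numeral)
qed

lemma card_Res_zero:
  "int (card {C \<in> {1..6} \<rightarrow>\<^sub>E Z. q dvd Res C}) = 2 * p^10 + p^9 - 2 * p^8 - p^7 + p^6"
proof -
  \<comment> \<open>This order of the indices puts the sums over the second form outermost, as in
    \<open>sum_T\<close>.\<close>
  have I: "{1..6::nat} = insert 4 (insert 5 (insert 6 (insert 1 (insert 2 (insert 3 {})))))" by auto
  have "int (card {C \<in> {1..6} \<rightarrow>\<^sub>E Z. q dvd Res C}) = (\<Sum>C\<in>{1..6} \<rightarrow>\<^sub>E Z. of_bool (q dvd Res C))"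
    by (subst sum_of_bool_eq) (auto intro!: finite_PiE simp: Int_def)
  also have "\<dots> = (\<Sum>d\<in>Z. \<Sum>e\<in>Z. \<Sum>f\<in>Z. T d e f)"
    unfolding I T_def by (subst sum_PiE_insert, simp)+ (simp add: Res_res6)
  finally show ?thesis by (simp add: sum_T)
qed

end

section \<open>Local proportions\<close>

context prime_square
begin

lemma unimodular_iff:
  "gcd (Gcd (C ` {1..6::nat})) q = 1 \<longleftrightarrow> (\<exists>i\<in>{1..6}. \<not> p dvd C i)"
proof -
  have "gcd (Gcd (C ` {1..6})) q = 1 \<longleftrightarrow> coprime (Gcd (C ` {1..6})) q"
    by (simp add: coprime_iff_gcd_eq_1)
  also have "\<dots> \<longleftrightarrow> \<not> p dvd Gcd (C ` {1..6})" by (rule coprime_q)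
  also have "\<dots> \<longleftrightarrow> (\<exists>i\<in>{1..6}. \<not> p dvd C i)" by (auto simp: dvd_Gcd_iff)
  finally show ?thesis .
qed

end

context
  fixes P :: nat
  assumes P: "prime P"
begin

interpretation prime_square "int P"
  by standard (use P in simp)

abbreviation "unimod \<equiv> unimodular_sextuples (P^2)"

lemma unimodular_eq: "unimod = {C \<in> Z6. \<exists>i\<in>{1..6}. \<not> int P dvd C i}"
  using unimodular_iff by (simp add: unimodular_sextuples_def q_def)

lemma card_unimodular: "int (card unimod) = int P^12 - int P^6"
proof -
  have "int (card Z6) = q^6"
    using q_pos by (simp add: card_PiE)
  moreover have "int (card ({1..6::nat} \<rightarrow>\<^sub>E N)) = int P^6"
    by (simp add: card_PiE card_N)
  moreover have "unimod = Z6 - ({1..6::nat} \<rightarrow>\<^sub>E N)"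
  proof (intro equalityI subsetI)
    fix C assume "C \<in> unimod"
    then obtain i where "C \<in> Z6" and i: "i \<in> {1..6}" "\<not> int P dvd C i"
      unfolding unimodular_eq by blast
    moreover from i have "C \<notin> {1..6::nat} \<rightarrow>\<^sub>E N" unfolding N_def by blast
    ultimately show "C \<in> Z6 - ({1..6} \<rightarrow>\<^sub>E N)" by blast
  next
    fix C assume C: "C \<in> Z6 - ({1..6} \<rightarrow>\<^sub>E N)"
    then have "\<exists>i\<in>{1..6}. C i \<notin> N" by (metis DiffE PiE_iff)
    then obtain i where "i \<in> {1..6}" "C i \<notin> N" by blast
    moreover from this C have "C i \<in> Z" by blast
    ultimately show "C \<in> unimod"
      using C unfolding unimodular_eq N_def by blast
  qed
  moreover have "({1..6::nat} \<rightarrow>\<^sub>E N) \<subseteq> Z6"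
    by (rule PiE_mono) (auto simp: N_def)
  moreover have "finite ({1..6::nat} \<rightarrow>\<^sub>E N)" "finite Z6"
    by (intro finite_PiE; simp)+
  moreover have "P^6 \<le> P^12" using prime_gt_0_nat[OF P] by (intro power_increasing) auto
  ultimately show ?thesis
    by (simp add: card_Diff_subset of_nat_diff q_def flip: power_mult)
qed

text \<open>A vector that is not unimodular has resultant divisible by \<open>p^2\<close>, so the
  count over all residue vectors applies without correction.\<close>

lemma card_unimodular_good:
  "int (card {C \<in> unimod. \<not> q dvd Res C}) =
     int P^12 - (2 * int P^10 + int P^9 - 2 * int P^8 - int P^7 + int P^6)"
proof -
  have fin: "finite Z6" by (intro finite_PiE) auto
  have "{C \<in> unimod. \<not> q dvd Res C} =
      Z6 - {C \<in> Z6. q dvd Res C}"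
    unfolding unimodular_eq q_def using square_dvd_Res[of "int P"] by blast
  moreover have "int (card Z6) = q^6"
    using q_pos by (simp add: card_PiE)
  ultimately show ?thesis
    using card_Res_zero fin card_mono[OF fin, of "{C \<in> Z6. q dvd Res C}"]
    by (simp add: card_Diff_subset of_nat_diff q_def subset_iff flip: power_mult)
qed

text \<open>Reducing the scalar modulo \<open>p^2\<close> exhibits every class as an orbit under the
  finite set \<open>U\<close>.\<close>

lemma proj_rel_iff:
  "(C, D) \<in> proj_rel (P^2) \<longleftrightarrow> C \<in> unimod \<and> D \<in> unimod \<and>
     (\<exists>u\<in>U. \<forall>i\<in>{1..6}. D i = u * C i mod q)"
proof -
  have "(\<exists>u. coprime u q \<and> (\<forall>i\<in>{1..6}. [D i = u * C i] (mod q))) \<longleftrightarrow>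
      (\<exists>u\<in>U. \<forall>i\<in>{1..6}. D i = u * C i mod q)" if D: "D \<in> unimod"
  proof -
    have Dm: "D i mod q = D i" if "i \<in> {1..6}" for i
    proof -
      have "D i \<in> Z" using D that unfolding unimodular_eq by blast
      then show ?thesis by simp
    qed
    show ?thesis
    proof
      assume "\<exists>u. coprime u q \<and> (\<forall>i\<in>{1..6}. [D i = u * C i] (mod q))"
      then obtain u where u: "coprime u q" "\<forall>i\<in>{1..6}. [D i = u * C i] (mod q)" by blast
      have "u mod q \<in> U" using u(1) q_pos p_dvd_q by (simp add: U_def coprime_q dvd_mod_iff)
      moreover have "\<forall>i\<in>{1..6}. D i = (u mod q) * C i mod q"
        using u(2) Dm by (simp add: cong_def mod_simps)
      ultimately show "\<exists>u\<in>U. \<forall>i\<in>{1..6}. D i = u * C i mod q" by blast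
    next
      assume "\<exists>u\<in>U. \<forall>i\<in>{1..6}. D i = u * C i mod q"
      then show "\<exists>u. coprime u q \<and> (\<forall>i\<in>{1..6}. [D i = u * C i] (mod q))"
        by (auto simp: U_def coprime_q cong_def)
    qed
  qed
  then show ?thesis by (auto simp: proj_rel_def q_def)
qed

lemma unit_inverse: assumes "u \<in> U" obtains v where "v \<in> U" "[v * u = 1] (mod q)"
proof -
  have "coprime u q" using assms by (simp add: U_def coprime_q)
  then obtain v where v: "[u * v = 1] (mod q)" using cong_solve_coprime_int by blast
  then have "coprime v q" by (metis coprime_iff_invertible_int mult.commute)
  then have "v mod q \<in> U" using q_pos p_dvd_q by (simp add: U_def coprime_q dvd_mod_iff)
  moreover have "[(v mod q) * u = 1] (mod q)" using v by (simp add: cong_def mod_simps mult.commute)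
  ultimately show ?thesis using that by blast
qed

lemma scale_unimodular:
  assumes "C \<in> unimod" "u \<in> U"
  shows "restrict (\<lambda>i. u * C i mod q) {1..6} \<in> unimod"
proof -
  obtain i where i: "i \<in> {1..6}" "\<not> int P dvd C i" using assms(1) unfolding unimodular_eq by blast
  then have "\<not> int P dvd u * C i mod q"
    using assms(2) p p_dvd_q by (simp add: U_def dvd_mod_iff prime_dvd_mult_iff)
  then show ?thesis using i(1) q_pos unfolding unimodular_eq by auto
qed

lemma equiv_proj_rel: "equiv unimod (proj_rel (P^2))"
proof (rule equivI)
  have one: "1 \<in> U" using p_gt_1 by (auto simp: U_def q_def)
  have m: "C i mod q = C i" if "C \<in> unimod" "i \<in> {1..6}" for C i
  proof -
    have "C i \<in> Z" using that unfolding unimodular_eq by blast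
    then show ?thesis by simp
  qed
  show "refl_on unimod (proj_rel (P^2))"
    by (rule refl_onI) (use one m in \<open>auto simp: proj_rel_iff intro!: bexI[of _ 1]\<close>)
  show "sym (proj_rel (P^2))"
  proof (rule symI)
    fix C D assume "(C, D) \<in> proj_rel (P^2)"
    then obtain u where CD: "C \<in> unimod" "D \<in> unimod"
      and u: "u \<in> U" "\<forall>i\<in>{1..6}. D i = u * C i mod q" by (auto simp: proj_rel_iff)
    obtain v where v: "v \<in> U" "[v * u = 1] (mod q)" using unit_inverse[OF u(1)] .
    have "C i = v * D i mod q" if "i \<in> {1..6}" for i
    proof -
      have "v * D i mod q = (v * u) * C i mod q"
        using u(2) that by (simp add: mod_simps mult.assoc)
      also have "\<dots> = 1 * C i mod q"
        using v(2) unfolding cong_def by (metis mod_mult_left_eq)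
      finally show ?thesis using m[OF CD(1) that] by simp
    qed
    then show "(D, C) \<in> proj_rel (P^2)" using CD v(1) by (auto simp: proj_rel_iff)
  qed
  show "trans (proj_rel (P^2))"
  proof (rule transI)
    fix C D E assume "(C, D) \<in> proj_rel (P^2)" "(D, E) \<in> proj_rel (P^2)"
    then obtain u v where CD: "C \<in> unimod" "E \<in> unimod"
      and u: "u \<in> U" "\<forall>i\<in>{1..6}. D i = u * C i mod q"
      and v: "v \<in> U" "\<forall>i\<in>{1..6}. E i = v * D i mod q" by (auto simp: proj_rel_iff)
    have "v * u mod q \<in> U"
      using u(1) v(1) q_pos p p_dvd_q by (simp add: U_def dvd_mod_iff prime_dvd_mult_iff)
    moreover have "\<forall>i\<in>{1..6}. E i = (v * u mod q) * C i mod q"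
      using u(2) v(2) by (simp add: mod_simps mult.assoc)
    ultimately show "(C, E) \<in> proj_rel (P^2)" using CD by (auto simp: proj_rel_iff)
  qed
qed (auto simp: proj_rel_iff)

text \<open>The units act freely: a unimodular vector has a coordinate prime to \<open>p\<close>,
  and this coordinate determines the scalar.\<close>

lemma card_proj_class:
  assumes "X \<in> P5_mod (P^2)"
  shows "card X = card U"
proof -
  obtain C where C: "C \<in> unimod" and X: "X = proj_rel (P^2) `` {C}"
    using assms unfolding P5_mod_def by (elim quotientE)
  have "X = (\<lambda>u. restrict (\<lambda>i. u * C i mod q) {1..6}) ` U" (is "_ = ?f ` U")
  proof (intro equalityI subsetI)
    fix D assume "D \<in> X"
    then obtain u where D: "D \<in> unimod" and u: "u \<in> U" "\<forall>i\<in>{1..6}. D i = u * C i mod q"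
      unfolding X by (auto simp: proj_rel_iff)
    have "D = ?f u"
      by (rule PiE_ext[of _ "{1..6}" "\<lambda>_. Z"]) (use D u q_pos in \<open>auto simp: unimodular_eq\<close>)
    then show "D \<in> ?f ` U" using u(1) by blast
  next
    fix D assume "D \<in> ?f ` U"
    then obtain u where "u \<in> U" "D = ?f u" by blast
    then show "D \<in> X" unfolding X using scale_unimodular[OF C, of u] C by (auto simp: proj_rel_iff)
  qed
  moreover have "inj_on ?f U"
  proof (rule inj_onI)
    fix u v assume uv: "u \<in> U" "v \<in> U" "?f u = ?f v"
    obtain i where i: "i \<in> {1..6}" "\<not> int P dvd C i" using C unfolding unimodular_eq by blast
    have "u * C i mod q = v * C i mod q" using fun_cong[OF uv(3), of i] i(1) by simp
    then have "q dvd C i * (u - v)" by (simp add: mod_eq_dvd_iff algebra_simps)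
    then have "q dvd u - v" using dvd_q_unit[OF i(2)] by simp
    then have "u mod q = v mod q" by (simp add: mod_eq_dvd_iff)
    then show "u = v" using uv by (simp add: U_def)
  qed
  ultimately show ?thesis by (simp add: card_image)
qed

lemma Res_class:
  assumes "(C, D) \<in> proj_rel (P^2)"
  shows "q dvd Res D \<longleftrightarrow> q dvd Res C"
proof -
  obtain u where u: "u \<in> U" "\<forall>i\<in>{1..6}. D i = u * C i mod q" using assms by (auto simp: proj_rel_iff)
  have c: "[D i = u * C i] (mod q)" if "i \<in> {1..6}" for i using u(2) that by (simp add: cong_def)
  have "[Res D = res6 (u * C 1) (u * C 2) (u * C 3) (u * C 4) (u * C 5) (u * C 6)] (mod q)"
    unfolding Res_res6 res6_def by (intro cong_diff cong_pow cong_mult c) auto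
  also have "res6 (u * C 1) (u * C 2) (u * C 3) (u * C 4) (u * C 5) (u * C 6) = u^4 * Res C"
    unfolding Res_res6 res6_def by (simp add: algebra_simps eval_nat_numeral)
  finally have "q dvd Res D \<longleftrightarrow> q dvd u^4 * Res C" by (rule cong_dvd_iff)
  moreover have "\<not> int P dvd u^4" using u(1) p by (simp add: U_def prime_dvd_power_iff)
  ultimately show ?thesis by (simp add: dvd_q_unit)
qed

lemma card_union_classes:
  assumes "\<X> \<subseteq> P5_mod (P^2)"
  shows "card (\<Union>\<X>) = card U * card \<X>"
proof (rule card_partition[symmetric])
  have fin: "finite unimod"
    unfolding unimodular_eq by (rule finite_subset[OF _ finite_PiE[of "{1..6}" "\<lambda>_. Z"]]) auto
  have "finite (P5_mod (P^2))"
    unfolding P5_mod_def by (rule finite_quotient[OF fin]) (auto simp: proj_rel_def)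
  then show "finite \<X>" using assms by (rule rev_finite_subset)
  have "\<Union>\<X> \<subseteq> unimod"
    using Union_mono[OF assms] Union_quotient[OF equiv_proj_rel] unfolding P5_mod_def by simp
  then show "finite (\<Union>\<X>)" by (rule finite_subset[OF _ fin])
  show "card X = card U" if "X \<in> \<X>" for X
    using card_proj_class[of X] that assms by auto
  show "X \<inter> Y = {}" if "X \<in> \<X>" "Y \<in> \<X>" "X \<noteq> Y" for X Y
    using quotient_disj[OF equiv_proj_rel, of X Y] that assms unfolding P5_mod_def by auto
qed

text \<open>All classes have the same size, so proportions of projective points are proportions of
  unimodular vectors.\<close>

lemma local_proportion_eq:
  "local_proportion P = (real P^12 - 2 * real P^10 - real P^9 + 2 * real P^8 + real P^7 - real P^6)
     / (real P^12 - real P^6)"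
proof -
  define \<X> where "\<X> = {X \<in> P5_mod (P^2). \<forall>C\<in>X. \<not> [Res C = 0] (mod int (P^2))}"
  have union: "\<Union>(P5_mod (P^2)) = unimod"
    unfolding P5_mod_def by (rule Union_quotient[OF equiv_proj_rel])
  have "\<Union>\<X> = {C \<in> unimod. \<not> q dvd Res C}"
  proof (intro equalityI subsetI)
    fix C assume "C \<in> \<Union>\<X>"
    then show "C \<in> {C \<in> unimod. \<not> q dvd Res C}"
      unfolding \<X>_def using union by (auto simp: cong_0_iff q_def)
  next
    fix C assume C: "C \<in> {C \<in> unimod. \<not> q dvd Res C}"
    define X where "X = proj_rel (P^2) `` {C}"
    have "C \<in> X" unfolding X_def using C equiv_class_self[OF equiv_proj_rel] by blast
    moreover have "X \<in> P5_mod (P^2)" unfolding X_def P5_mod_def using C by (auto intro: quotientI)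
    moreover have "\<forall>D\<in>X. \<not> [Res D = 0] (mod int (P^2))"
      unfolding X_def using C Res_class by (auto simp: cong_0_iff q_def)
    ultimately show "C \<in> \<Union>\<X>" unfolding \<X>_def by blast
  qed
  then have good: "int (card U * card \<X>) = int P^12 - (2 * int P^10 + int P^9 - 2 * int P^8 - int P^7 + int P^6)"
    using card_union_classes[of \<X>] card_unimodular_good by (simp add: \<X>_def)
  have all: "int (card U * card (P5_mod (P^2))) = int P^12 - int P^6"
    using card_union_classes[of "P5_mod (P^2)"] union card_unimodular by simp
  have "card U > 0"
  proof -
    have "int (card U) > 0" using card_U p_gt_1 by (simp add: power2_eq_square)
    then show ?thesis by simp
  qed
  then have "local_proportion P = real_of_int (int (card U * card \<X>)) / real_of_int (int (card U * card (P5_mod (P^2))))"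
    unfolding local_proportion_def \<X>_def by (auto simp: card_gt_0_iff)
  also have "\<dots> = (real P^12 - 2 * real P^10 - real P^9 + 2 * real P^8 + real P^7 - real P^6)
     / (real P^12 - real P^6)"
    unfolding good all by (simp add: algebra_simps)
  finally show ?thesis .
qed

end

section \<open>Conjugation and minimality\<close>

text \<open>Under a substitution of the variables the minors \<open>s\<close>, \<open>t\<close>,
  \<open>r\<close> become its determinant times values and a polar value of the binary form
  \<open>t X^2 + 2 s X Y + r Y^2\<close>. The resultant \<open>s^2 - t r\<close> is the discriminant
  of that form up to a constant, which contributes a second squared determinant.\<close>

lemma res6_conjugate:
  fixes a b c d e f :: "'a::comm_ring_1"
  shows "res6 (a * x^2 + b * x * z + c * z^2) (2 * a * x * y + b * (x * w + y * z) + 2 * c * z * w)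
      (a * y^2 + b * y * w + c * w^2) (d * x^2 + e * x * z + f * z^2)
      (2 * d * x * y + e * (x * w + y * z) + 2 * f * z * w) (d * y^2 + e * y * w + f * w^2)
    = (x * w - y * z)^4 * res6 a b c d e f"
proof -
  define s where "s = a * f - c * d"
  define t where "t = a * e - b * d"
  define r where "r = b * f - c * e"
  have 1: "(a * x^2 + b * x * z + c * z^2) * (2 * d * x * y + e * (x * w + y * z) + 2 * f * z * w) -
      (2 * a * x * y + b * (x * w + y * z) + 2 * c * z * w) * (d * x^2 + e * x * z + f * z^2)
      = (x * w - y * z) * (t * x^2 + 2 * s * x * z + r * z^2)"
    unfolding s_def t_def r_def by (simp add: algebra_simps power2_eq_square)
  have 2: "(2 * a * x * y + b * (x * w + y * z) + 2 * c * z * w) * (d * y^2 + e * y * w + f * w^2) -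
      (a * y^2 + b * y * w + c * w^2) * (2 * d * x * y + e * (x * w + y * z) + 2 * f * z * w)
      = (x * w - y * z) * (t * y^2 + 2 * s * y * w + r * w^2)"
    unfolding s_def t_def r_def by (simp add: algebra_simps power2_eq_square)
  have 3: "(a * x^2 + b * x * z + c * z^2) * (d * y^2 + e * y * w + f * w^2) -
      (a * y^2 + b * y * w + c * w^2) * (d * x^2 + e * x * z + f * z^2)
      = (x * w - y * z) * (t * x * y + s * (x * w + y * z) + r * z * w)"
    unfolding s_def t_def r_def by (simp add: algebra_simps power2_eq_square)
  have 4: "res6 a b c d e f = s^2 - t * r" unfolding res6_def s_def t_def r_def ..
  show ?thesis
    unfolding 4 unfolding res6_def 1 2 3
    by (simp add: algebra_simps power2_eq_square power4_eq_xxxx)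
qed

text \<open>Composition with a matrix on the left multiplies every minor by its determinant.\<close>

lemma res6_linear_comb:
  fixes a b c d e f :: "'a::comm_ring_1"
  shows "res6 (x * a + y * d) (x * b + y * e) (x * c + y * f) (z * a + w * d) (z * b + w * e) (z * c + w * f)
    = (x * w - y * z)^2 * res6 a b c d e f"
proof -
  have "(x * a + y * d) * (z * c + w * f) - (x * c + y * f) * (z * a + w * d) = (x * w - y * z) * (a * f - c * d)"
    "(x * a + y * d) * (z * b + w * e) - (x * b + y * e) * (z * a + w * d) = (x * w - y * z) * (a * e - b * d)"
    "(x * b + y * e) * (z * c + w * f) - (x * c + y * f) * (z * b + w * e) = (x * w - y * z) * (b * f - c * e)"
    by (simp_all add: algebra_simps)
  then show ?thesis unfolding res6_def by (simp add: algebra_simps power2_eq_square)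
qed

lemma quadratic_form_coeffs:
  fixes A B C A' B' C' :: rat
  assumes "\<And>x y. A * x^2 + B * x * y + C * y^2 = A' * x^2 + B' * x * y + C' * y^2"
  shows "A = A'" "B = B'" "C = C'"
  using assms[of 1 0] assms[of 0 1] assms[of 1 1] by simp_all

text \<open>With \<open>B\<close> the inverse of \<open>A\<close>, the factor is
  \<open>k^4 (det A)^4 (det B)^2\<close>, the square of \<open>k^2 det A\<close>.\<close>

lemma is_conjugate_Res:
  assumes A: "invertible A" and conj: "is_conjugate A C D"
  obtains r :: rat where "r \<noteq> 0" "of_int (Res D) = r^2 * of_int (Res C)"
proof -
  define B where "B = matrix_inv A"
  obtain k :: rat where k: "k \<noteq> 0" and lift: "\<And>v. hom_lift D v = k *s (B *v hom_lift C (A *v v))"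
    using conj unfolding is_conjugate_def B_def by blast
  define x y z w where A_def: "x = A$1$1" "y = A$1$2" "z = A$2$1" "w = A$2$2"
  define x' y' z' w' where B'_def: "x' = B$1$1" "y' = B$1$2" "z' = B$2$1" "w' = B$2$2"
  have "B ** A = mat 1" unfolding B_def
    using A unfolding invertible_def matrix_inv_def by (rule someI2_ex) blast
  then have "det B * det A = 1" by (metis det_I det_mul)
  then have det: "(x' * w' - y' * z') * (x * w - y * z) = 1"
    by (simp add: det_2 A_def B'_def)
  define a b c d e f :: rat where C_def: "a = of_int (C 1)" "b = of_int (C 2)" "c = of_int (C 3)"
    "d = of_int (C 4)" "e = of_int (C 5)" "f = of_int (C 6)"
  define a2 b2 c2 d2 e2 f2 where C2_def: "a2 = a * x^2 + b * x * z + c * z^2"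
    "b2 = 2 * a * x * y + b * (x * w + y * z) + 2 * c * z * w"
    "c2 = a * y^2 + b * y * w + c * w^2" "d2 = d * x^2 + e * x * z + f * z^2"
    "e2 = 2 * d * x * y + e * (x * w + y * z) + 2 * f * z * w" "f2 = d * y^2 + e * y * w + f * w^2"
  have lift2: "hom_lift C (A *v vector [X, Y]) = vector [a2 * X^2 + b2 * X * Y + c2 * Y^2, d2 * X^2 + e2 * X * Y + f2 * Y^2]" for X Y
    unfolding hom_lift_def C2_def C_def A_def
    by (simp add: vec_eq_iff forall_2 matrix_vector_mult_def sum_2 algebra_simps power2_eq_square)
  have eq1: "of_int (D 1) * X^2 + of_int (D 2) * X * Y + of_int (D 3) * Y^2 =
      (k * x' * a2 + k * y' * d2) * X^2 + (k * x' * b2 + k * y' * e2) * X * Y + (k * x' * c2 + k * y' * f2) * Y^2" for X Y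
  proof -
    have "hom_lift D (vector [X, Y]) $ 1 = (k *s (B *v hom_lift C (A *v vector [X, Y]))) $ 1"
      by (simp only: lift)
    then show ?thesis unfolding lift2
      by (simp add: hom_lift_def matrix_vector_mult_def sum_2 B'_def algebra_simps)
  qed
  have eq2: "of_int (D 4) * X^2 + of_int (D 5) * X * Y + of_int (D 6) * Y^2 =
      (k * z' * a2 + k * w' * d2) * X^2 + (k * z' * b2 + k * w' * e2) * X * Y + (k * z' * c2 + k * w' * f2) * Y^2" for X Y
  proof -
    have "hom_lift D (vector [X, Y]) $ 2 = (k *s (B *v hom_lift C (A *v vector [X, Y]))) $ 2"
      by (simp only: lift)
    then show ?thesis unfolding lift2
      by (simp add: hom_lift_def matrix_vector_mult_def sum_2 B'_def algebra_simps)
  qed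
  have hom: "of_int (Res E) = res6 (of_int (E 1)) (of_int (E 2)) (of_int (E 3)) (of_int (E 4)) (of_int (E 5)) (of_int (E 6) :: rat)" for E
    by (simp add: Res_res6 res6_def)
  have "(of_int (Res D) :: rat) = (k * x' * (k * w') - k * y' * (k * z'))^2 * res6 a2 b2 c2 d2 e2 f2"
    unfolding hom quadratic_form_coeffs[OF eq1] quadratic_form_coeffs[OF eq2]
    by (rule res6_linear_comb)
  also have "res6 a2 b2 c2 d2 e2 f2 = (x * w - y * z)^4 * of_int (Res C)"
    unfolding C2_def res6_conjugate hom C_def ..
  also have "(k * x' * (k * w') - k * y' * (k * z'))^2 * ((x * w - y * z)^4 * of_int (Res C)) =
      ((x' * w' - y' * z') * (x * w - y * z))^2 * (k^2 * (x * w - y * z))^2 * of_int (Res C)"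
    by (simp add: algebra_simps power2_eq_square power4_eq_xxxx)
  finally have "(of_int (Res D) :: rat) = (k^2 * (x * w - y * z))^2 * of_int (Res C)"
    unfolding det by simp
  moreover have "k^2 * (x * w - y * z) \<noteq> 0" using k det by auto
  ultimately show ?thesis using that by blast
qed

lemma is_conjugate_Res_parity:
  assumes "invertible A" "is_conjugate A C D" "prime p" "Res C \<noteq> 0"
  shows "even (multiplicity (int p) (Res D)) \<longleftrightarrow> even (multiplicity (int p) (Res C))"
proof -
  obtain r :: rat where r: "r \<noteq> 0" "of_int (Res D) = r^2 * of_int (Res C)"
    using is_conjugate_Res[OF assms(1,2)] .
  obtain x y where xy: "r = of_int x / of_int y" "y > 0" "coprime x y"
    using quotient_of_div[of r] quotient_of_denom_pos[of r] quotient_of_coprime[of r]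
    by (metis prod.collapse)
  have x: "x \<noteq> 0" using r(1) xy by auto
  have D0: "Res D \<noteq> 0" using r assms(4) by auto
  have "(of_int (Res D * y^2) :: rat) = of_int (x^2 * Res C)"
    using r(2) xy(2) unfolding xy(1) by (simp add: field_simps power2_eq_square)
  then have eq: "Res D * y^2 = x^2 * Res C" by (simp only: of_int_eq_iff)
  have pe: "prime_elem (int p)" using assms(3) by (simp add: prime_imp_prime_elem)
  have "multiplicity (int p) (Res D) + 2 * multiplicity (int p) y = 2 * multiplicity (int p) x + multiplicity (int p) (Res C)"
    using arg_cong[OF eq, of "multiplicity (int p)"] x xy(2) D0 assms(4)
    by (simp add: prime_elem_multiplicity_mult_distrib[OF pe] prime_elem_multiplicity_power_distrib[OF pe])
  then have "even (multiplicity (int p) (Res D) + 2 * multiplicity (int p) y) \<longleftrightarrow>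
      even (2 * multiplicity (int p) x + multiplicity (int p) (Res C))" by (simp only:)
  then show ?thesis by simp
qed

text \<open>The identity matrix attains the value. Nothing lies below 0, and for the value 1 parity
  rules out 0.\<close>

lemma min_res_exponent_eq:
  assumes C: "C \<in> P5Q" "Res C \<noteq> 0" and p: "prime p" and m: "multiplicity (int p) (Res C) \<le> 1"
  shows "min_res_exponent p C = multiplicity (int p) (Res C)"
  unfolding min_res_exponent_def
proof (rule Least_equality)
  have "matrix_inv (mat 1 :: rat^2^2) = mat 1"
    unfolding matrix_inv_def by simp
  then have "is_conjugate (mat 1) C C"
    unfolding is_conjugate_def using C(1) by (auto intro!: exI[of _ 1])
  moreover have "invertible (mat 1 :: rat^2^2)"
    unfolding invertible_def by (intro exI[of _ "mat 1"]) simp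
  ultimately show "\<exists>A D. invertible A \<and> is_conjugate A C D \<and> multiplicity (int p) (Res C) = multiplicity (int p) (Res D)"
    by blast
next
  fix k assume "\<exists>A D. invertible A \<and> is_conjugate A C D \<and> k = multiplicity (int p) (Res D)"
  then obtain A D where "invertible A" "is_conjugate A C D" "k = multiplicity (int p) (Res D)" by blast
  then have "even k \<longleftrightarrow> even (multiplicity (int p) (Res C))"
    using is_conjugate_Res_parity p C(2) by blast
  then show "multiplicity (int p) (Res C) \<le> k"
    using m by (cases "k = 0") (auto simp: le_Suc_eq)
qed

text \<open>All exponents are 0 or 1, so the minimal resultant is the product of the primes dividing
  \<open>Res C\<close>, which for a squarefree number is its absolute value.\<close>

lemma squarefree_res_globally_minimal:
  "squarefree_res_maps \<subseteq> {C \<in> rational_maps2. globally_minimal C}"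
proof
  fix C assume "C \<in> squarefree_res_maps"
  then have C: "C \<in> rational_maps2" "C \<in> P5Q" "Res C \<noteq> 0" and sf: "squarefree (Res C)"
    by (auto simp: squarefree_res_maps_def rational_maps2_def)
  define n where "n = nat \<bar>Res C\<bar>"
  have n: "int n = \<bar>Res C\<bar>" "n \<noteq> 0" using C(3) by (auto simp: n_def)
  have mult: "multiplicity (int p) (Res C) = (if p dvd n then 1 else 0)" if p: "prime p" for p
  proof (cases "p dvd n")
    case True
    then have "int p dvd Res C" using n(1) by (metis dvd_abs_iff int_dvd_int_iff)
    moreover have "\<not> int p ^ 2 dvd Res C"
      using sf p unfolding squarefree_def by (metis not_prime_unit prime_nat_int_transfer)
    ultimately show ?thesis using True p
      by (intro multiplicity_eqI) (auto simp: numeral_2_eq_2)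
  next
    case False
    then have "\<not> int p dvd Res C" using n(1) by (metis dvd_abs_iff int_dvd_int_iff)
    then show ?thesis using False by (simp add: not_dvd_imp_multiplicity_0)
  qed
  have mre: "min_res_exponent p C = (if p dvd n then 1 else 0)" if "prime p" for p
    using min_res_exponent_eq[OF C(2,3) that] mult[OF that] by simp
  have set: "{p. prime p \<and> min_res_exponent p C > 0} = prime_factors n"
    using n(2) mre by (auto simp: prime_factors_dvd split: if_splits)
  have "minimal_resultant C = (\<Prod>p\<in>prime_factors n. p ^ multiplicity p n)"
    unfolding minimal_resultant_def set
  proof (rule prod.cong[OF refl])
    fix p assume p: "p \<in> prime_factors n"
    then have "prime p" "p dvd n" by auto
    moreover have "multiplicity p n = 1"
    proof -
      have "\<not> p^2 dvd n"
      proof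
        assume "p^2 dvd n"
        then have "int p ^ 2 dvd Res C" using n(1) by (metis dvd_abs_iff int_dvd_int_iff of_nat_power)
        then show False using sf \<open>prime p\<close> unfolding squarefree_def
          by (metis not_prime_unit prime_nat_int_transfer)
      qed
      then show ?thesis using \<open>p dvd n\<close> by (intro multiplicity_eqI) (auto simp: numeral_2_eq_2)
    qed
    ultimately show "p ^ min_res_exponent p C = p ^ multiplicity p n" using mre by simp
  qed
  also have "\<dots> = n" using prod_prime_factors[OF n(2)] by simp
  finally have "globally_minimal C" using n(1) by (simp add: globally_minimal_def)
  then show "C \<in> {C \<in> rational_maps2. globally_minimal C}" using C(1) by simp
qed

section \<open>Numerical bounds\<close>

abbreviation primes_le :: "nat \<Rightarrow> nat set" where
  "primes_le x \<equiv> {p. prime p \<and> p \<le> x}"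

lemma prod_one_minus_ge:
  fixes x :: "'a \<Rightarrow> real"
  assumes "finite A" "\<And>i. i \<in> A \<Longrightarrow> 0 \<le> x i" "\<And>i. i \<in> A \<Longrightarrow> x i \<le> 1"
  shows "(\<Prod>i\<in>A. 1 - x i) \<ge> 1 - (\<Sum>i\<in>A. x i)"
  using assms
proof (induction A rule: finite_induct)
  case (insert i A)
  have "(\<Prod>i\<in>A. 1 - x i) \<le> 1" using insert by (intro prod_le_1) auto
  then have "x i * (\<Prod>i\<in>A. 1 - x i) \<le> x i" using insert.prems(1)[of i] by (simp add: mult_left_le)
  then show ?case using insert by (simp add: algebra_simps)
qed simp

text \<open>The value 1 away from the primes \<open>p \<ge> 23\<close> turns the product over primes
  into one over all natural numbers.\<close>

definition tail_factor :: "nat \<Rightarrow> real" where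
  "tail_factor p = (if prime p \<and> p \<ge> 23
     then (real p ^ 12 - 3 * real p ^ 10 - 2 * real p ^ 9 + 4 * real p ^ 8)
            / (real p ^ 12 * (1 - 1 / real p ^ 6))
     else 1)"

text \<open>Over the common denominator \<open>p^12 - p^6\<close>, the numerator of
  \<open>local_proportion p - tail_factor p\<close> is
  \<open>p^10 + p^9 - 2 p^8 + p^7 - p^6\<close>, which is positive.\<close>

lemma tail_factor_bounds:
  assumes "prime p" "p \<ge> 23"
  shows "tail_factor p \<le> 1" "1 - tail_factor p \<le> 3 / real p^2 + 2 / real p^3"
    "tail_factor p < local_proportion p" "0 < tail_factor p"
proof -
  define x where "x = real p"
  have x: "x \<ge> 23" using assms(2) by (simp add: x_def)
  have den: "x^12 * (1 - 1 / x^6) = x^12 - x^6"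
    using x by (simp add: field_simps flip: power_add)
  have "x^6 > 1" using x by (intro one_less_power) auto
  then have "x^6 * (x^6 - 1) > 0" using x by (intro mult_pos_pos) auto
  then have D: "x^12 - x^6 > 0" by (simp add: algebra_simps flip: power_add)
  have tf: "tail_factor p = (x^12 - 3 * x^10 - 2 * x^9 + 4 * x^8) / (x^12 - x^6)"
    using assms by (simp add: tail_factor_def den flip: x_def)
  have lp: "local_proportion p = (x^12 - 2 * x^10 - x^9 + 2 * x^8 + x^7 - x^6) / (x^12 - x^6)"
    using local_proportion_eq[OF assms(1)] by (simp add: x_def)
  have p1: "x^(k+1) \<ge> 23 * x^k" for k
    using x by (simp add: mult_right_mono)
  have pos: "x^k > 0" for k using x by simp
  \<comment> \<open>With these ratios, linear arithmetic can treat the powers of \<open>x\<close> as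
    independent unknowns.\<close>
  have s: "x^8 \<ge> 23 * x^7" "x^7 \<ge> 23 * x^6" "x^9 \<ge> 23 * x^8" "x^10 \<ge> 23 * x^9" "x^11 \<ge> 23 * x^10" "x^12 \<ge> 23 * x^11"
    "x^5 \<ge> 23 * x^4" "x^6 \<ge> 23 * x^5" "x^4 \<ge> 23 * x^3" "x^3 > 0"
    using p1[of 7] p1[of 6] p1[of 8] p1[of 9] p1[of 10] p1[of 11] p1[of 4] p1[of 5] p1[of 3] pos[of 3] by simp_all
  show "tail_factor p \<le> 1" unfolding tf
    by (rule divide_le_eq_1_pos[OF D, THEN iffD2]) (use s in linarith)
  show "tail_factor p < local_proportion p" unfolding tf lp
    by (rule divide_strict_right_mono[OF _ D]) (use s in linarith)
  show "0 < tail_factor p" unfolding tf by (rule divide_pos_pos[OF _ D]) (use s in linarith)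
  have "1 - tail_factor p = (3 * x^10 + 2 * x^9 - 4 * x^8 - x^6) / (x^12 - x^6)"
    unfolding tf using D by (simp add: field_simps)
  also have "\<dots> \<le> (3 * x^10 + 2 * x^9 - 3 * x^4 - 2 * x^3) / (x^12 - x^6)"
    by (rule divide_right_mono) (use s D in linarith)+
  also have "3 * x^10 + 2 * x^9 - 3 * x^4 - 2 * x^3 = (3 / x^2 + 2 / x^3) * (x^12 - x^6)"
    using x by (simp add: field_simps eval_nat_numeral)
  also have "(3 / x^2 + 2 / x^3) * (x^12 - x^6) / (x^12 - x^6) = 3 / x^2 + 2 / x^3"
    using D by simp
  finally show "1 - tail_factor p \<le> 3 / real p^2 + 2 / real p^3" by (simp add: x_def)
qed

text \<open>Cheap to evaluate and containing every prime of the range; the only composite entry is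
  529, the square of 23.\<close>

definition small_candidates :: "int list" where
  "small_candidates = filter (\<lambda>p. list_all (\<lambda>k. p mod k \<noteq> 0) [2,3,5,7,11,13,17,19]) [23..599]"

text \<open>An integer upper bound for \<open>10^10 (3 / p^2 + 2 / p^3)\<close>, so that the
  numerical check stays in integer arithmetic.\<close>

abbreviation scaled_bound :: "int \<Rightarrow> int" where
  "scaled_bound p \<equiv> (30000000000 div p^2 + 1) + (20000000000 div p^3 + 1)"

lemma small_candidates_sum:
  "sum_list (map (\<lambda>p. scaled_bound p) small_candidates) \<le> 308000000"
  unfolding small_candidates_def by code_simp

lemma set_small_candidates:
  "set small_candidates = {p \<in> {23..599}. list_all (\<lambda>k. p mod k \<noteq> 0) [2,3,5,7,11,13,17,19]}"
  unfolding small_candidates_def set_filter set_upto by blast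

lemma distinct_small_candidates: "distinct small_candidates"
  unfolding small_candidates_def by (intro distinct_filter distinct_upto)

lemma sum_small_primes:
  "(\<Sum>p | prime p \<and> 23 \<le> p \<and> p < 600. 3 / real p^2 + 2 / real p^3) \<le> 0.0308"
proof -
  have sub: "int ` {p. prime p \<and> 23 \<le> p \<and> p < 600} \<subseteq> set small_candidates"
  proof (rule image_subsetI)
    fix p :: nat assume "p \<in> {p. prime p \<and> 23 \<le> p \<and> p < 600}"
    then have p: "prime p" "23 \<le> p" "p < 600" by auto
    have "int p mod k \<noteq> 0" if "k \<in> {2,3,5,7,11,13,17,19}" for k
    proof
      assume "int p mod k = 0"
      then have "k dvd int p" by presburger
      moreover have "prime (int p)" using p(1) by simp
      moreover have "k \<ge> 0" using that by auto
      ultimately have "k = 1 \<or> k = int p" unfolding prime_int_iff by blast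
      then show False using that p(2) by auto
    qed
    then have "list_all (\<lambda>k. int p mod k \<noteq> 0) [2,3,5,7,11,13,17,19]"
      unfolding list_all_iff by (intro ballI) simp
    then show "int p \<in> set small_candidates"
      using p unfolding set_small_candidates by (intro CollectI conjI) simp_all
  qed
  have term_le: "3 / real_of_int p^2 + 2 / real_of_int p^3 \<le>
      real_of_int (scaled_bound p) / 10^10"
    if "p > 0" for p :: int
  proof -
    have "real_of_int a / real_of_int b \<le> real_of_int (a div b + 1)" if "b > 0" for a b :: int
      using real_of_int_div3[of a b] by simp
    from this[of "p^2" "30000000000"] this[of "p^3" "20000000000"] that
    have "(30000000000 / real_of_int p^2 + 20000000000 / real_of_int p^3) / 10^10 \<le>
      real_of_int (scaled_bound p) / 10^10"
      by (intro divide_right_mono) simp_all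
    then show ?thesis by (simp add: add_divide_distrib)
  qed
  have "(\<Sum>p | prime p \<and> 23 \<le> p \<and> p < 600. 3 / real p^2 + 2 / real p^3) =
      (\<Sum>p\<in>int ` {p. prime p \<and> 23 \<le> p \<and> p < 600}. 3 / real_of_int p^2 + 2 / real_of_int p^3)"
    by (subst sum.reindex) auto
  also have "\<dots> \<le> (\<Sum>p\<in>set small_candidates. 3 / real_of_int p^2 + 2 / real_of_int p^3)"
    by (rule sum_mono2[OF finite_set sub]) (auto simp: set_small_candidates)
  also have "\<dots> \<le> (\<Sum>p\<in>set small_candidates. real_of_int (scaled_bound p) / 10^10)"
    by (rule sum_mono, rule term_le) (auto simp: set_small_candidates)
  also have "\<dots> = real_of_int (\<Sum>p\<in>set small_candidates. scaled_bound p) / 10^10"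
    by (simp only: of_int_sum sum_divide_distrib)
  also have "(\<Sum>p\<in>set small_candidates. scaled_bound p) =
      sum_list (map (\<lambda>p. scaled_bound p) small_candidates)"
    by (rule sum.distinct_set_conv_list[OF distinct_small_candidates])
  also have "real_of_int \<dots> / 10^10 \<le> real_of_int 308000000 / 10^10"
    by (intro divide_right_mono of_int_le_iff[THEN iffD2] small_candidates_sum) simp
  finally show ?thesis by simp
qed

text \<open>The sum telescopes through \<open>4 y (y + 1) \<le> (2 y + 1)^2\<close>. Restricting to
  odd numbers halves the tail; with 1/600 in place of 1/1200 the final estimate would fall below
  0.327.\<close>

lemma sum_odd_inverse_squares:
  "(\<Sum>k\<in>{300..<300 + n}. 1 / real (2 * k + 1)^2) \<le> 1 / 1200 - 1 / (4 * (300 + real n))"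
proof (induction n)
  case (Suc n)
  define y where "y = 300 + real n"
  have y: "y > 0" by (simp add: y_def)
  have "1 / (2 * y + 1)^2 \<le> 1 / (4 * y) - 1 / (4 * (y + 1))"
  proof -
    have "1 / (4 * y) - 1 / (4 * (y + 1)) = 1 / (4 * y * (y + 1))" using y by (simp add: field_simps)
    moreover have "4 * y * (y + 1) \<le> (2 * y + 1)^2" by (simp add: power2_eq_square algebra_simps)
    ultimately show ?thesis using y by (simp add: frac_le)
  qed
  moreover have "(\<Sum>k\<in>{300..<300 + Suc n}. 1 / real (2 * k + 1)^2) =
      (\<Sum>k\<in>{300..<300 + n}. 1 / real (2 * k + 1)^2) + 1 / (2 * y + 1)^2"
    unfolding add_Suc_right by (subst sum.atLeastLessThan_Suc) (simp_all add: y_def algebra_simps)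
  moreover have "1 / (4 * (300 + real (Suc n))) = 1 / (4 * (y + 1))"
    by (simp add: y_def algebra_simps)
  ultimately show ?case using Suc.IH[folded y_def] by linarith
qed simp

lemma sum_large_primes:
  "(\<Sum>p | prime p \<and> 600 \<le> p \<and> p \<le> N. 3 / real p^2 + 2 / real p^3) \<le> 0.00251"
proof -
  have "(\<Sum>p | prime p \<and> 600 \<le> p \<and> p \<le> N. 3 / real p^2 + 2 / real p^3) \<le>
      (\<Sum>p\<in>(\<lambda>k. 2 * k + 1) ` {300..<300 + N}. 3 / real p^2 + 2 / real p^3)"
  proof (rule sum_mono2)
    show "{p. prime p \<and> 600 \<le> p \<and> p \<le> N} \<subseteq> (\<lambda>k. 2 * k + 1) ` {300..<300 + N}"
    proof
      fix p assume p: "p \<in> {p. prime p \<and> 600 \<le> p \<and> p \<le> N}"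
      then have "odd p" using prime_odd_nat[of p] by auto
      then obtain k where "p = 2 * k + 1" by (elim oddE)
      then show "p \<in> (\<lambda>k. 2 * k + 1) ` {300..<300 + N}" using p by auto
    qed
  qed auto
  also have "\<dots> = (\<Sum>k\<in>{300..<300 + N}. 3 / real (2 * k + 1)^2 + 2 / real (2 * k + 1)^3)"
    by (subst sum.reindex) (auto simp: inj_on_def)
  \<comment> \<open>For \<open>x \<ge> 601\<close> the cubic term is at most
    \<open>2 / 601 < 0.004\<close> times \<open>1 / x^2\<close>.\<close>
  also have "\<dots> \<le> (\<Sum>k\<in>{300..<300 + N}. 3.004 * (1 / real (2 * k + 1)^2))"
  proof (rule sum_mono)
    fix k assume "k \<in> {300..<300 + N}"
    then have x: "real (2 * k + 1) \<ge> 601" by simp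
    have "3 / x^2 + 2 / x^3 \<le> 3.004 * (1 / x^2)" if "x \<ge> 601" for x :: real
      using that by (simp add: field_simps power2_eq_square power3_eq_cube)
    from this[OF x] show "3 / real (2 * k + 1)^2 + 2 / real (2 * k + 1)^3 \<le> 3.004 * (1 / real (2 * k + 1)^2)" .
  qed
  also have "\<dots> = 3.004 * (\<Sum>k\<in>{300..<300 + N}. 1 / real (2 * k + 1)^2)"
    by (rule sum_distrib_left[symmetric])
  also have "\<dots> \<le> 3.004 * (1 / 1200)"
  proof (intro mult_left_mono)
    have "1 / (4 * (300 + real N)) \<ge> 0" by simp
    then show "(\<Sum>k\<in>{300..<300 + N}. 1 / real (2 * k + 1)^2) \<le> 1 / 1200"
      using sum_odd_inverse_squares[of N] by linarith
  qed simp
  finally show ?thesis by simp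
qed

text \<open>A product of factors \<open>1 - x\<close> is at least one minus the sum of the
  \<open>x\<close>; here that sum is at most 0.0308 + 0.00251, below 0.0335.\<close>

lemma prod_tail_factor_ge: "(\<Prod>p\<le>N. tail_factor p) \<ge> 0.9665"
proof -
  let ?P = "{p. prime p \<and> 23 \<le> p \<and> p \<le> N}"
  have fin: "finite ?P" by (rule finite_subset[of _ "{..N}"]) auto
  have "(\<Prod>p\<le>N. tail_factor p) = (\<Prod>p\<in>?P. tail_factor p)"
    by (rule prod.mono_neutral_right) (auto simp: tail_factor_def)
  also have "\<dots> = (\<Prod>p\<in>?P. 1 - (1 - tail_factor p))" by simp
  also have "\<dots> \<ge> 1 - (\<Sum>p\<in>?P. 1 - tail_factor p)"
    using tail_factor_bounds(1,4) by (intro prod_one_minus_ge fin) (auto intro: less_imp_le)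
  finally have "(\<Prod>p\<le>N. tail_factor p) \<ge> 1 - (\<Sum>p\<in>?P. 1 - tail_factor p)" .
  moreover have "(\<Sum>p\<in>?P. 1 - tail_factor p) \<le> (\<Sum>p\<in>?P. 3 / real p^2 + 2 / real p^3)"
    using tail_factor_bounds(2) by (intro sum_mono) auto
  moreover have "\<dots> \<le> (\<Sum>p\<in>{p. prime p \<and> 23 \<le> p \<and> p < 600} \<union> {p. prime p \<and> 600 \<le> p \<and> p \<le> N}. 3 / real p^2 + 2 / real p^3)"
    by (rule sum_mono2) (auto intro: finite_subset[of _ "{..N}"])
  moreover have "\<dots> = (\<Sum>p | prime p \<and> 23 \<le> p \<and> p < 600. 3 / real p^2 + 2 / real p^3) +
      (\<Sum>p | prime p \<and> 600 \<le> p \<and> p \<le> N. 3 / real p^2 + 2 / real p^3)"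
    by (rule sum.union_disjoint) (auto intro: finite_subset[of _ "{..N}"])
  ultimately show ?thesis using sum_small_primes sum_large_primes[of N] by simp
qed

lemma convergent_prod_tail_factor: "convergent_prod tail_factor"
proof (rule abs_convergent_prod_imp_convergent_prod, rule summable_imp_abs_convergent_prod)
  have "summable (\<lambda>p. 5 * inverse (real p ^ 2))"
    by (intro summable_mult inverse_power_summable) simp
  then show "summable (\<lambda>p. norm (tail_factor p - 1))"
  proof (rule summable_comparison_test')
    fix p :: nat
    show "norm (norm (tail_factor p - 1)) \<le> 5 * inverse (real p ^ 2)"
    proof (cases "prime p \<and> p \<ge> 23")
      case True
      then have "2 / real p^3 \<le> 2 / real p^2"
        by (intro divide_left_mono power_increasing) auto
      moreover have "3 / real p^2 + 2 / real p^2 = 5 * inverse (real p ^ 2)"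
        by (simp add: field_simps)
      ultimately show ?thesis using tail_factor_bounds(1,2)[of p] True by simp
    next
      case False
      then have "tail_factor p = 1" unfolding tail_factor_def by (rule if_not_P)
      then show ?thesis by simp
    qed
  qed
qed

lemma primes_less_20: "{p::nat. prime p \<and> p < 20} = {2,3,5,7,11,13,17,19}"
proof -
  have "{p::nat. prime p \<and> p < 20} = set (filter prime [0..<20])" by auto
  also have "\<dots> = {2,3,5,7,11,13,17,19}" by code_simp
  finally show ?thesis .
qed

abbreviation "small_part \<equiv> \<Prod>p | prime p \<and> p < 20. local_proportion p"

lemma prod_local_proportion_small:
  "small_part = 28089992620735699456000/83000538971992844930637"
proof -
  have "prime (2::nat)" "prime (3::nat)" "prime (5::nat)" "prime (7::nat)" "prime (11::nat)"
    "prime (13::nat)" "prime (17::nat)" "prime (19::nat)" by simp_all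
  then show ?thesis unfolding primes_less_20 by (simp add: local_proportion_eq)
qed

text \<open>A limit would weaken strict inequalities between the factors to \<open>\<le>\<close>.
  The gap at the single prime 23 is therefore kept as a constant factor \<open>k > 1\<close>, and
  only the primes above 23 are compared termwise.\<close>

lemma density_bounds:
  assumes lim: "(\<lambda>M. \<Prod>p\<in>primes_le M. local_proportion p) \<longlonglongrightarrow> \<mu>"
  shows "\<mu> > prodinf tail_factor * small_part"
    and "prodinf tail_factor * small_part > 0.327"
proof -
  let ?L = small_part
  have B: "(\<lambda>N. \<Prod>p\<le>N. tail_factor p) \<longlonglongrightarrow> prodinf tail_factor"
    by (rule convergent_prod_LIMSEQ[OF convergent_prod_tail_factor])
  have B_ge: "prodinf tail_factor \<ge> 0.9665"
    by (rule LIMSEQ_le_const[OF B]) (use prod_tail_factor_ge in auto)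
  have L: "?L > 0.3384" unfolding prod_local_proportion_small by simp
  \<comment> \<open>The left side is about 0.32706.\<close>
  have "0.9665 * 0.3384 \<le> prodinf tail_factor * ?L"
    using B_ge L by (intro mult_mono) auto
  then show "prodinf tail_factor * ?L > 0.327" by simp
  define k where "k = local_proportion 23 / tail_factor 23"
  have tf23: "0 < tail_factor 23" "tail_factor 23 < local_proportion 23"
    using tail_factor_bounds(3,4)[of 23] by simp_all
  then have k: "k > 1" by (simp add: k_def)
  have "?L * k * prodinf tail_factor \<le> \<mu>"
  proof (rule LIMSEQ_le[OF tendsto_mult_left[OF B] lim], intro exI allI impI)
    fix M :: nat assume M: "M \<ge> 23"
    let ?P = "{p. prime p \<and> 23 < p \<and> p \<le> M}"
    have fin: "finite ?P" by (rule finite_subset[of _ "{..M}"]) auto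
    have "(\<Prod>p\<in>primes_le M. local_proportion p) = (\<Prod>p\<in>{p. prime p \<and> p < 20} \<union> insert 23 ?P. local_proportion p)"
    proof (rule prod.cong[OF _ refl])
      have "\<not> prime p" if "20 \<le> p" "p < 23" for p :: nat
      proof -
        have "p = 20 \<or> p = 21 \<or> p = 22" using that by auto
        then show ?thesis by auto
      qed
      then show "primes_le M = {p. prime p \<and> p < 20} \<union> insert 23 ?P"
        using M by (auto simp: not_less) (metis le_neq_implies_less not_less)
    qed
    also have "\<dots> = ?L * (local_proportion 23 * (\<Prod>p\<in>?P. local_proportion p))"
      using fin by (subst prod.union_disjoint) auto
    also have "\<dots> \<ge> ?L * (local_proportion 23 * (\<Prod>p\<in>?P. tail_factor p))"
    proof (intro mult_left_mono prod_mono conjI)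
      show "0 \<le> local_proportion 23" using tf23 by linarith
      show "0 \<le> ?L" by (rule order_trans[OF _ less_imp_le[OF L]]) simp
      show "0 \<le> tail_factor p" "tail_factor p \<le> local_proportion p" if "p \<in> ?P" for p
        using tail_factor_bounds(3,4)[of p] that by (auto intro: less_imp_le)
    qed
    also have "?L * (local_proportion 23 * (\<Prod>p\<in>?P. tail_factor p)) = ?L * k * (\<Prod>p\<in>insert 23 ?P. tail_factor p)"
      using fin tf23 by (simp add: k_def)
    also have "(\<Prod>p\<in>insert 23 ?P. tail_factor p) = (\<Prod>p\<le>M. tail_factor p)"
      using M by (intro prod.mono_neutral_left) (auto simp: tail_factor_def)
    finally show "?L * k * (\<Prod>p\<le>M. tail_factor p) \<le> (\<Prod>p\<in>primes_le M. local_proportion p)" .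
  qed
  moreover have "prodinf tail_factor * ?L < ?L * k * prodinf tail_factor"
    using k L B_ge by simp
  ultimately show "\<mu> > prodinf tail_factor * ?L" by simp
qed

section \<open>Densities of periodic sets\<close>

text \<open>The iterated limit as a single filter, to which the ordinary limit theorems for
  quotients and estimates apply.\<close>

definition iterated_at_top :: "nat \<Rightarrow> (nat \<Rightarrow> real) filter" where
  "iterated_at_top n = Abs_filter (\<lambda>P. \<forall>\<^sub>F r in others_at_top n. \<forall>\<^sub>F t in at_top. P (r(n := t)))"

lemma eventually_iterated_at_top:
  "eventually P (iterated_at_top n) \<longleftrightarrow> (\<forall>\<^sub>F r in others_at_top n. \<forall>\<^sub>F t in at_top. P (r(n := t)))"
  unfolding iterated_at_top_def
proof (rule eventually_Abs_filter, rule is_filter.intro)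
  show "\<forall>\<^sub>F r in others_at_top n. \<forall>\<^sub>F t in at_top. P (r(n := t)) \<and> Q (r(n := t))"
    if "\<forall>\<^sub>F r in others_at_top n. \<forall>\<^sub>F t in at_top. P (r(n := t))"
      "\<forall>\<^sub>F r in others_at_top n. \<forall>\<^sub>F t in at_top. Q (r(n := t))" for P Q
    using that by eventually_elim (rule eventually_conj)
  show "\<forall>\<^sub>F r in others_at_top n. \<forall>\<^sub>F t in at_top. Q (r(n := t))"
    if "\<forall>x. P x \<longrightarrow> Q x" "\<forall>\<^sub>F r in others_at_top n. \<forall>\<^sub>F t in at_top. P (r(n := t))" for P Q
    using that(2)
  proof eventually_elim
    case (elim r)
    then show ?case by (rule eventually_mono) (use that(1) in blast)
  qed
qed simp

lemma eventually_others_ge: "\<forall>\<^sub>F r in others_at_top n. \<forall>i\<in>{1..6} - {n}. r i \<ge> K"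
proof (rule eventually_ball_finite)
  show "\<forall>i\<in>{1..6} - {n}. \<forall>\<^sub>F r in others_at_top n. K \<le> r i"
  proof
    fix i assume i: "i \<in> {1..6} - {n}"
    have "\<forall>\<^sub>F r in filtercomap (\<lambda>r. r i) at_top. K \<le> (r i :: real)"
      by (rule eventually_filtercomapI[OF eventually_ge_at_top])
    then show "\<forall>\<^sub>F r in others_at_top n. K \<le> r i"
      unfolding others_at_top_def by (rule eventually_INF1[OF i])
  qed
qed simp

text \<open>Lower bounds on different coordinates are compatible. Nontriviality of the filter is
  what identifies lower and upper limits with the limit.\<close>

lemma others_at_top_neq_bot: "others_at_top n \<noteq> bot"
proof
  assume "others_at_top n = bot"
  then have "eventually (\<lambda>_. False) (others_at_top n)" by simp
  then have "\<exists>Q. (\<forall>i\<in>{1..6} - {n}. eventually (Q i) (filtercomap (\<lambda>r. r i) (at_top :: real filter))) \<and>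
      (\<forall>r. (\<forall>i\<in>{1..6} - {n}. Q i r) \<longrightarrow> False)"
    unfolding others_at_top_def by (subst (asm) eventually_INF_finite) auto
  then obtain Q where Q: "\<And>i. i \<in> {1..6} - {n} \<Longrightarrow> eventually (Q i) (filtercomap (\<lambda>r. r i) (at_top :: real filter))"
    "\<And>r. (\<forall>i\<in>{1..6} - {n}. Q i r) \<Longrightarrow> False" by blast
  have "\<exists>K. \<forall>r. r i \<ge> K \<longrightarrow> Q i r" if "i \<in> {1..6} - {n}" for i
    using Q(1)[OF that] unfolding eventually_filtercomap eventually_at_top_linorder by blast
  then obtain K where "\<And>i r. i \<in> {1..6} - {n} \<Longrightarrow> r i \<ge> K i \<Longrightarrow> Q i r" by metis
  then show False using Q(2)[of K] by blast
qed

lemma filterlim_iterated_at_top: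
  assumes "i \<in> {1..6}"
  shows "filterlim (\<lambda>r. r i) at_top (iterated_at_top n)"
  unfolding filterlim_at_top
proof
  fix Z :: real
  show "\<forall>\<^sub>F r in iterated_at_top n. Z \<le> r i"
    unfolding eventually_iterated_at_top
  proof (cases "i = n")
    case True
    then show "\<forall>\<^sub>F r in others_at_top n. \<forall>\<^sub>F t in at_top. Z \<le> (r(n := t)) i"
      by (simp add: eventually_ge_at_top)
  next
    case False
    show "\<forall>\<^sub>F r in others_at_top n. \<forall>\<^sub>F t in at_top. Z \<le> (r(n := t)) i"
      using eventually_others_ge[of n Z]
    proof eventually_elim
      case (elim r)
      then show ?case using False assms by simp
    qed
  qed
qed

text \<open>No inner limit is claimed for fixed outer sides. Convergence along the combined filter
  traps the inner lower and upper limits within \<open>e\<close> of \<open>\<mu>\<close> once the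
  outer sides are large, which suffices.\<close>

lemma has_weak_box_densityI:
  assumes lim: "(box_ratio S \<longlongrightarrow> \<mu>) (iterated_at_top n)"
  shows "has_weak_box_density n S \<mu>"
proof -
  define lo where "lo = (\<lambda>r. Liminf at_top (\<lambda>t. ereal (box_ratio S (r(n := t)))))"
  define up where "up = (\<lambda>r. Limsup at_top (\<lambda>t. ereal (box_ratio S (r(n := t)))))"
  have bounds: "\<forall>\<^sub>F r in others_at_top n. ereal (\<mu> - e) \<le> lo r \<and> lo r \<le> up r \<and> up r \<le> ereal (\<mu> + e)"
    if "e > 0" for e
  proof -
    have "\<forall>\<^sub>F r in iterated_at_top n. dist (box_ratio S r) \<mu> < e"
      using lim that by (rule tendstoD)
    then have "\<forall>\<^sub>F r in others_at_top n. \<forall>\<^sub>F t in at_top. dist (box_ratio S (r(n := t))) \<mu> < e"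
      by (simp add: eventually_iterated_at_top)
    then show ?thesis
    proof eventually_elim
      case (elim r)
      have "\<forall>\<^sub>F t in at_top. ereal (\<mu> - e) \<le> ereal (box_ratio S (r(n := t)))"
        using elim by eventually_elim (simp add: dist_real_def)
      then have "ereal (\<mu> - e) \<le> lo r" unfolding lo_def by (rule Liminf_bounded)
      moreover have "\<forall>\<^sub>F t in at_top. ereal (box_ratio S (r(n := t))) \<le> ereal (\<mu> + e)"
        using elim by eventually_elim (simp add: dist_real_def)
      then have "up r \<le> ereal (\<mu> + e)" unfolding up_def by (rule Limsup_bounded)
      moreover have "lo r \<le> up r" unfolding lo_def up_def by (rule Liminf_le_Limsup) simp
      ultimately show ?case by simp
    qed
  qed
  have lo: "(lo \<longlongrightarrow> ereal \<mu>) (others_at_top n)" and up: "(up \<longlongrightarrow> ereal \<mu>) (others_at_top n)"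
  proof -
    have "\<forall>\<^sub>F r in others_at_top n. a < lo r \<and> a < up r" if a: "a < ereal \<mu>" for a
    proof -
      obtain b where b: "a < ereal b" "ereal b < ereal \<mu>" using ereal_dense2[OF a] by auto
      show ?thesis using bounds[of "\<mu> - b"] b
        by (auto elim!: eventually_mono intro: less_le_trans order_trans)
    qed
    moreover have "\<forall>\<^sub>F r in others_at_top n. lo r < a \<and> up r < a" if a: "ereal \<mu> < a" for a
    proof -
      obtain b where b: "ereal \<mu> < ereal b" "ereal b < a" using ereal_dense2[OF a] by auto
      show ?thesis using bounds[of "b - \<mu>"] b
        by (auto elim!: eventually_mono intro: le_less_trans order_trans)
    qed
    ultimately show "(lo \<longlongrightarrow> ereal \<mu>) (others_at_top n)" "(up \<longlongrightarrow> ereal \<mu>) (others_at_top n)"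
      by (auto simp: order_tendsto_iff eventually_conj_iff)
  qed
  show ?thesis
    unfolding has_weak_box_density_def weak_lower_density_def weak_upper_density_def
    using lim_imp_Liminf[OF others_at_top_neq_bot lo] lim_imp_Limsup[OF others_at_top_neq_bot up]
    unfolding lo_def up_def by blast
qed

section \<open>Lattice points of boxes in residue classes\<close>

abbreviation side :: "int \<Rightarrow> real" where
  "side R \<equiv> real_of_int (2 * R + 1)"

text \<open>The class is a progression indexed by the integers between two reals at distance
  \<open>2 R / q\<close>; the errors come from rounding both ends.\<close>

lemma card_residue_class:
  fixes R q a :: int
  assumes q: "q > 0" and R: "R \<ge> 0"
  shows "real (card {x \<in> {-R..R}. x mod q = a mod q}) \<le> side R / real_of_int q + 1"
    and "real (card {x \<in> {-R..R}. x mod q = a mod q}) \<ge> side R / real_of_int q - 2"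
proof -
  let ?l = "real_of_int (- R - a) / real_of_int q" and ?u = "real_of_int (R - a) / real_of_int q"
  define lo where "lo = \<lceil>?l\<rceil>"
  define up where "up = \<lfloor>?u\<rfloor>"
  have "{x \<in> {-R..R}. x mod q = a mod q} = (\<lambda>k. a + q * k) ` {lo..up}"
  proof -
    have mem: "- R \<le> a + q * k \<and> a + q * k \<le> R \<longleftrightarrow> k \<in> {lo..up}" for k
    proof -
      have "lo \<le> k \<longleftrightarrow> ?l \<le> real_of_int k"
        unfolding lo_def by (rule ceiling_le_iff)
      also have "\<dots> \<longleftrightarrow> real_of_int (- R - a) \<le> real_of_int (k * q)"
        using q by (simp add: pos_divide_le_eq)
      also have "\<dots> \<longleftrightarrow> - R \<le> a + q * k" unfolding of_int_le_iff by (simp add: algebra_simps)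
      finally have 1: "lo \<le> k \<longleftrightarrow> - R \<le> a + q * k" .
      have "k \<le> up \<longleftrightarrow> real_of_int k \<le> ?u"
        unfolding up_def by (rule le_floor_iff)
      also have "\<dots> \<longleftrightarrow> real_of_int (k * q) \<le> real_of_int (R - a)"
        using q by (simp add: pos_le_divide_eq)
      also have "\<dots> \<longleftrightarrow> a + q * k \<le> R" unfolding of_int_le_iff by (simp add: algebra_simps)
      finally have 2: "k \<le> up \<longleftrightarrow> a + q * k \<le> R" .
      from 1 2 show ?thesis by simp
    qed
    show ?thesis
    proof (intro equalityI subsetI)
      fix x assume x: "x \<in> {x \<in> {-R..R}. x mod q = a mod q}"
      then have "q dvd x - a" by (simp add: mod_eq_dvd_iff)
      then obtain k where "x - a = q * k" by (elim dvdE)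
      then have "x = a + q * k" by simp
      then show "x \<in> (\<lambda>k. a + q * k) ` {lo..up}" using x mem[of k] by auto
    next
      fix x assume "x \<in> (\<lambda>k. a + q * k) ` {lo..up}"
      then obtain k where "k \<in> {lo..up}" "x = a + q * k" by blast
      then show "x \<in> {x \<in> {-R..R}. x mod q = a mod q}" using mem[of k] by simp
    qed
  qed
  moreover have "inj_on (\<lambda>k. a + q * k) {lo..up}" using q by (auto simp: inj_on_def)
  ultimately have card: "card {x \<in> {-R..R}. x mod q = a mod q} = nat (up - lo + 1)"
    by (simp add: card_image)
  have up_lo: "?u - ?l = 2 * real_of_int R / real_of_int q"
    using q by (simp add: field_simps)
  have u: "real_of_int up \<le> ?u" "?u < real_of_int up + 1"
    unfolding up_def by linarith+
  have l: "real_of_int lo \<ge> ?l" "real_of_int lo < ?l + 1"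
    unfolding lo_def by linarith+
  have L: "side R / real_of_int q = 2 * real_of_int R / real_of_int q + 1 / real_of_int q"
    by (simp add: add_divide_distrib)
  have q1: "0 < 1 / real_of_int q" "1 / real_of_int q \<le> 1" using q by auto
  have R0: "2 * real_of_int R / real_of_int q \<ge> 0" using q R by simp
  show "real (card {x \<in> {-R..R}. x mod q = a mod q}) \<le> side R / real_of_int q + 1"
    unfolding card L using u l up_lo q1 R0 by linarith
  show "real (card {x \<in> {-R..R}. x mod q = a mod q}) \<ge> side R / real_of_int q - 2"
    unfolding card L using u l up_lo q1 R0 by linarith
qed

text \<open>The index set is a parameter because the sieve also works with the boxes left after
  removing a coordinate.\<close>

definition int_box :: "nat set \<Rightarrow> (nat \<Rightarrow> int) \<Rightarrow> sextuple set" where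
  "int_box I R = (\<Pi>\<^sub>E i\<in>I. {- R i..R i})"

definition vol :: "nat set \<Rightarrow> (nat \<Rightarrow> int) \<Rightarrow> real" where
  "vol I R = (\<Prod>i\<in>I. side (R i))"

abbreviation floor_box :: "(nat \<Rightarrow> real) \<Rightarrow> sextuple set" where
  "floor_box r \<equiv> int_box {1..6} (\<lambda>i. \<lfloor>r i\<rfloor>)"

abbreviation floor_vol :: "(nat \<Rightarrow> real) \<Rightarrow> real" where
  "floor_vol r \<equiv> vol {1..6} (\<lambda>i. \<lfloor>r i\<rfloor>)"

lemma finite_int_box [simp]: "finite I \<Longrightarrow> finite (int_box I R)"
  unfolding int_box_def by (intro finite_PiE) auto

lemma card_int_box:
  assumes "finite I" "\<And>i. i \<in> I \<Longrightarrow> R i \<ge> 0"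
  shows "real (card (int_box I R)) = vol I R"
  using assms unfolding int_box_def vol_def by (auto simp: card_PiE intro!: prod.cong)

definition residues6 :: "int \<Rightarrow> sextuple set" where
  "residues6 q = {1..6} \<rightarrow>\<^sub>E {0..<q}"

definition reduce6 :: "int \<Rightarrow> sextuple \<Rightarrow> sextuple" where
  "reduce6 q C = (\<lambda>i\<in>{1..6}. C i mod q)"

definition periodic6 :: "int \<Rightarrow> (sextuple \<Rightarrow> bool) \<Rightarrow> bool" where
  "periodic6 q A \<longleftrightarrow> (\<forall>C D. (\<forall>i\<in>{1..6}. C i mod q = D i mod q) \<longrightarrow> A C = A D)"

definition residue_density :: "int \<Rightarrow> (sextuple \<Rightarrow> bool) \<Rightarrow> real" where
  "residue_density q A = real (card {C \<in> residues6 q. A C}) / real_of_int q ^ 6"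

lemma finite_residues6 [simp]: "finite (residues6 q)"
  unfolding residues6_def by (intro finite_PiE) auto

lemma periodic6_reduce: "periodic6 q A \<Longrightarrow> A (reduce6 q C) = A C"
  unfolding periodic6_def by (simp add: reduce6_def)

lemma reduce6_in: "q > 0 \<Longrightarrow> reduce6 q C \<in> residues6 q"
  by (auto simp: reduce6_def residues6_def)

lemma reduce6_eq_iff:
  assumes "D \<in> residues6 q"
  shows "reduce6 q C = D \<longleftrightarrow> (\<forall>i\<in>{1..6}. C i mod q = D i)"
proof
  assume *: "\<forall>i\<in>{1..6}. C i mod q = D i"
  show "reduce6 q C = D"
    unfolding reduce6_def using * assms
    by (intro ext) (auto simp: residues6_def PiE_def extensional_def)
qed (auto simp: reduce6_def)

text \<open>Sorting the points by residue vector turns the count into a finite sum of products of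
  one-dimensional counts, each asymptotic to the side divided by \<open>q\<close>, whatever the
  relative size of the sides.\<close>

lemma tendsto_periodic_density:
  fixes F :: "(nat \<Rightarrow> real) filter"
  assumes q: "q > 0" and A: "periodic6 q A"
    and F: "\<And>i. i \<in> {1..6} \<Longrightarrow> filterlim (\<lambda>r. r i) at_top F"
  shows "((\<lambda>r. real (card {C \<in> floor_box r. A C}) / floor_vol r)
    \<longlongrightarrow> residue_density q A) F"
proof -
  define cnt where "cnt t a = real (card {x \<in> {-\<lfloor>t\<rfloor>..\<lfloor>t\<rfloor>}. x mod q = a})" for t :: real and a
  have lim1: "((\<lambda>t. cnt t a / side \<lfloor>t\<rfloor>) \<longlongrightarrow> 1 / real_of_int q) at_top" if a: "a \<in> {0..<q}" for a
  proof (rule LIM_zero_cancel, rule Lim_null_comparison)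
    have am: "a mod q = a" using a by simp
    show "\<forall>\<^sub>F t in at_top. norm (cnt t a / side \<lfloor>t\<rfloor> - 1 / real_of_int q) \<le> 2 / side \<lfloor>t\<rfloor>"
      using eventually_ge_at_top[of 0]
    proof eventually_elim
      case (elim t)
      then have t0: "\<lfloor>t\<rfloor> \<ge> 0" by simp
      then have s: "side \<lfloor>t\<rfloor> > 0" by (simp only: of_int_0_less_iff)
      have "\<bar>cnt t a - side \<lfloor>t\<rfloor> / real_of_int q\<bar> \<le> 2"
        using card_residue_class[OF q t0, of a] unfolding am cnt_def by linarith
      moreover have "norm (c / s - 1 / y) \<le> 2 / s" if "\<bar>c - s / y\<bar> \<le> 2" "s > 0" for c s y :: real
      proof -
        have "c / s - 1 / y = (c - s / y) / s" using that(2) by (simp add: diff_divide_distrib)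
        then have "norm (c / s - 1 / y) = \<bar>c - s / y\<bar> / s" using that(2) by (simp add: abs_divide)
        then show ?thesis using that by (simp add: divide_right_mono)
      qed
      ultimately show ?case using s by blast
    qed
    have "filterlim (\<lambda>t::real. side \<lfloor>t\<rfloor>) at_top at_top"
    proof (rule filterlim_at_top_mono[OF filterlim_ident])
      show "\<forall>\<^sub>F t in at_top. t \<le> side \<lfloor>t\<rfloor>"
        using eventually_ge_at_top[of 0]
      proof eventually_elim
        case (elim t)
        then have "0 \<le> \<lfloor>t\<rfloor>" by simp
        then show ?case by linarith
      qed
    qed
    then show "((\<lambda>t::real. 2 / side \<lfloor>t\<rfloor>) \<longlongrightarrow> 0) at_top"
      by (intro tendsto_divide_0[OF tendsto_const] filterlim_at_top_imp_at_infinity)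
  qed
  have card_eq: "real (card {C \<in> floor_box r. A C}) =
      (\<Sum>D\<in>{D \<in> residues6 q. A D}. \<Prod>i\<in>{1..6}. cnt (r i) (D i))" for r
  proof -
    let ?B = "floor_box r"
    have "{C \<in> ?B. A C} = (\<Union>D\<in>{D \<in> residues6 q. A D}. {C \<in> ?B. reduce6 q C = D})"
      using periodic6_reduce[OF A] reduce6_in[OF q] by auto
    also have "card \<dots> = (\<Sum>D\<in>{D \<in> residues6 q. A D}. card {C \<in> ?B. reduce6 q C = D})"
      by (rule card_UN_disjoint) auto
    also have "\<dots> = (\<Sum>D\<in>{D \<in> residues6 q. A D}. \<Prod>i\<in>{1..6}. card {x \<in> {-\<lfloor>r i\<rfloor>..\<lfloor>r i\<rfloor>}. x mod q = D i})"
    proof (rule sum.cong[OF refl])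
      fix D assume "D \<in> {D \<in> residues6 q. A D}"
      then have D: "D \<in> residues6 q" by simp
      have "{C \<in> ?B. reduce6 q C = D} = (\<Pi>\<^sub>E i\<in>{1..6}. {x \<in> {-\<lfloor>r i\<rfloor>..\<lfloor>r i\<rfloor>}. x mod q = D i})"
        unfolding int_box_def reduce6_eq_iff[OF D] PiE_def Pi_def by blast
      then show "card {C \<in> ?B. reduce6 q C = D} = (\<Prod>i\<in>{1..6}. card {x \<in> {-\<lfloor>r i\<rfloor>..\<lfloor>r i\<rfloor>}. x mod q = D i})"
        by (simp add: card_PiE)
    qed
    finally show ?thesis by (simp add: cnt_def)
  qed
  have "((\<lambda>r. \<Sum>D\<in>{D \<in> residues6 q. A D}. \<Prod>i\<in>{1..6}. cnt (r i) (D i) / side \<lfloor>r i\<rfloor>)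
      \<longlongrightarrow> (\<Sum>D\<in>{D \<in> residues6 q. A D}. \<Prod>i\<in>{1..6::nat}. 1 / real_of_int q)) F"
  proof (intro tendsto_sum tendsto_prod)
    fix D i assume D: "D \<in> {D \<in> residues6 q. A D}" and i: "i \<in> {1..6::nat}"
    have "D i \<in> {0..<q}" using D i unfolding residues6_def by blast
    from filterlim_compose[OF lim1[OF this] F[OF i]]
    show "((\<lambda>r. cnt (r i) (D i) / side \<lfloor>r i\<rfloor>) \<longlongrightarrow> 1 / real_of_int q) F" .
  qed
  moreover have "(\<Sum>D\<in>{D \<in> residues6 q. A D}. \<Prod>i\<in>{1..6::nat}. 1 / real_of_int q) = residue_density q A"
    by (simp add: residue_density_def power_divide)
  moreover have "(\<Sum>D\<in>{D \<in> residues6 q. A D}. \<Prod>i\<in>{1..6}. cnt (r i) (D i) / side \<lfloor>r i\<rfloor>) =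
      real (card {C \<in> floor_box r. A C}) / floor_vol r" for r
    unfolding card_eq vol_def by (simp only: prod_dividef sum_divide_distrib)
  ultimately show ?thesis by simp
qed

lemma card_residues6: "q > 0 \<Longrightarrow> real (card (residues6 q)) = real_of_int q ^ 6"
  by (simp add: residues6_def card_PiE)

text \<open>Chinese remainder theorem: the pair of reductions is injective, hence bijective by
  cardinality.\<close>

lemma residue_density_coprime:
  assumes q: "q > 0" "q' > 0" "coprime q q'" and A: "periodic6 q A" and B: "periodic6 q' B"
  shows "residue_density (q * q') (\<lambda>C. A C \<and> B C) = residue_density q A * residue_density q' B"
proof -
  define \<phi> where "\<phi> C = (reduce6 q C, reduce6 q' C)" for C
  have inj: "inj_on \<phi> (residues6 (q * q'))"
  proof (rule inj_onI)
    fix C D assume CD: "C \<in> residues6 (q * q')" "D \<in> residues6 (q * q')" "\<phi> C = \<phi> D"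
    have "C i = D i" if i: "i \<in> {1..6}" for i
    proof -
      have "reduce6 q C = reduce6 q D" "reduce6 q' C = reduce6 q' D"
        using CD(3) by (simp_all add: \<phi>_def)
      then have "reduce6 q C i = reduce6 q D i" "reduce6 q' C i = reduce6 q' D i" by simp_all
      then have "C i mod q = D i mod q" "C i mod q' = D i mod q'"
        using i by (simp_all add: reduce6_def)
      then have "q dvd C i - D i" "q' dvd C i - D i" by (simp_all add: mod_eq_dvd_iff)
      then have "q * q' dvd C i - D i" using q(3) by (rule divides_mult)
      then have "C i mod (q * q') = D i mod (q * q')" by (simp add: mod_eq_dvd_iff)
      moreover have "C i \<in> {0..<q * q'}" "D i \<in> {0..<q * q'}"
        using CD(1,2) i unfolding residues6_def by blast+
      ultimately show ?thesis by simp
    qed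
    then show "C = D" by (rule PiE_ext[OF CD(1,2)[unfolded residues6_def]])
  qed
  have sub: "\<phi> ` residues6 (q * q') \<subseteq> residues6 q \<times> residues6 q'"
    using q by (auto simp: \<phi>_def reduce6_in)
  have "card (\<phi> ` residues6 (q * q')) = card (residues6 q \<times> residues6 q')"
  proof -
    have "card (residues6 k) = nat k ^ 6" if "k > 0" for k
      using that by (simp add: residues6_def card_PiE)
    then show ?thesis
      using q by (simp add: card_image[OF inj] card_cartesian_product nat_mult_distrib power_mult_distrib)
  qed
  then have im: "\<phi> ` residues6 (q * q') = residues6 q \<times> residues6 q'"
    using sub by (intro card_subset_eq) auto
  have "\<phi> ` {C \<in> residues6 (q * q'). A C \<and> B C} = {C \<in> residues6 q. A C} \<times> {C \<in> residues6 q'. B C}"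
  proof (intro equalityI subsetI)
    fix z assume "z \<in> \<phi> ` {C \<in> residues6 (q * q'). A C \<and> B C}"
    then show "z \<in> {C \<in> residues6 q. A C} \<times> {C \<in> residues6 q'. B C}"
      using reduce6_in[OF q(1)] reduce6_in[OF q(2)] periodic6_reduce[OF A] periodic6_reduce[OF B]
      by (auto simp: \<phi>_def)
  next
    fix z assume z: "z \<in> {C \<in> residues6 q. A C} \<times> {C \<in> residues6 q'. B C}"
    then have "z \<in> \<phi> ` residues6 (q * q')" unfolding im by auto
    then obtain C where C: "C \<in> residues6 (q * q')" "z = \<phi> C" by blast
    then have "A C" "B C" using z periodic6_reduce[OF A] periodic6_reduce[OF B] by (auto simp: \<phi>_def)
    then show "z \<in> \<phi> ` {C \<in> residues6 (q * q'). A C \<and> B C}" using C by blast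
  qed
  moreover have "inj_on \<phi> {C \<in> residues6 (q * q'). A C \<and> B C}" by (rule inj_on_subset[OF inj]) auto
  ultimately have "card {C \<in> residues6 (q * q'). A C \<and> B C} = card {C \<in> residues6 q. A C} * card {C \<in> residues6 q'. B C}"
    using card_image[of \<phi> "{C \<in> residues6 (q * q'). A C \<and> B C}"] by (simp add: card_cartesian_product)
  then show ?thesis by (simp add: residue_density_def power_mult_distrib)
qed

lemma residue_density_prod:
  assumes "finite P" "\<And>p. p \<in> P \<Longrightarrow> prime p" "\<And>p. p \<in> P \<Longrightarrow> periodic6 (int p ^ 2) (A p)"
  shows "periodic6 (\<Prod>p\<in>P. int p ^ 2) (\<lambda>C. \<forall>p\<in>P. A p C) \<and>
    residue_density (\<Prod>p\<in>P. int p ^ 2) (\<lambda>C. \<forall>p\<in>P. A p C) = (\<Prod>p\<in>P. residue_density (int p ^ 2) (A p))"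
  using assms
proof (induction P rule: finite_induct)
  case empty
  then show ?case using card_residues6[of 1] by (simp add: periodic6_def residue_density_def)
next
  case (insert p P)
  let ?q = "\<Prod>p\<in>P. int p ^ 2" and ?A = "\<lambda>C. \<forall>p\<in>P. A p C"
  have IH: "periodic6 ?q ?A"
    "residue_density ?q ?A = (\<Prod>p\<in>P. residue_density (int p ^ 2) (A p))"
    using insert by auto
  have pos: "int p ^ 2 > 0" using insert.prems(1)[of p] by (simp add: prime_gt_0_nat)
  have posq: "?q > 0" using insert.prems(1) by (intro prod_pos) (simp add: prime_gt_0_nat)
  have cop: "coprime (int p ^ 2) ?q"
  proof (rule prod_coprime_right)
    fix p' assume "p' \<in> P"
    then have "prime p" "prime p'" "p \<noteq> p'" using insert by auto
    then show "coprime (int p ^ 2) (int p' ^ 2)"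
      using primes_coprime[of p p'] by simp
  qed
  have "periodic6 (int p ^ 2 * ?q) (\<lambda>C. A p C \<and> ?A C)"
    unfolding periodic6_def
  proof (intro allI impI)
    fix C D :: sextuple assume *: "\<forall>i\<in>{1..6}. C i mod (int p ^ 2 * ?q) = D i mod (int p ^ 2 * ?q)"
    then have "\<forall>i\<in>{1..6}. C i mod int p ^ 2 = D i mod int p ^ 2" "\<forall>i\<in>{1..6}. C i mod ?q = D i mod ?q"
      using mod_mod_cancel[OF dvd_triv_left[of "int p ^ 2" ?q]] mod_mod_cancel[OF dvd_triv_right[of ?q "int p ^ 2"]]
      by metis+
    then show "(A p C \<and> ?A C) = (A p D \<and> ?A D)"
      using insert.prems(2)[of p, OF insertI1, unfolded periodic6_def, rule_format, of C D]
        IH(1)[unfolded periodic6_def, rule_format, of C D] by blast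
  qed
  then show ?case
    using insert residue_density_coprime[OF pos posq cop insert.prems(2)[of p] IH(1)] IH(2)
    by (simp add: insert.hyps)
qed

section \<open>Square divisors of the values of a quadratic polynomial\<close>

lemma prod_dvd_of_pairwise_coprime:
  fixes m :: nat
  assumes "finite A" "\<And>p. p \<in> A \<Longrightarrow> p dvd m" "\<And>p p'. p \<in> A \<Longrightarrow> p' \<in> A \<Longrightarrow> p \<noteq> p' \<Longrightarrow> coprime p p'"
  shows "(\<Prod>p\<in>A. p) dvd m"
  using assms
proof (induction A rule: finite_induct)
  case (insert p A)
  have "coprime p (\<Prod>p\<in>A. p)" using insert by (intro prod_coprime_right) auto
  then have "p * (\<Prod>p\<in>A. p) dvd m" using insert by (intro divides_mult) auto
  then show ?case using insert.hyps by simp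
qed simp

text \<open>A prime in \<open>(n, 2 n]\<close> divides \<open>(2 n)!\<close> but not
  \<open>n!\<close>, so it survives in the central binomial coefficient.\<close>

lemma prod_primes_dvd_binomial:
  "(\<Prod>p | prime p \<and> n < p \<and> p \<le> 2 * n. p) dvd (2 * n choose n)"
proof (rule prod_dvd_of_pairwise_coprime)
  show "finite {p. prime p \<and> n < p \<and> p \<le> 2 * n}"
    by (rule finite_subset[of _ "{..2 * n}"]) auto
next
  fix p assume "p \<in> {p. prime p \<and> n < p \<and> p \<le> 2 * n}"
  then have p: "prime p" "n < p" "p \<le> 2 * n" by auto
  have "fact (2 * n) = (fact n * fact n * (2 * n choose n) :: nat)"
    using binomial_fact_lemma[of n "2 * n"] by (simp add: mult_2)
  moreover have "p dvd fact (2 * n)" using p by (simp add: prime_dvd_fact_iff)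
  moreover have "\<not> p dvd fact n" using p by (simp add: prime_dvd_fact_iff)
  ultimately show "p dvd (2 * n choose n)" using p(1) by (simp add: prime_dvd_mult_iff)
next
  fix p p' assume "p \<in> {p. prime p \<and> n < p \<and> p \<le> 2 * n}" "p' \<in> {p. prime p \<and> n < p \<and> p \<le> 2 * n}" "p \<noteq> p'"
  then show "coprime p p'" by (auto intro: primes_coprime)
qed

text \<open>Each of these primes exceeds \<open>n\<close>, while their product is at most the
  central binomial coefficient and hence at most \<open>4^n\<close>; take logarithms.\<close>

lemma card_primes_double:
  assumes "n \<ge> 2"
  shows "real (card {p. prime p \<and> n < p \<and> p \<le> 2 * n}) \<le> 2 * ln 2 / ln (real n) * real n"
proof -
  let ?P = "{p. prime p \<and> n < p \<and> p \<le> 2 * n}"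
  have fin: "finite ?P" by (rule finite_subset[of _ "{..2 * n}"]) auto
  have "n ^ card ?P \<le> (\<Prod>p\<in>?P. p)"
    using prod_mono[of ?P "\<lambda>_. n" "\<lambda>p. p"] by simp
  also have "\<dots> \<le> (2 * n choose n)"
    by (rule dvd_imp_le[OF prod_primes_dvd_binomial]) simp
  also have "\<dots> \<le> 2 ^ (2 * n)" by (rule binomial_le_pow2)
  finally have "real n ^ card ?P \<le> 2 ^ (2 * n)"
    by (metis of_nat_le_iff of_nat_numeral of_nat_power)
  then have "ln (real n ^ card ?P) \<le> ln (2 ^ (2 * n))"
    using assms by (subst ln_le_cancel_iff) auto
  then have "real (card ?P) * ln (real n) \<le> 2 * ln 2 * real n"
    using assms by (simp add: ln_realpow algebra_simps)
  moreover have "ln (real n) > 0" using assms by simp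
  ultimately show ?thesis by (simp add: field_simps)
qed

definition prime_count :: "nat \<Rightarrow> nat" where
  "prime_count x = card (primes_le x)"

lemma finite_primes_le [simp]: "finite (primes_le x)"
  by (rule finite_subset[of _ "{..x}"]) auto

lemma prime_count_mono: "x \<le> y \<Longrightarrow> prime_count x \<le> prime_count y"
  unfolding prime_count_def by (intro card_mono) auto

lemma prime_count_le: "prime_count x \<le> x"
proof -
  have "primes_le x \<subseteq> {1..x}" by (auto simp: prime_gt_0_nat Suc_le_eq)
  then show ?thesis unfolding prime_count_def using card_mono[of "{1..x}"] by simp
qed

text \<open>For large \<open>k\<close> the block \<open>(2^k, 2^(k+1)]\<close> contains at most
  \<open>(e / 2) 2^k\<close> primes. The blocks add up geometrically, and rounding \<open>x\<close>
  up to a power of 2 costs the remaining factor 2.\<close>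

lemma prime_count_sublinear:
  fixes e :: real
  assumes e: "e > 0"
  obtains K where "\<And>x. real (prime_count x) \<le> e * real x + K"
proof -
  have "((\<lambda>n. 2 * ln 2 / ln (real n)) \<longlongrightarrow> 0) sequentially"
    by (intro tendsto_divide_0[OF tendsto_const] filterlim_at_top_imp_at_infinity
      filterlim_compose[OF ln_at_top filterlim_real_sequentially])
  then have "\<forall>\<^sub>F n in sequentially. 2 * ln 2 / ln (real n) < e / 2"
    by (rule order_tendstoD) (use e in simp)
  then obtain n0 where n0: "\<And>n. n \<ge> n0 \<Longrightarrow> 2 * ln 2 / ln (real n) < e / 2"
    unfolding eventually_sequentially by blast
  define k0 where "k0 = n0 + 1"
  have big: "2 ^ k \<ge> n0" "2 ^ k \<ge> (2::nat)" if "k \<ge> k0" for k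
  proof -
    have "n0 < 2 ^ n0" by (rule less_exp)
    also have "(2::nat) ^ n0 \<le> 2 ^ k" using that by (intro power_increasing) (auto simp: k0_def)
    finally show "2 ^ k \<ge> n0" by simp
    show "2 ^ k \<ge> (2::nat)" using that power_increasing[of 1 k "2::nat"] by (simp add: k0_def)
  qed
  have pow: "real (prime_count (2 ^ k)) \<le> e / 2 * 2 ^ k + 2 ^ k0" if "k \<ge> k0" for k
    using that
  proof (induction k rule: dec_induct)
    case base
    have "real (prime_count (2 ^ k0)) \<le> real (2 ^ k0)" by (intro of_nat_mono prime_count_le)
    also have "\<dots> \<le> e / 2 * 2 ^ k0 + 2 ^ k0" using e by simp
    finally show ?case .
  next
    case (step k)
    have "{p::nat. prime p \<and> p \<le> 2 ^ Suc k} = {p. prime p \<and> p \<le> 2 ^ k} \<union> {p. prime p \<and> 2 ^ k < p \<and> p \<le> 2 * 2 ^ k}"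
      by (auto simp: not_le)
    then have "prime_count (2 ^ Suc k) \<le> prime_count (2 ^ k) + card {p::nat. prime p \<and> 2 ^ k < p \<and> p \<le> 2 * 2 ^ k}"
      unfolding prime_count_def by (simp only: card_Un_le)
    then have "real (prime_count (2 ^ Suc k)) \<le> real (prime_count (2 ^ k)) + real (card {p::nat. prime p \<and> 2 ^ k < p \<and> p \<le> 2 * 2 ^ k})"
      by linarith
    also have "real (card {p::nat. prime p \<and> 2 ^ k < p \<and> p \<le> 2 * 2 ^ k}) \<le> 2 * ln 2 / ln (real (2 ^ k)) * real (2 ^ k)"
      by (rule card_primes_double) (use big step in auto)
    also have "\<dots> \<le> e / 2 * real (2 ^ k)"
      using n0[of "2 ^ k"] big(1)[of k] step by (intro mult_right_mono) auto
    finally show ?case using step.IH by simp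
  qed
  have "real (prime_count x) \<le> e * real x + 2 ^ k0" for x
  proof (cases "x < 2 ^ k0")
    case True
    have "real (prime_count x) \<le> real x" using prime_count_le by simp
    also have "real x \<le> real (2 ^ k0)" using True by (intro of_nat_mono) simp
    finally have "real (prime_count x) \<le> 2 ^ k0" by simp
    moreover have "e * real x \<ge> 0" using e by simp
    ultimately show ?thesis by linarith
  next
    case False
    moreover have "(1::nat) \<le> 2 ^ k0" by simp
    ultimately have "x \<ge> 1" by linarith
    then obtain k where k: "2 ^ k \<le> x" "x < 2 ^ (k + 1)" using ex_power_ivl1[of 2 x] by auto
    have "k0 \<le> k + 1"
    proof (rule ccontr)
      assume "\<not> k0 \<le> k + 1"
      then have "(2::nat) ^ (k + 1) \<le> 2 ^ k0" by (intro power_increasing) auto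
      then show False using False k(2) by simp
    qed
    have "real (prime_count x) \<le> real (prime_count (2 ^ (k + 1)))"
      using prime_count_mono k(2) by simp
    also have "\<dots> \<le> e / 2 * 2 ^ (k + 1) + 2 ^ k0" by (rule pow) fact
    also have "\<dots> = e * real (2 ^ k) + 2 ^ k0" by simp
    also have "\<dots> \<le> e * real x + 2 ^ k0" using k(1) e by (simp del: of_nat_power)
    finally show ?thesis .
  qed
  then show ?thesis using that by blast
qed

text \<open>The sum over all integers above \<open>M\<close> telescopes through
  \<open>1 / (y + 1)^2 \<le> 1 / y - 1 / (y + 1)\<close>.\<close>

lemma sum_inverse_squares_le:
  assumes M: "M \<ge> 1" and P: "finite P" "\<And>p. p \<in> P \<Longrightarrow> M < p"
  shows "(\<Sum>p\<in>P. 1 / real p ^ 2) \<le> 1 / real M"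
proof -
  have step: "(\<Sum>k\<in>{M<..M + n}. 1 / real k ^ 2) \<le> 1 / real M - 1 / real (M + n)" for n
  proof (induction n)
    case (Suc n)
    define y where "y = real (M + n)"
    have y: "y > 0" using M by (simp add: y_def)
    have "{M<..M + Suc n} = insert (M + Suc n) {M<..M + n}" by auto
    then have "(\<Sum>k\<in>{M<..M + Suc n}. 1 / real k ^ 2) = 1 / (y + 1)^2 + (\<Sum>k\<in>{M<..M + n}. 1 / real k ^ 2)"
      by (simp add: y_def algebra_simps)
    moreover have "1 / (y + 1)^2 \<le> 1 / y - 1 / (y + 1)"
    proof -
      have "1 / y - 1 / (y + 1) = 1 / (y * (y + 1))" using y by (simp add: field_simps)
      moreover have "y * (y + 1) \<le> (y + 1)^2" using y by (simp add: power2_eq_square)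
      ultimately show ?thesis using y by (simp add: frac_le)
    qed
    ultimately have "(\<Sum>k\<in>{M<..M + Suc n}. 1 / real k ^ 2) \<le> 1 / real M - 1 / (y + 1)"
      using Suc.IH[folded y_def] by linarith
    moreover have "real (M + Suc n) = y + 1" by (simp add: y_def)
    ultimately show ?case by (simp only:)
  qed simp
  have "(\<Sum>p\<in>P. 1 / real p ^ 2) \<le> (\<Sum>k\<in>{M<..M + Max (insert 0 P)}. 1 / real k ^ 2)"
  proof (rule sum_mono2)
    show "P \<subseteq> {M<..M + Max (insert 0 P)}"
      using P by (auto simp: trans_le_add2 Max_ge_iff intro!: trans_le_add2)
  qed auto
  also have "\<dots> \<le> 1 / real M - 1 / real (M + Max (insert 0 P))" by (rule step)
  also have "\<dots> \<le> 1 / real M" by simp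
  finally show ?thesis .
qed

section \<open>Residue classes of the roots of a quadratic polynomial\<close>

lemma card_one_class:
  fixes m :: int
  assumes m: "m > 0" and T: "T \<ge> 0" and X: "X \<subseteq> {-T..T}"
    and cls: "\<And>x y. x \<in> X \<Longrightarrow> y \<in> X \<Longrightarrow> m dvd x - y"
  shows "real (card X) \<le> side T / real_of_int m + 1"
proof (cases "X = {}")
  case True
  then show ?thesis using m T by simp
next
  case False
  then obtain x where x: "x \<in> X" by blast
  have "X \<subseteq> {y \<in> {-T..T}. y mod m = x mod m}" using X cls[OF _ x] by (auto simp: mod_eq_dvd_iff)
  then have "real (card X) \<le> real (card {y \<in> {-T..T}. y mod m = x mod m})"
    by (intro of_nat_mono card_mono finite_subset[of "{y \<in> {-T..T}. y mod m = x mod m}" "{-T..T}"]) auto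
  also have "\<dots> \<le> side T / real_of_int m + 1"
    by (rule card_residue_class(1)[OF m T])
  finally show ?thesis .
qed

text \<open>Asking for a congruent pair among any three elements expresses "at most two classes"
  without naming them, so that it can be read off from polynomial identities.\<close>

lemma card_two_classes:
  fixes m :: int
  assumes m: "m > 0" and T: "T \<ge> 0" and X: "X \<subseteq> {-T..T}"
    and cls: "\<And>x y z. x \<in> X \<Longrightarrow> y \<in> X \<Longrightarrow> z \<in> X \<Longrightarrow> m dvd x - y \<or> m dvd x - z \<or> m dvd y - z"
  shows "real (card X) \<le> 2 * (side T / real_of_int m + 1)"
proof -
  define L where "L = side T / real_of_int m"
  have L: "L \<ge> 0" unfolding L_def using m T by simp
  show ?thesis unfolding L_def[symmetric]
  proof (cases "\<exists>x\<in>X. \<exists>y\<in>X. \<not> m dvd x - y")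
    case False
    then have "real (card X) \<le> L + 1"
      unfolding L_def by (intro card_one_class[OF m T X]) auto
    also have "L + 1 \<le> 2 * (L + 1)" using L by simp
    finally show "real (card X) \<le> 2 * (L + 1)" .
  next
    case True
    then obtain x y where xy: "x \<in> X" "y \<in> X" "\<not> m dvd x - y" by blast
    have *: "m dvd a - b" if "m dvd x - a" "m dvd x - b" for x a b
      using dvd_diff[OF that(2,1)] by simp
    have "X = {z \<in> X. m dvd x - z} \<union> {z \<in> X. m dvd y - z}" using cls[OF xy(1,2)] xy(3) by blast
    then have "card X \<le> card {z \<in> X. m dvd x - z} + card {z \<in> X. m dvd y - z}"
      using card_Un_le[of "{z \<in> X. m dvd x - z}" "{z \<in> X. m dvd y - z}"] by simp
    then have "real (card X) \<le> real (card {z \<in> X. m dvd x - z}) + real (card {z \<in> X. m dvd y - z})"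
      by (simp flip: of_nat_add)
    moreover have "real (card {z \<in> X. m dvd x - z}) \<le> L + 1"
      unfolding L_def by (rule card_one_class[OF m T]) (use X * in auto)
    moreover have "real (card {z \<in> X. m dvd y - z}) \<le> L + 1"
      unfolding L_def by (rule card_one_class[OF m T]) (use X * in auto)
    ultimately show "real (card X) \<le> 2 * (L + 1)" unfolding distrib_left by linarith
  qed
qed

locale int_quadratic =
  fixes \<alpha> \<beta> \<gamma> :: int
begin

definition f where "f x = \<alpha> * x^2 + \<beta> * x + \<gamma>"
definition D where "D = \<beta>^2 - 4 * \<alpha> * \<gamma>"

lemma f_diff: "f x - f y = (x - y) * (\<alpha> * (x + y) + \<beta>)"
  by (simp add: f_def algebra_simps power2_eq_square)

lemma D_eq: "D = (2 * \<alpha> * x + \<beta>)^2 - 4 * \<alpha> * f x"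
  by (simp add: D_def f_def algebra_simps power2_eq_square)

text \<open>If two roots differ modulo \<open>p^2\<close>, then \<open>p\<close> divides the
  cofactor \<open>\<alpha> (x + y) + \<beta>\<close>. Were they congruent modulo \<open>p\<close>,
  \<open>p\<close> would divide the derivative and hence \<open>D\<close>. Three classes would thus
  be three distinct roots modulo \<open>p\<close>, forcing \<open>p\<close> to divide
  \<open>\<alpha>\<close> and \<open>\<beta>\<close>, and again \<open>D\<close>.\<close>

lemma three_roots_unramified:
  assumes p: "prime p" and D: "\<not> p dvd D"
    and f: "p^2 dvd f x" "p^2 dvd f y" "p^2 dvd f z"
  shows "p^2 dvd x - y \<or> p^2 dvd x - z \<or> p^2 dvd y - z"
proof (rule ccontr)
  assume "\<not> ?thesis"
  then have nd: "\<not> p^2 dvd x - y" "\<not> p^2 dvd x - z" "\<not> p^2 dvd y - z" by auto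
  have pp: "p dvd f x" if "p^2 dvd f x" for x using that by (metis dvd_trans dvd_triv_left power2_eq_square)
  have sep: "p dvd \<alpha> * (x + y) + \<beta>" if f: "p^2 dvd f x" "p^2 dvd f y" and nd: "\<not> p^2 dvd x - y" for x y
  proof (rule ccontr)
    assume n: "\<not> p dvd \<alpha> * (x + y) + \<beta>"
    then have "coprime (p^2) (\<alpha> * (x + y) + \<beta>)" using p by (simp add: prime_imp_coprime)
    moreover have "p^2 dvd (x - y) * (\<alpha> * (x + y) + \<beta>)" using dvd_diff[OF f] f_diff[of x y] by simp
    ultimately show False using nd by (simp add: coprime_dvd_mult_left_iff)
  qed
  have np: "\<not> p dvd x - y" if f: "p^2 dvd f x" "p^2 dvd f y" and nd: "\<not> p^2 dvd x - y" for x y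
  proof
    assume "p dvd x - y"
    then have "p dvd (\<alpha> * (x + y) + \<beta>) + \<alpha> * (x - y)" using sep[OF f nd] by simp
    moreover have "(\<alpha> * (x + y) + \<beta>) + \<alpha> * (x - y) = 2 * \<alpha> * x + \<beta>" by (simp add: algebra_simps)
    ultimately have "p dvd (2 * \<alpha> * x + \<beta>)^2" by (simp add: power2_eq_square)
    then have "p dvd D" unfolding D_eq[of x] using pp[OF f(1)] by (intro dvd_diff dvd_mult) auto
    then show False using D by simp
  qed
  have "p dvd (\<alpha> * (x + y) + \<beta>) - (\<alpha> * (x + z) + \<beta>)"
    by (intro dvd_diff sep f nd)
  then have "p dvd \<alpha> * (y - z)" by (simp add: algebra_simps)
  then have a: "p dvd \<alpha>" using p np[OF f(2,3) nd(3)] by (simp add: prime_dvd_mult_iff)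
  have "p dvd (\<alpha> * (x + y) + \<beta>) - \<alpha> * (x + y)" using sep[OF f(1,2) nd(1)] a by (intro dvd_diff) auto
  then have "p dvd \<beta>" by simp
  then have "p dvd D" unfolding D_def using a by (simp add: power2_eq_square)
  then show False using D by simp
qed

text \<open>By \<open>(2 \<alpha> x + \<beta>)^2 = D + 4 \<alpha> f x\<close> the derivative
  vanishes at every root modulo \<open>p\<close>, so there is only a double root. If
  \<open>p\<close> divides \<open>\<alpha>\<close>, it also divides \<open>\<beta>\<close> and then
  \<open>\<gamma>\<close>, which is excluded.\<close>

lemma two_roots_ramified:
  assumes p: "prime p" "p > 2" and D: "p dvd D" and n: "\<not> (p dvd \<alpha> \<and> p dvd \<beta> \<and> p dvd \<gamma>)"
    and f: "p dvd f x" "p dvd f y"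
  shows "p dvd x - y"
proof -
  have lin: "p dvd 2 * \<alpha> * x + \<beta>" if "p dvd f x" for x
  proof -
    have "(2 * \<alpha> * x + \<beta>)^2 = D + 4 * \<alpha> * f x" using D_eq[of x] by simp
    also have "p dvd \<dots>" using D that by simp
    finally show ?thesis using p(1) prime_dvd_power by blast
  qed
  have "p dvd (2 * \<alpha> * x + \<beta>) - (2 * \<alpha> * y + \<beta>)" by (intro dvd_diff lin f)
  then have "p dvd 2 * \<alpha> * (x - y)" by (simp add: algebra_simps)
  moreover have "\<not> p dvd 2" using p(2) by (auto dest: zdvd_imp_le)
  ultimately have "p dvd \<alpha> \<or> p dvd x - y" using p(1) by (auto simp: prime_dvd_mult_iff)
  moreover have False if a: "p dvd \<alpha>"
  proof -
    have "p dvd (2 * \<alpha> * x + \<beta>) - 2 * \<alpha> * x" using lin[OF f(1)] a by (intro dvd_diff) auto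
    then have b: "p dvd \<beta>" by simp
    have "p dvd f x - (\<alpha> * x^2 + \<beta> * x)" using f(1) a b by (intro dvd_diff dvd_add) auto
    then have "p dvd \<gamma>" by (simp add: f_def)
    then show False using a b n by blast
  qed
  ultimately show ?thesis by blast
qed

lemma abs_f_le:
  assumes "\<bar>x\<bar> \<le> T" "T \<ge> 1"
  shows "\<bar>f x\<bar> \<le> (\<bar>\<alpha>\<bar> + \<bar>\<beta>\<bar> + \<bar>\<gamma>\<bar>) * T^2"
proof -
  have x2: "x^2 \<le> T^2" using assms by (simp add: abs_le_square_iff[symmetric])
  have T2: "T \<le> T^2" "1 \<le> T^2" using assms(2) by (simp_all add: self_le_power)
  have "\<bar>f x\<bar> \<le> \<bar>\<alpha>\<bar> * x^2 + \<bar>\<beta>\<bar> * \<bar>x\<bar> + \<bar>\<gamma>\<bar>"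
    unfolding f_def
    using abs_triangle_ineq[of "\<alpha> * x^2 + \<beta> * x" \<gamma>] abs_triangle_ineq[of "\<alpha> * x^2" "\<beta> * x"]
    by (simp add: abs_mult)
  also have "\<dots> \<le> \<bar>\<alpha>\<bar> * T^2 + \<bar>\<beta>\<bar> * T^2 + \<bar>\<gamma>\<bar> * T^2"
    using x2 T2 assms by (intro add_mono mult_left_mono) (auto simp: mult_le_cancel_left1)
  finally show ?thesis by (simp add: algebra_simps)
qed

end

section \<open>Large square divisors along one line\<close>

abbreviation large_primes :: "nat \<Rightarrow> int \<Rightarrow> nat set" where
  "large_primes M g \<equiv> {p. prime p \<and> M < p \<and> int p dvd g}"

definition prime_weight :: "nat \<Rightarrow> int \<Rightarrow> real" where
  "prime_weight M g = (\<Sum>p | prime p \<and> M < p \<and> int p dvd g. 1 / real p)"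

lemma finite_prime_divisors: "g \<noteq> 0 \<Longrightarrow> finite (large_primes M g)"
proof -
  assume g: "g \<noteq> 0"
  have "(large_primes M g) \<subseteq> {..nat \<bar>g\<bar>}"
    using g by (auto dest!: dvd_imp_le_int)
  then show ?thesis using finite_subset by blast
qed

lemma prime_weight_nonneg: "prime_weight M g \<ge> 0"
  unfolding prime_weight_def by (intro sum_nonneg) auto

abbreviation large_square :: "nat \<Rightarrow> int \<Rightarrow> bool" where
  "large_square M m \<equiv> \<exists>p. prime p \<and> p > M \<and> int p ^ 2 dvd m"

abbreviation square_count :: "nat \<Rightarrow> (int \<Rightarrow> int) \<Rightarrow> int \<Rightarrow> real" where
  "square_count M g T \<equiv> real (card {x \<in> {-T..T}. large_square M (g x)})"

context int_quadratic
begin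

lemma large_square_divisors:
  assumes M: "M \<ge> 2" and D: "D \<noteq> 0"
    and n: "\<And>p. prime p \<Longrightarrow> p > M \<Longrightarrow> \<not> (int p dvd \<alpha> \<and> int p dvd \<beta> \<and> int p dvd \<gamma>)"
    and e: "e > 0"
  shows "\<forall>\<^sub>F T in at_top. square_count M f T
    \<le> side T * (2 / real M + prime_weight M D + e)"
proof -
  define B where "B = nat (\<bar>\<alpha>\<bar> + \<bar>\<beta>\<bar> + \<bar>\<gamma>\<bar> + 1)"
  have B: "int B = \<bar>\<alpha>\<bar> + \<bar>\<beta>\<bar> + \<bar>\<gamma>\<bar> + 1" "B \<ge> 1" by (simp_all add: B_def)
  \<comment> \<open>A zero of \<open>f\<close> gives no bound on \<open>p\<close>. Zeros are instead
    counted with this auxiliary prime, whose square divides 0 like any other.\<close>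
  obtain p0 where p0: "prime p0" "p0 > max M (nat \<bar>D\<bar>)" using bigger_prime by blast
  have p0D: "\<not> int p0 dvd D" using p0(2) D by (auto dest!: dvd_imp_le_int)
  \<comment> \<open>There are two classes for each prime up to \<open>B T\<close>; the constant is
    chosen so that their additive errors total at most \<open>e T\<close> plus a constant.\<close>
  obtain K where K: "\<And>x. real (prime_count x) \<le> e / (2 * real B) * real x + K"
    using prime_count_sublinear[of "e / (2 * real B)"] e B(2) by auto
  define P2 where "P2 = large_primes M D"
  have fin2: "finite P2" unfolding P2_def by (rule finite_prime_divisors[OF D])
  define K' where "K' = 2 * K + real (card P2)"
  show ?thesis
    \<comment> \<open>The second bound gives \<open>K' \<le> e T\<close>, so that
      \<open>e T + K'\<close> is at most \<open>2 e T\<close>, below \<open>e\<close> times the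
      side.\<close>
    using eventually_ge_at_top[of "int p0"] eventually_ge_at_top[of "\<lceil>K' / e\<rceil>"]
  proof eventually_elim
    case (elim T)
    have T1: "T \<ge> 1" using elim(1) p0(1) prime_gt_0_nat[of p0] by linarith
    define P1 where "P1 = {p. prime p \<and> M < p \<and> p \<le> B * nat T \<and> \<not> int p dvd D}"
    have fin1: "finite P1" unfolding P1_def by (rule finite_subset[of _ "{..B * nat T}"]) auto
    define S where "S p = {x \<in> {-T..T}. int p ^ 2 dvd f x}" for p
    have "p0 \<in> P1"
    proof -
      have "p0 \<le> nat T" using elim(1) by simp
      also have "\<dots> \<le> B * nat T" using B(2) by simp
      finally show ?thesis using p0 p0D by (simp add: P1_def)
    qed
    have finS: "finite (S p)" for p unfolding S_def by (rule finite_subset[of _ "{-T..T}"]) auto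
    have "{x \<in> {-T..T}. large_square M (f x)} \<subseteq> (\<Union>p\<in>P1. S p) \<union> (\<Union>p\<in>P2. S p)"
    proof
      fix x assume "x \<in> {x \<in> {-T..T}. large_square M (f x)}"
      then obtain p where x: "x \<in> {-T..T}" and p: "prime p" "p > M" "int p ^ 2 dvd f x" by blast
      show "x \<in> (\<Union>p\<in>P1. S p) \<union> (\<Union>p\<in>P2. S p)"
      proof (cases "f x = 0 \<or> int p dvd D")
        case True
        then show ?thesis using x p \<open>p0 \<in> P1\<close> by (auto simp: S_def P2_def)
      next
        case False
        then have "int p ^ 2 \<le> \<bar>f x\<bar>" using p(3) dvd_imp_le_int[of "f x" "int p ^ 2"] by simp
        also have "\<dots> \<le> (\<bar>\<alpha>\<bar> + \<bar>\<beta>\<bar> + \<bar>\<gamma>\<bar>) * T^2" using x T1 by (intro abs_f_le) auto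
        also have "\<dots> \<le> int B ^ 2 * T^2"
        proof (rule mult_right_mono)
          have "int B \<le> int B ^ 2" using B(2) by (simp add: self_le_power)
          then show "\<bar>\<alpha>\<bar> + \<bar>\<beta>\<bar> + \<bar>\<gamma>\<bar> \<le> int B ^ 2" using B(1) by linarith
        qed simp
        also have "\<dots> = (int (B * nat T))^2" using T1 by (simp add: power_mult_distrib)
        finally have "p \<le> B * nat T" by (metis of_nat_le_iff of_nat_power power2_nat_le_eq_le)
        then show ?thesis using False x p by (auto simp: S_def P1_def)
      qed
    qed
    then have "card {x \<in> {-T..T}. large_square M (f x)} \<le> card ((\<Union>p\<in>P1. S p) \<union> (\<Union>p\<in>P2. S p))"
      by (intro card_mono) (auto simp: fin1 fin2 finS)
    also have "\<dots> \<le> (\<Sum>p\<in>P1. card (S p)) + (\<Sum>p\<in>P2. card (S p))"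
      using card_Un_le[of "\<Union>p\<in>P1. S p" "\<Union>p\<in>P2. S p"] card_UN_le[OF fin1, of S] card_UN_le[OF fin2, of S] by linarith
    finally have "square_count M f T \<le>
        (\<Sum>p\<in>P1. real (card (S p))) + (\<Sum>p\<in>P2. real (card (S p)))"
      by (simp flip: of_nat_add of_nat_sum)
    also have "(\<Sum>p\<in>P1. real (card (S p))) \<le> (\<Sum>p\<in>P1. 2 * (side T * (1 / real p ^ 2) + 1))"
    proof (rule sum_mono)
      fix p assume "p \<in> P1"
      then have p: "prime (int p)" "\<not> int p dvd D" by (auto simp: P1_def)
      have "real (card (S p)) \<le> 2 * (side T / real_of_int (int p ^ 2) + 1)"
        by (rule card_two_classes) (use T1 p three_roots_unramified[OF p] in \<open>auto simp: S_def prime_gt_0_int\<close>)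
      then show "real (card (S p)) \<le> 2 * (side T * (1 / real p ^ 2) + 1)" by simp
    qed
    also have "\<dots> = 2 * (side T * (\<Sum>p\<in>P1. 1 / real p ^ 2) + real (card P1))"
      by (simp only: sum_distrib_left[symmetric] sum.distrib) simp
    also have "\<dots> \<le> 2 * (side T * (1 / real M) + real (prime_count (B * nat T)))"
    proof (intro mult_left_mono add_mono)
      show "(\<Sum>p\<in>P1. 1 / real p ^ 2) \<le> 1 / real M"
        by (rule sum_inverse_squares_le) (use M fin1 in \<open>auto simp: P1_def\<close>)
      show "real (card P1) \<le> real (prime_count (B * nat T))"
        unfolding prime_count_def by (intro of_nat_mono card_mono) (auto simp: P1_def)
    qed (use T1 in auto)
    also have "(\<Sum>p\<in>P2. real (card (S p))) \<le> (\<Sum>p\<in>P2. side T * (1 / real p) + 1)"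
    proof (rule sum_mono)
      fix p assume "p \<in> P2"
      then have p: "prime (int p)" "int p > 2" "int p dvd D" "\<not> (int p dvd \<alpha> \<and> int p dvd \<beta> \<and> int p dvd \<gamma>)"
        using M n by (auto simp: P2_def)
      have dv: "int p dvd f x" if "x \<in> S p" for x
        using that dvd_trans[of "int p" "int p ^ 2" "f x"] by (simp add: S_def)
      have "real (card (S p)) \<le> side T / real_of_int (int p) + 1"
        by (rule card_one_class) (use T1 p two_roots_ramified[OF p] dv in \<open>auto simp: S_def\<close>)
      then show "real (card (S p)) \<le> side T * (1 / real p) + 1" by simp
    qed
    also have "\<dots> = side T * prime_weight M D + real (card P2)"
      unfolding prime_weight_def P2_def by (simp only: sum_distrib_left[symmetric] sum.distrib) simp
    finally have "square_count M f T \<le>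
        side T * (2 / real M + prime_weight M D) + (2 * real (prime_count (B * nat T)) + real (card P2))"
      by (simp add: algebra_simps)
    also have "2 * real (prime_count (B * nat T)) + real (card P2) \<le> side T * e"
    proof -
      have "real (prime_count (B * nat T)) \<le> e / (2 * real B) * real (B * nat T) + K" by (rule K)
      also have "e / (2 * real B) * real (B * nat T) = e / 2 * real_of_int T" using B(2) T1 by simp
      finally have "2 * real (prime_count (B * nat T)) + real (card P2) \<le> e * real_of_int T + K'"
        unfolding K'_def by linarith
      also have "K' \<le> e * real_of_int T"
      proof -
        have "K' / e \<le> real_of_int T" using elim(2) by linarith
        then show ?thesis using e by (simp add: field_simps)
      qed
      finally show ?thesis using e by (simp add: algebra_simps)
    qed
    finally show ?case by (simp add: algebra_simps)
  qed
qed

end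

section \<open>Averages over boxes\<close>

text \<open>A sum over infinitely many primes is 0 by convention, so \<open>prime_weight\<close>
  does not see \<open>g = 0\<close>; the indicator gives it weight 1.\<close>

definition weight0 :: "nat \<Rightarrow> int \<Rightarrow> real" where
  "weight0 M g = of_bool (g = 0) + prime_weight M g"

definition capped_weight :: "nat \<Rightarrow> int \<Rightarrow> real" where
  "capped_weight M g = min 1 (weight0 M g)"

lemma prime_weight_0: "prime_weight M 0 = 0"
proof -
  have "infinite (large_primes M 0)"
  proof
    assume "finite (large_primes M 0)"
    then obtain b where b: "\<And>p. prime p \<Longrightarrow> M < p \<Longrightarrow> p \<le> b"
      using finite_nat_set_iff_bounded_le by auto
    obtain p where "prime p" "p > max M b" using bigger_prime by blast
    then show False using b[of p] by auto
  qed
  then show ?thesis by (simp add: prime_weight_def)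
qed

lemma weight0_0 [simp]: "weight0 M 0 = 1"
  by (simp add: weight0_def prime_weight_0)

lemma weight0_nonneg: "weight0 M g \<ge> 0"
  using prime_weight_nonneg[of M g] by (simp add: weight0_def)

abbreviation nonzero_multiples :: "nat \<Rightarrow> int \<Rightarrow> int set" where
  "nonzero_multiples p R \<equiv> {x \<in> {-R..R}. x \<noteq> 0 \<and> int p dvd x}"

text \<open>Leaving out 0 removes the additive error, so the bound remains useful for
  \<open>p > R\<close> and can be summed over all primes without a cutoff.\<close>

lemma card_nonzero_multiples:
  assumes p: "p > 0" and R: "R \<ge> 0"
  shows "real (card (nonzero_multiples p R)) \<le> 2 * real_of_int R / real p"
proof -
  let ?k = "R div int p"
  have "(nonzero_multiples p R) \<subseteq> (\<lambda>k. int p * k) ` ({-?k..?k} - {0})"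
  proof
    fix x assume "x \<in> (nonzero_multiples p R)"
    then obtain k where k: "x = int p * k" "\<bar>x\<bar> \<le> R" "x \<noteq> 0" by (auto elim!: dvdE)
    have "int p * \<bar>k\<bar> \<le> R" using k p by (simp add: abs_mult)
    then have "\<bar>k\<bar> \<le> ?k" using zdiv_mono1[of "int p * \<bar>k\<bar>" R "int p"] p by simp
    then have "k \<in> {-?k..?k} - {0}" using k by (simp add: abs_le_iff)
    then show "x \<in> (\<lambda>k. int p * k) ` ({-?k..?k} - {0})" using k(1) by blast
  qed
  then have "card (nonzero_multiples p R) \<le> card ({-?k..?k} - {0})"
    by (rule surj_card_le[rotated]) (rule finite_Diff, simp)
  also have "\<dots> = nat (2 * ?k)"
  proof -
    have "card ({-k..k} - {0}) = nat (2 * k)" if "k \<ge> 0" for k :: int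
      using that by (subst card_Diff_singleton) simp_all
    moreover have "?k \<ge> 0" using p R by (simp add: pos_imp_zdiv_nonneg_iff)
    ultimately show ?thesis by blast
  qed
  finally have "real (card (nonzero_multiples p R)) \<le> real (nat (2 * ?k))"
    by (simp only: of_nat_le_iff)
  also have "real (nat (2 * ?k)) = 2 * real_of_int ?k"
    using p R by (simp add: pos_imp_zdiv_nonneg_iff)
  also have "real_of_int ?k \<le> real_of_int R / real p"
    using real_of_int_div4[of R "int p"] by simp
  finally show ?thesis by simp
qed

lemma finite_primes_dividing:
  assumes "finite X"
  shows "finite {p. prime p \<and> M < p \<and> (\<exists>x\<in>X. g x \<noteq> 0 \<and> int p dvd g x)}"
proof -
  have "{p. prime p \<and> M < p \<and> (\<exists>x\<in>X. g x \<noteq> 0 \<and> int p dvd g x)} \<subseteq>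
      (\<Union>x\<in>{x \<in> X. g x \<noteq> 0}. (large_primes M (g x)))" by auto
  then show ?thesis by (rule finite_subset) (auto simp: assms finite_prime_divisors)
qed

lemma sum_prime_weight:
  assumes "finite X"
  shows "(\<Sum>x\<in>X. prime_weight M (g x)) =
    (\<Sum>p | prime p \<and> M < p \<and> (\<exists>x\<in>X. g x \<noteq> 0 \<and> int p dvd g x).
      real (card {x \<in> X. g x \<noteq> 0 \<and> int p dvd g x}) * (1 / real p))"
proof -
  let ?P = "{p. prime p \<and> M < p \<and> (\<exists>x\<in>X. g x \<noteq> 0 \<and> int p dvd g x)}"
  have fin: "finite ?P" by (rule finite_primes_dividing[OF assms])
  have "(\<Sum>x\<in>X. prime_weight M (g x)) = (\<Sum>x\<in>X. \<Sum>p\<in>?P. of_bool (g x \<noteq> 0 \<and> int p dvd g x) * (1 / real p))"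
  proof (rule sum.cong[OF refl])
    fix x assume x: "x \<in> X"
    show "prime_weight M (g x) = (\<Sum>p\<in>?P. of_bool (g x \<noteq> 0 \<and> int p dvd g x) * (1 / real p))"
    proof (cases "g x = 0")
      case True
      then show ?thesis by (simp add: prime_weight_0)
    next
      case False
      have "prime_weight M (g x) = (\<Sum>p | prime p \<and> M < p \<and> int p dvd g x. of_bool (g x \<noteq> 0 \<and> int p dvd g x) * (1 / real p))"
        unfolding prime_weight_def by (rule sum.cong) (use False in auto)
      also have "\<dots> = (\<Sum>p\<in>?P. of_bool (g x \<noteq> 0 \<and> int p dvd g x) * (1 / real p))"
        by (rule sum.mono_neutral_left[OF fin]) (use False x in auto)
      finally show ?thesis .
    qed
  qed
  also have "\<dots> = (\<Sum>p\<in>?P. \<Sum>x\<in>X. of_bool (g x \<noteq> 0 \<and> int p dvd g x) * (1 / real p))"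
    by (rule sum.swap)
  also have "\<dots> = (\<Sum>p\<in>?P. real (card {x \<in> X. g x \<noteq> 0 \<and> int p dvd g x}) * (1 / real p))"
    unfolding sum_distrib_right[symmetric] using assms
    by (intro sum.cong refl arg_cong2[where f="(*)"]) (simp add: Int_def)
  finally show ?thesis .
qed

text \<open>Nonzero multiples of \<open>p\<close> have frequency at most \<open>1 / p\<close> and
  cost \<open>1 / p\<close> each, which sums to \<open>1 / M\<close>. The point 0 costs 1, at most
  \<open>side R / M\<close> because \<open>R \<ge> M\<close>.\<close>

lemma sum_weight0_interval:
  assumes M: "M \<ge> 1" and R: "R \<ge> int M"
  shows "(\<Sum>x\<in>{-R..R}. weight0 M x) \<le> side R * (2 / real M)"
proof -
  have R0: "R \<ge> 1" using M R by simp
  let ?P = "{p. prime p \<and> M < p \<and> (\<exists>x\<in>{-R..R}. x \<noteq> 0 \<and> int p dvd x)}"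
  have fin: "finite ?P" by (rule finite_primes_dividing) simp
  have "(\<Sum>x\<in>{-R..R}. prime_weight M x) = (\<Sum>p\<in>?P. real (card (nonzero_multiples p R)) * (1 / real p))"
    using sum_prime_weight[of "{-R..R}" M "\<lambda>x. x"] by simp
  also have "\<dots> \<le> (\<Sum>p\<in>?P. 2 * real_of_int R * (1 / real p ^ 2))"
  proof (rule sum_mono)
    fix p assume "p \<in> ?P"
    then have "p > 0" by auto
    then have "real (card (nonzero_multiples p R)) * (1 / real p) \<le> (2 * real_of_int R / real p) * (1 / real p)"
      using R0 by (intro mult_right_mono card_nonzero_multiples) auto
    then show "real (card (nonzero_multiples p R)) * (1 / real p) \<le> 2 * real_of_int R * (1 / real p ^ 2)"
      by (simp add: power2_eq_square)
  qed
  also have "\<dots> = 2 * real_of_int R * (\<Sum>p\<in>?P. 1 / real p ^ 2)" by (rule sum_distrib_left[symmetric])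
  also have "\<dots> \<le> 2 * real_of_int R * (1 / real M)"
    using R0 fin by (intro mult_left_mono sum_inverse_squares_le M) auto
  finally have 1: "(\<Sum>x\<in>{-R..R}. prime_weight M x) \<le> 2 * real_of_int R * (1 / real M)" .
  have "(\<Sum>x\<in>{-R..R}. of_bool (x = 0)) = (1::real)"
    using R0 by simp
  also have "1 \<le> side R * (1 / real M)"
    using M R by (simp add: field_simps)
  finally have "(\<Sum>x\<in>{-R..R}. weight0 M x) \<le> side R * (1 / real M) + 2 * real_of_int R * (1 / real M)"
    using 1 unfolding weight0_def sum.distrib by linarith
  also have "\<dots> \<le> side R * (1 / real M) + side R * (1 / real M)"
    by (intro add_left_mono mult_right_mono) auto
  finally show ?thesis by (simp add: algebra_simps)
qed

lemma card_large_prime_divisors: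
  assumes g: "g \<noteq> 0" "\<bar>g\<bar> < (int L)^3"
  shows "card (large_primes L g) \<le> 2"
proof (rule ccontr)
  let ?P = "large_primes L g"
  assume "\<not> card ?P \<le> 2"
  then obtain Q where Q: "Q \<subseteq> ?P" "card Q = 3" "finite Q"
    using obtain_subset_with_card_n[of 3 ?P] by auto
  have "(\<Prod>p\<in>Q. p) dvd nat \<bar>g\<bar>"
  proof (rule prod_dvd_of_pairwise_coprime[OF Q(3)])
    show "p dvd nat \<bar>g\<bar>" if "p \<in> Q" for p
    proof -
      have "int p dvd int (nat \<bar>g\<bar>)" using that Q(1) by auto
      then show ?thesis by (simp only: int_dvd_int_iff)
    qed
    show "coprime p p'" if "p \<in> Q" "p' \<in> Q" "p \<noteq> p'" for p p'
      using that Q(1) by (intro primes_coprime) auto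
  qed
  then have "(\<Prod>p\<in>Q. p) \<le> nat \<bar>g\<bar>" using g(1) by (intro dvd_imp_le) auto
  moreover have "L ^ card Q \<le> (\<Prod>p\<in>Q. p)"
  proof -
    have "(\<Prod>p\<in>Q. L) \<le> (\<Prod>p\<in>Q. p)" by (rule prod_mono) (use Q(1) in auto)
    then show ?thesis by simp
  qed
  ultimately have "L ^ 3 \<le> nat \<bar>g\<bar>" using Q(2) by simp
  then have "int (L ^ 3) \<le> int (nat \<bar>g\<bar>)" by (simp only: of_nat_le_iff)
  then have "int L ^ 3 \<le> \<bar>g\<bar>" by simp
  then show False using g(2) by simp
qed

text \<open>
  The cap is needed on lines with \<open>u = 0\<close>, where the uncapped weight may be unbounded. The case \<open>q = 0\<close>
  of \<open>roots\<close> speaks about zeros of \<open>g\<close>. A nonzero value has at most two prime factors above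
  \<open>2 R + 1\<close> by \<open>bound\<close>, which is why the line has to run along a longest side of the box.
\<close>

lemma sum_capped_weight_line:
  fixes g :: "int \<Rightarrow> int"
  assumes M: "M \<ge> 2" and R: "R \<ge> int M"
    and bound: "\<And>x. \<bar>x\<bar> \<le> R \<Longrightarrow> \<bar>g x\<bar> < (2 * R + 1)^3"
    and roots: "\<And>q x y z. q = 0 \<or> prime q \<and> q > 2 \<Longrightarrow> \<not> q dvd u \<Longrightarrow>
      q dvd g x \<Longrightarrow> q dvd g y \<Longrightarrow> q dvd g z \<Longrightarrow> q dvd x - y \<or> q dvd x - z \<or> q dvd y - z"
  shows "(\<Sum>x\<in>{-R..R}. capped_weight M (g x)) \<le> side R * (weight0 M u + 6 / real M)"
proof (cases "u = 0")
  case True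
  have R0: "R \<ge> 2" using M R by simp
  have "(\<Sum>x\<in>{-R..R}. capped_weight M (g x)) \<le> (\<Sum>x\<in>{-R..R}. 1)"
    by (rule sum_mono) (simp add: capped_weight_def)
  also have "\<dots> = side R * 1" using R0 by simp
  also have "\<dots> \<le> side R * (weight0 M u + 6 / real M)"
    using R0 True by (intro mult_left_mono) auto
  finally show ?thesis .
next
  case False
  have R0: "R \<ge> 2" using M R by simp
  define L where "L = nat (2 * R + 1)"
  have L: "int L = 2 * R + 1" "real L = side R" "L \<ge> 5" using R0 by (simp_all add: L_def)
  let ?X = "{-R..R}"
  define P where "P = {p. prime p \<and> M < p \<and> (\<exists>x\<in>?X. g x \<noteq> 0 \<and> int p dvd g x)}"
  define N where "N p = real (card {x \<in> ?X. g x \<noteq> 0 \<and> int p dvd g x})" for p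
  let ?w = "\<lambda>p. N p * (1 / real p)"
  define Pu where "Pu = large_primes M u"
  define Ps where "Ps = {p \<in> P. \<not> int p dvd u \<and> p \<le> L}"
  define Pl where "Pl = {p \<in> P. L < p}"
  have fin: "finite P" unfolding P_def by (rule finite_primes_dividing) simp
  have fins: "finite Ps" and finl: "finite Pl"
    using fin finite_subset[of Ps P] finite_subset[of Pl P] by (auto simp: Ps_def Pl_def)
  have finu: "finite Pu" unfolding Pu_def by (rule finite_prime_divisors[OF False])
  have card_le_L: "real (card X) \<le> real L" if "X \<subseteq> ?X" for X
    using card_mono[OF _ that] R0 L(1) by simp
  have zeros: "real (card {x \<in> ?X. g x = 0}) \<le> 2"
  proof (rule ccontr)
    assume "\<not> ?thesis"
    then obtain Y where Y: "Y \<subseteq> {x \<in> ?X. g x = 0}" "card Y = 3"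
      using obtain_subset_with_card_n[of 3 "{x \<in> ?X. g x = 0}"] by auto
    then obtain x y z where xyz: "Y = {x, y, z}" "x \<noteq> y" "y \<noteq> z" "x \<noteq> z"
      unfolding card_3_iff by blast
    then have "g x = 0" "g y = 0" "g z = 0" using Y(1) by auto
    then show False using roots[of 0 x y z] xyz False by simp
  qed
  have "(\<Sum>x\<in>?X. prime_weight M (g x)) = sum ?w P"
    unfolding P_def N_def by (rule sum_prime_weight) simp
  also have "\<dots> \<le> (\<Sum>p\<in>Pu \<union> (Ps \<union> Pl). N p * (1 / real p))"
  proof (rule sum_mono2)
    show "finite (Pu \<union> (Ps \<union> Pl))" using finu fins finl by simp
    show "P \<subseteq> Pu \<union> (Ps \<union> Pl)" by (auto simp: Ps_def Pl_def Pu_def P_def)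
  qed (simp add: N_def)
  also have "\<dots> \<le> sum ?w Pu + (sum ?w Ps + sum ?w Pl)"
  proof -
    have un: "(\<Sum>p\<in>A \<union> B. N p * (1 / real p)) \<le> sum ?w A + sum ?w B"
      if "finite A" "finite B" for A B
    proof -
      have "(\<Sum>p\<in>A \<inter> B. N p * (1 / real p)) \<ge> 0" by (intro sum_nonneg) (simp add: N_def)
      then show ?thesis using sum_Un[OF that, of "\<lambda>p. N p * (1 / real p)"] by linarith
    qed
    have "finite (Ps \<union> Pl)" using fins finl by simp
    from un[OF finu this] un[OF fins finl] show ?thesis by linarith
  qed
  also have "sum ?w Pu \<le> (\<Sum>p\<in>Pu. real L * (1 / real p))"
    unfolding N_def by (intro sum_mono mult_right_mono card_le_L) auto
  also have "\<dots> = real L * prime_weight M u"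
    unfolding prime_weight_def Pu_def by (rule sum_distrib_left[symmetric])
  also have "sum ?w Ps \<le> (\<Sum>p\<in>Ps. 4 * real L * (1 / real p ^ 2))"
  proof (rule sum_mono)
    fix p assume "p \<in> Ps"
    then have p: "prime p" "M < p" "\<not> int p dvd u" "p \<le> L" by (auto simp: Ps_def P_def)
    have "N p \<le> 2 * (side R / real_of_int (int p) + 1)"
      unfolding N_def
    proof (rule card_two_classes)
      fix x y z assume "x \<in> {x \<in> ?X. g x \<noteq> 0 \<and> int p dvd g x}" "y \<in> {x \<in> ?X. g x \<noteq> 0 \<and> int p dvd g x}"
        "z \<in> {x \<in> ?X. g x \<noteq> 0 \<and> int p dvd g x}"
      then show "int p dvd x - y \<or> int p dvd x - z \<or> int p dvd y - z"
        using p M by (intro roots) auto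
    qed (use p R0 in auto)
    also have "\<dots> = 2 * (real L / real p + 1)" using L by simp
    \<comment> \<open>The additive 1 is absorbed because \<open>p \<le> L\<close>.\<close>
    also have "\<dots> \<le> 2 * (real L / real p + real L / real p)"
      using p by (intro mult_left_mono add_left_mono) auto
    finally have "N p * (1 / real p) \<le> 4 * (real L / real p) * (1 / real p)"
      by (intro mult_right_mono) auto
    then show "N p * (1 / real p) \<le> 4 * real L * (1 / real p ^ 2)" by (simp add: power2_eq_square)
  qed
  also have "\<dots> = 4 * real L * (\<Sum>p\<in>Ps. 1 / real p ^ 2)" by (rule sum_distrib_left[symmetric])
  also have "\<dots> \<le> 4 * real L * (1 / real M)"
    using M fin by (intro mult_left_mono sum_inverse_squares_le) (auto simp: Ps_def P_def)
  also have "sum ?w Pl \<le> (\<Sum>p\<in>Pl. N p * (1 / real L))"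
    using L(3) by (intro sum_mono mult_left_mono frac_le) (auto simp: Pl_def N_def)
  also have "\<dots> = (\<Sum>p\<in>Pl. N p) * (1 / real L)" by (rule sum_distrib_right[symmetric])
  also have "\<dots> \<le> 2 * real L * (1 / real L)"
  proof (rule mult_right_mono)
    have "(\<Sum>p\<in>Pl. N p) = (\<Sum>p\<in>Pl. \<Sum>x\<in>?X. of_bool (g x \<noteq> 0 \<and> int p dvd g x))"
      unfolding N_def by (intro sum.cong refl) (simp add: Int_def)
    also have "\<dots> = (\<Sum>x\<in>?X. \<Sum>p\<in>Pl. of_bool (g x \<noteq> 0 \<and> int p dvd g x))" by (rule sum.swap)
    also have "\<dots> \<le> (\<Sum>x\<in>?X. 2)"
    proof (rule sum_mono)
      fix x assume x: "x \<in> ?X"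
      have "(\<Sum>p\<in>Pl. of_bool (g x \<noteq> 0 \<and> int p dvd g x)) = real (card {p \<in> Pl. g x \<noteq> 0 \<and> int p dvd g x})"
        using finl by (simp add: Int_def)
      also have "\<dots> \<le> 2"
      proof (cases "g x = 0")
        case False
        have "card {p \<in> Pl. g x \<noteq> 0 \<and> int p dvd g x} \<le> card (large_primes L (g x))"
          by (intro card_mono finite_prime_divisors False) (auto simp: Pl_def P_def)
        also have "\<dots> \<le> 2"
          by (rule card_large_prime_divisors[OF False]) (use bound[of x] x L(1) in auto)
        finally show ?thesis by simp
      qed simp
      finally show "(\<Sum>p\<in>Pl. of_bool (g x \<noteq> 0 \<and> int p dvd g x)) \<le> (2::real)" .
    qed
    also have "\<dots> = 2 * real L" using L R0 by simp
    finally show "(\<Sum>p\<in>Pl. N p) \<le> 2 * real L" .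
  qed simp
  finally have pw: "(\<Sum>x\<in>?X. prime_weight M (g x)) \<le> real L * prime_weight M u + (4 * real L * (1 / real M) + 2 * real L * (1 / real L))"
    by simp
  have "(\<Sum>x\<in>?X. capped_weight M (g x)) \<le> (\<Sum>x\<in>?X. weight0 M (g x))"
    by (rule sum_mono) (simp add: capped_weight_def)
  also have "\<dots> = real (card {x \<in> ?X. g x = 0}) + (\<Sum>x\<in>?X. prime_weight M (g x))"
    unfolding weight0_def sum.distrib by (simp add: Int_def)
  also have "\<dots> \<le> 2 + (real L * prime_weight M u + (4 * real L * (1 / real M) + 2 * real L * (1 / real L)))"
    by (intro add_mono zeros pw)
  \<comment> \<open>The 4 collects the two possible zeros of \<open>g\<close> and the contribution 2
    of the primes above \<open>L\<close>; \<open>R \<ge> M\<close> then turns it into a multiple of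
    \<open>1 / M\<close>.\<close>
  also have "\<dots> = real L * prime_weight M u + (4 * real L * (1 / real M) + 4)"
    using L(3) by simp
  also have "\<dots> \<le> real L * prime_weight M u + (4 * real L * (1 / real M) + 2 * real L * (1 / real M))"
  proof (intro add_left_mono)
    have "2 * real M \<le> real L" using R L(2) by simp
    then show "4 \<le> 2 * real L * (1 / real M)" using M by (simp add: field_simps)
  qed
  also have "real L * prime_weight M u + (4 * real L * (1 / real M) + 2 * real L * (1 / real M)) =
      side R * (weight0 M u + 6 / real M)"
    using False unfolding L(2) by (simp add: weight0_def algebra_simps)
  finally show ?thesis by simp
qed

text \<open>For \<open>x \<noteq> 0\<close> each large prime divisor of \<open>x\<close> divides a
  proportion of at most \<open>1 / p\<close> of the nonzero \<open>y\<close>, which adds up to the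
  weight of \<open>x\<close>. The point \<open>y = 0\<close> accounts for
  \<open>1 / M\<close>.\<close>

lemma sum_common_prime_divisor:
  assumes M: "M \<ge> 1" and R: "R \<ge> int M"
  shows "(\<Sum>y\<in>{-R..R}. of_bool (\<exists>p. prime p \<and> M < p \<and> int p dvd x \<and> int p dvd y)) \<le>
    side R * (weight0 M x + 1 / real M)"
proof (cases "x = 0")
  case True
  have "(\<Sum>y\<in>{-R..R}. of_bool (\<exists>p. prime p \<and> M < p \<and> int p dvd x \<and> int p dvd y)) \<le> (\<Sum>y\<in>{-R..R}. 1::real)"
    by (rule sum_mono) simp
  also have "\<dots> = side R * 1" using R M by simp
  also have "\<dots> \<le> side R * (weight0 M x + 1 / real M)"
    using R M True by (intro mult_left_mono) auto
  finally show ?thesis .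
next
  case False
  let ?P = "large_primes M x"
  have fin: "finite ?P" by (rule finite_prime_divisors[OF False])
  have "(\<Sum>y\<in>{-R..R}. of_bool (\<exists>p. prime p \<and> M < p \<and> int p dvd x \<and> int p dvd y)) \<le>
      (\<Sum>y\<in>{-R..R}. of_bool (y = 0) + (\<Sum>p\<in>?P. of_bool (y \<noteq> 0 \<and> int p dvd y) :: real))"
  proof (rule sum_mono)
    fix y
    show "of_bool (\<exists>p. prime p \<and> M < p \<and> int p dvd x \<and> int p dvd y) \<le>
      of_bool (y = 0) + (\<Sum>p\<in>?P. of_bool (y \<noteq> 0 \<and> int p dvd y) :: real)"
    proof (cases "y \<noteq> 0 \<and> (\<exists>p. prime p \<and> M < p \<and> int p dvd x \<and> int p dvd y)")
      case True
      then obtain p where p: "p \<in> ?P" "int p dvd y" by blast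
      have "(of_bool (y \<noteq> 0 \<and> int p dvd y) :: real) \<le> (\<Sum>p\<in>?P. of_bool (y \<noteq> 0 \<and> int p dvd y))"
        by (rule member_le_sum[OF p(1) _ fin]) simp
      then show ?thesis using True p by simp
    next
      case False
      have "(\<Sum>p\<in>?P. of_bool (y \<noteq> 0 \<and> int p dvd y) :: real) \<ge> 0" by (intro sum_nonneg) simp
      then show ?thesis using False by auto
    qed
  qed
  also have "\<dots> = 1 + (\<Sum>y\<in>{-R..R}. \<Sum>p\<in>?P. of_bool (y \<noteq> 0 \<and> int p dvd y) :: real)"
    unfolding sum.distrib using R M by simp
  also have "(\<Sum>y\<in>{-R..R}. \<Sum>p\<in>?P. of_bool (y \<noteq> 0 \<and> int p dvd y) :: real) =
      (\<Sum>p\<in>?P. \<Sum>y\<in>{-R..R}. of_bool (y \<noteq> 0 \<and> int p dvd y))"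
    by (rule sum.swap)
  also have "\<dots> = (\<Sum>p\<in>?P. real (card (nonzero_multiples p R)))"
    by (simp add: Int_def)
  also have "\<dots> \<le> (\<Sum>p\<in>?P. 2 * real_of_int R / real p)"
    by (intro sum_mono card_nonzero_multiples) (use R M in auto)
  also have "\<dots> = 2 * real_of_int R * prime_weight M x"
    unfolding prime_weight_def sum_distrib_left by simp
  also have "\<dots> \<le> side R * prime_weight M x"
    by (intro mult_right_mono prime_weight_nonneg) simp
  also have "1 \<le> side R * (1 / real M)"
    using R M by (simp add: field_simps)
  finally show ?thesis using False by (simp add: weight0_def algebra_simps)
qed

lemma sum_int_box_split:
  assumes "finite I" "i \<in> I"
  shows "(\<Sum>c\<in>int_box I R. F c) = (\<Sum>c\<in>int_box (I - {i}) R. \<Sum>x\<in>{-R i..R i}. F (c(i := x)))"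
proof -
  have "(\<Sum>c\<in>int_box I R. F c) = (\<Sum>c\<in>PiE (insert i (I - {i})) (\<lambda>i. {-R i..R i}). F c)"
    using assms by (simp add: int_box_def insert_absorb)
  also have "\<dots> = (\<Sum>x\<in>{-R i..R i}. \<Sum>c\<in>int_box (I - {i}) R. F (c(i := x)))"
    unfolding int_box_def by (rule sum_PiE_insert) simp
  also have "\<dots> = (\<Sum>c\<in>int_box (I - {i}) R. \<Sum>x\<in>{-R i..R i}. F (c(i := x)))"
    by (rule sum.swap)
  finally show ?thesis .
qed

text \<open>Fubini: a bound for the averages over lines in direction \<open>i\<close>, by a function
  constant along these lines, can be summed over the box.\<close>

lemma sum_int_box_le:
  fixes F G :: "sextuple \<Rightarrow> real"
  assumes I: "finite I" "i \<in> I" and R: "R i \<ge> 0"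
    and le: "\<And>c. c \<in> int_box I R \<Longrightarrow> (\<Sum>x\<in>{-R i..R i}. F (c(i := x))) \<le> side (R i) * G c"
    and G: "\<And>c x. G (c(i := x)) = G c"
  shows "(\<Sum>c\<in>int_box I R. F c) \<le> (\<Sum>c\<in>int_box I R. G c)"
  unfolding sum_int_box_split[OF I]
proof (rule sum_mono)
  fix c assume c: "c \<in> int_box (I - {i}) R"
  \<comment> \<open>The value 0 only serves to return to a point of the full box.\<close>
  have "c(i := 0) \<in> int_box I R"
    using c R I(2) by (auto simp: int_box_def PiE_iff extensional_def)
  from le[OF this] have "(\<Sum>x\<in>{-R i..R i}. F (c(i := x))) \<le> side (R i) * G c"
    by (simp add: G)
  also have "\<dots> = (\<Sum>x\<in>{-R i..R i}. G (c(i := x)))" using R by (simp add: G)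
  finally show "(\<Sum>x\<in>{-R i..R i}. F (c(i := x))) \<le> (\<Sum>x\<in>{-R i..R i}. G (c(i := x)))" .
qed

lemma sum_weight0_coordinate:
  assumes I: "finite I" "j \<in> I" and M: "M \<ge> 1" and R: "\<And>i. i \<in> I \<Longrightarrow> R i \<ge> int M"
  shows "(\<Sum>c\<in>int_box I R. weight0 M (c j)) \<le> vol I R * (2 / real M)"
proof -
  have "(\<Sum>c\<in>int_box I R. weight0 M (c j)) \<le> (\<Sum>c\<in>int_box I R. 2 / real M)"
    by (rule sum_int_box_le[OF I]) (use R[OF I(2)] M sum_weight0_interval[OF M R[OF I(2)]] in auto)
  also have "\<dots> = vol I R * (2 / real M)"
    using card_int_box[OF I(1), of R] R by (simp add: order_trans[of 0 "int M"])
  finally show ?thesis .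
qed

text \<open>The average is at most \<open>8 / M\<close> for every shape of box with sides at least
  \<open>M\<close>; the joint outer limit calls for this uniformity.\<close>

definition thin :: "nat set \<Rightarrow> (sextuple \<Rightarrow> int) \<Rightarrow> bool" where
  "thin I g \<longleftrightarrow> (\<forall>M\<ge>2. \<forall>R. (\<forall>i\<in>I. R i \<ge> int M) \<longrightarrow>
     (\<Sum>c\<in>int_box I R. capped_weight M (g c)) \<le> vol I R * (8 / real M))"

text \<open>In the applications \<open>m\<close> is the direction of a longest side and
  \<open>5 r^2\<close> bounds a discriminant or minor with entries at most \<open>r\<close>. The
  line bound leaves \<open>weight0 M (c j) + 6 / M\<close>, and averaging over coordinate
  \<open>j\<close> adds another \<open>2 / M\<close>.\<close>

lemma sum_capped_weight_le:
  assumes I: "finite I" "m \<in> I" "j \<in> I" "m \<noteq> j" and M: "M \<ge> 2" and R: "\<And>i. i \<in> I \<Longrightarrow> R i \<ge> int M"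
    and bound: "\<And>c. c \<in> int_box I R \<Longrightarrow> \<bar>g c\<bar> \<le> 5 * (R m)^2"
    and roots: "\<And>c q x y z. q = 0 \<or> prime q \<and> q > 2 \<Longrightarrow> \<not> q dvd c j \<Longrightarrow>
      q dvd g (c(m := x)) \<Longrightarrow> q dvd g (c(m := y)) \<Longrightarrow> q dvd g (c(m := z)) \<Longrightarrow>
      q dvd x - y \<or> q dvd x - z \<or> q dvd y - z"
  shows "(\<Sum>c\<in>int_box I R. capped_weight M (g c)) \<le> vol I R * (8 / real M)"
proof -
  have Rm: "R m \<ge> int M" using R I(2) by blast
  have "(\<Sum>c\<in>int_box I R. capped_weight M (g c)) \<le> (\<Sum>c\<in>int_box I R. weight0 M (c j) + 6 / real M)"
  proof (rule sum_int_box_le[OF I(1,2)])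
    fix c assume c: "c \<in> int_box I R"
    show "(\<Sum>x\<in>{-R m..R m}. capped_weight M (g (c(m := x)))) \<le> side (R m) * (weight0 M (c j) + 6 / real M)"
    proof (rule sum_capped_weight_line[OF M Rm _ roots])
      fix x assume x: "\<bar>x\<bar> \<le> R m"
      have "c(m := x) \<in> int_box I R" using c x I(2) by (auto simp: int_box_def PiE_iff extensional_def)
      then have "\<bar>g (c(m := x))\<bar> \<le> 5 * (R m)^2" by (rule bound)
      also have "\<dots> < (2 * R m + 1)^3"
      proof -
        have "(2 * R m + 1)^3 = 5 * (R m)^2 + (8 * (R m)^3 + 7 * (R m)^2 + 6 * R m + 1)"
          by (simp add: power2_eq_square power3_eq_cube algebra_simps)
        moreover have "8 * (R m)^3 + 7 * (R m)^2 + 6 * R m + 1 > 0" using Rm M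
          by (intro add_nonneg_pos add_nonneg_nonneg) auto
        ultimately show ?thesis by linarith
      qed
      finally show "\<bar>g (c(m := x))\<bar> < (2 * R m + 1)^3" .
    qed
  qed (use Rm M I(4) in auto)
  also have "\<dots> = (\<Sum>c\<in>int_box I R. weight0 M (c j)) + vol I R * (6 / real M)"
    using card_int_box[OF I(1), of R] R by (simp add: sum.distrib order_trans[of 0 "int M"])
  also have "(\<Sum>c\<in>int_box I R. weight0 M (c j)) \<le> vol I R * (2 / real M)"
    by (rule sum_weight0_coordinate[OF I(1,3)]) (use M R in auto)
  finally show ?thesis by (simp add: algebra_simps)
qed

text \<open>Divisibility by 0 means being 0, so the value \<open>q = 0\<close> lets one argument
  serve for congruences modulo odd primes and for exact zeros.\<close>

lemma prime_like_mult:
  fixes q :: int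
  assumes "q = 0 \<or> prime q \<and> q > 2"
  shows "q dvd a * b \<longleftrightarrow> q dvd a \<or> q dvd b" "\<not> q dvd 4"
proof -
  show "q dvd a * b \<longleftrightarrow> q dvd a \<or> q dvd b" using assms by (auto simp: prime_dvd_mult_iff)
  have "\<not> q dvd 2" using assms by (auto dest: zdvd_imp_le)
  moreover have "(4::int) = 2 * 2" by simp
  ultimately show "\<not> q dvd 4" using assms by (metis prime_dvd_mult_iff dvd_0_left_iff zero_neq_numeral)
qed

lemma int_box_abs: "c \<in> int_box I R \<Longrightarrow> i \<in> I \<Longrightarrow> \<bar>c i\<bar> \<le> R i"
  by (auto simp: int_box_def abs_le_iff dest!: PiE_mem)

lemma abs_mult_le_square: "\<bar>a\<bar> \<le> r \<Longrightarrow> \<bar>b\<bar> \<le> r \<Longrightarrow> \<bar>a * b\<bar> \<le> r^2" for a b r :: int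
  unfolding abs_mult power2_eq_square by (intro mult_mono) auto

text \<open>A minor is linear in each entry, with its partner in the same product as coefficient up
  to sign. Which entry has the longest side depends on \<open>R\<close>; the symmetries of the minor
  reduce the four cases to one.\<close>

lemma thin_minor:
  assumes I: "finite I" "{i, j, k, l} \<subseteq> I" "distinct [i, j, k, l]"
  shows "thin I (\<lambda>c. c i * c j - c k * c l)"
  unfolding thin_def
proof (intro allI impI)
  fix M :: nat and R :: "nat \<Rightarrow> int" assume M: "M \<ge> 2" and R: "\<forall>i\<in>I. R i \<ge> int M"
  have main: "(\<Sum>c\<in>int_box I R. capped_weight M (c i * c j - c k * c l)) \<le> vol I R * (8 / real M)"
    if "{i, j, k, l} \<subseteq> I" "distinct [i, j, k, l]" "R j \<le> R i" "R k \<le> R i" "R l \<le> R i" for i j k l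
  proof (rule sum_capped_weight_le[where m = i and j = j])
    fix c assume c: "c \<in> int_box I R"
    have "\<bar>c x\<bar> \<le> R i" if "x \<in> {i, j, k, l}" for x
      using int_box_abs[OF c, of x] that \<open>{i, j, k, l} \<subseteq> I\<close> \<open>R j \<le> R i\<close> \<open>R k \<le> R i\<close> \<open>R l \<le> R i\<close> by auto
    then have "\<bar>c i * c j\<bar> \<le> (R i)^2" "\<bar>c k * c l\<bar> \<le> (R i)^2" by (intro abs_mult_le_square; simp)+
    then show "\<bar>c i * c j - c k * c l\<bar> \<le> 5 * (R i)^2" by linarith
  next
    fix c :: sextuple and q x y z
    assume q: "q = 0 \<or> prime q \<and> q > 2" "\<not> q dvd c j"
      and d: "q dvd (c(i := x)) i * (c(i := x)) j - (c(i := x)) k * (c(i := x)) l"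
        "q dvd (c(i := y)) i * (c(i := y)) j - (c(i := y)) k * (c(i := y)) l"
    have "q dvd (x * c j - c k * c l) - (y * c j - c k * c l)"
      using dvd_diff[OF d] that(2) by simp
    then have "q dvd (x - y) * c j" by (simp add: algebra_simps)
    then show "q dvd x - y \<or> q dvd x - z \<or> q dvd y - z"
      using prime_like_mult(1)[OF q(1)] q(2) by blast
  qed (use I(1) M R that in auto)
  have neg: "capped_weight M (- g) = capped_weight M g" for g
    by (simp add: capped_weight_def weight0_def prime_weight_def)
  have sw1: "c i * c j - c k * c l = c j * c i - c k * c l" for c :: sextuple by simp
  have sw2: "c i * c j - c k * c l = - (c k * c l - c i * c j)" for c :: sextuple by simp
  have sw3: "c i * c j - c k * c l = - (c l * c k - c i * c j)" for c :: sextuple by simp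
  consider "R j \<le> R i" "R k \<le> R i" "R l \<le> R i" | "R i \<le> R j" "R k \<le> R j" "R l \<le> R j"
    | "R i \<le> R k" "R j \<le> R k" "R l \<le> R k" | "R i \<le> R l" "R j \<le> R l" "R k \<le> R l"
    by (meson linorder_le_cases order_trans)
  then show "(\<Sum>c\<in>int_box I R. capped_weight M (c i * c j - c k * c l)) \<le> vol I R * (8 / real M)"
  proof cases
    case 1
    then show ?thesis using main[of i j k l] I by auto
  next
    case 2
    then show ?thesis unfolding sw1 using main[of j i k l] I by auto
  next
    case 3
    then show ?thesis unfolding sw2 neg using main[of k l i j] I by auto
  next
    case 4
    then show ?thesis unfolding sw3 neg using main[of l k i j] I by auto
  qed
qed

text \<open>Along \<open>d\<close> or \<open>f\<close> the discriminant is linear; along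
  \<open>e\<close> it is a square up to a constant, and among three numbers with equal squares
  modulo \<open>q\<close> two are congruent.\<close>

lemma thin_discriminant:
  assumes I: "finite I" "{d, e, f} \<subseteq> I" "distinct [d, e, f]"
  shows "thin I (\<lambda>c. (c e)^2 - 4 * c d * c f)"
  unfolding thin_def
proof (intro allI impI)
  fix M :: nat and R :: "nat \<Rightarrow> int" assume M: "M \<ge> 2" and R: "\<forall>i\<in>I. R i \<ge> int M"
  have bound: "\<bar>(c e)^2 - 4 * c d * c f\<bar> \<le> 5 * r^2"
    if "c \<in> int_box I R" "R d \<le> r" "R e \<le> r" "R f \<le> r" "{d, e, f} \<subseteq> I" for c r d e f
  proof -
    have "\<bar>c x\<bar> \<le> r" if "x \<in> {d, e, f}" for x
      using int_box_abs[OF \<open>c \<in> int_box I R\<close>, of x] that \<open>{d, e, f} \<subseteq> I\<close> \<open>R d \<le> r\<close> \<open>R e \<le> r\<close> \<open>R f \<le> r\<close> by auto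
    then have "\<bar>c e * c e\<bar> \<le> r^2" "\<bar>c d * c f\<bar> \<le> r^2" by (intro abs_mult_le_square; simp)+
    then show ?thesis unfolding power2_eq_square[of "c e"] mult.assoc by linarith
  qed
  have main: "(\<Sum>c\<in>int_box I R. capped_weight M ((c e)^2 - 4 * c d * c f)) \<le> vol I R * (8 / real M)"
    if "{d, e, f} \<subseteq> I" "distinct [d, e, f]" "R e \<le> R d" "R f \<le> R d" for d f
  proof (rule sum_capped_weight_le[where m = d and j = f])
    fix c assume c: "c \<in> int_box I R"
    show "\<bar>(c e)^2 - 4 * c d * c f\<bar> \<le> 5 * (R d)^2" by (rule bound[OF c]) (use that in auto)
  next
    fix c :: sextuple and q x y z
    assume q: "q = 0 \<or> prime q \<and> q > 2" "\<not> q dvd c f"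
      and dv: "q dvd ((c(d := x)) e)^2 - 4 * (c(d := x)) d * (c(d := x)) f"
        "q dvd ((c(d := y)) e)^2 - 4 * (c(d := y)) d * (c(d := y)) f"
    have "q dvd ((c e)^2 - 4 * y * c f) - ((c e)^2 - 4 * x * c f)"
      using dvd_diff[OF dv(2,1)] that(2) by simp
    then have "q dvd 4 * ((x - y) * c f)" by (simp add: algebra_simps)
    then have "q dvd 4 \<or> q dvd x - y \<or> q dvd c f" by (simp only: prime_like_mult(1)[OF q(1)])
    then show "q dvd x - y \<or> q dvd x - z \<or> q dvd y - z"
      using prime_like_mult(2)[OF q(1)] q(2) by blast
  qed (use I(1) M R that in auto)
  consider "R e \<le> R d" "R f \<le> R d" | "R e \<le> R f" "R d \<le> R f" | "R d \<le> R e" "R f \<le> R e"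
    by (meson linorder_le_cases order_trans)
  then show "(\<Sum>c\<in>int_box I R. capped_weight M ((c e)^2 - 4 * c d * c f)) \<le> vol I R * (8 / real M)"
  proof cases
    case 1
    then show ?thesis using main[of d f] I by auto
  next
    case 2
    have sw: "(c e)^2 - 4 * c d * c f = (c e)^2 - 4 * c f * c d" for c :: sextuple by simp
    show ?thesis unfolding sw using main[of f d] I 2 by auto
  next
    case 3
    show ?thesis
    proof (rule sum_capped_weight_le[where m = e and j = d])
      fix c assume c: "c \<in> int_box I R"
      show "\<bar>(c e)^2 - 4 * c d * c f\<bar> \<le> 5 * (R e)^2" by (rule bound[OF c]) (use 3 I in auto)
    next
      fix c :: sextuple and q x y z
      assume q: "q = 0 \<or> prime q \<and> q > 2"
        and dv: "q dvd ((c(e := x)) e)^2 - 4 * (c(e := x)) d * (c(e := x)) f"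
          "q dvd ((c(e := y)) e)^2 - 4 * (c(e := y)) d * (c(e := y)) f"
          "q dvd ((c(e := z)) e)^2 - 4 * (c(e := z)) d * (c(e := z)) f"
      have 1: "q dvd (x - y) * (x + y)"
        using dvd_diff[OF dv(1,2)] I(3) by (simp add: algebra_simps power2_eq_square)
      have 2: "q dvd (x - z) * (x + z)"
        using dvd_diff[OF dv(1,3)] I(3) by (simp add: algebra_simps power2_eq_square)
      have "q dvd y - z" if "q dvd x + y" "q dvd x + z" using dvd_diff[OF that] by simp
      then show "q dvd x - y \<or> q dvd x - z \<or> q dvd y - z"
        using 1 2 prime_like_mult(1)[OF q] by blast
    qed (use I M R in auto)
  qed
qed

section \<open>The tail of the sieve\<close>

lemma prime_weight_disc_le:
  assumes "g1 * g2^2 \<noteq> 0"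
  shows "prime_weight M (g1 * g2^2) \<le> prime_weight M g1 + prime_weight M g2"
proof -
  have g: "g1 \<noteq> 0" "g2 \<noteq> 0" using assms by auto
  let ?S = "\<lambda>g. (large_primes M g)"
  have sub: "?S (g1 * g2^2) \<subseteq> ?S g1 \<union> ?S g2"
    by (auto simp: prime_dvd_mult_iff prime_dvd_power_iff)
  have fin: "finite (?S g1)" "finite (?S g2)" using g by (auto intro: finite_prime_divisors)
  have "prime_weight M (g1 * g2^2) \<le> (\<Sum>p\<in>?S g1 \<union> ?S g2. 1 / real p)"
    unfolding prime_weight_def by (rule sum_mono2) (use sub fin in auto)
  also have "\<dots> \<le> prime_weight M g1 + prime_weight M g2"
  proof -
    have "(\<Sum>p\<in>?S g1 \<inter> ?S g2. 1 / real p) \<ge> 0" by (intro sum_nonneg) simp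
    then show ?thesis unfolding prime_weight_def
      using sum_Un[OF fin, of "\<lambda>p. 1 / real p"] by linarith
  qed
  finally show ?thesis .
qed

text \<open>What the sieve needs in direction \<open>n\<close>. The assumption
  \<open>content\<close> says that a prime dividing all three coefficients already divides two of
  the other coordinates; this has frequency about \<open>1 / p^2\<close>, which is summable.\<close>

locale quadratic_fibration =
  fixes n :: nat and \<alpha> \<beta> \<gamma> g1 g2 :: "sextuple \<Rightarrow> int"
  assumes n: "n \<in> {1..6}"
    and Res_eq: "\<And>c x. Res (c(n := x)) = \<alpha> c * x^2 + \<beta> c * x + \<gamma> c"
    and disc: "\<And>c. (\<beta> c)^2 - 4 * \<alpha> c * \<gamma> c = g1 c * (g2 c)^2"
    and content: "\<And>c p. prime p \<Longrightarrow> int p dvd \<alpha> c \<Longrightarrow> int p dvd \<beta> c \<Longrightarrow> int p dvd \<gamma> c \<Longrightarrow>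
      \<exists>i\<in>{1..6} - {n}. \<exists>j\<in>{1..6} - {n}. i \<noteq> j \<and> int p dvd c i \<and> int p dvd c j"
    and thin: "thin ({1..6} - {n}) g1" "thin ({1..6} - {n}) g2"
begin

abbreviation "I \<equiv> {1..6} - {n}"
abbreviation "pairs \<equiv> {(i, j) \<in> I \<times> I. i \<noteq> j}"

definition bad_pair :: "nat \<Rightarrow> sextuple \<Rightarrow> nat \<Rightarrow> nat \<Rightarrow> bool" where
  "bad_pair M c i j \<longleftrightarrow> (\<exists>p. prime p \<and> M < p \<and> int p dvd c i \<and> int p dvd c j)"

text \<open>Up to \<open>3 / M\<close>, an upper bound for the proportion of bad points on the line.
  Each degeneracy, a zero of \<open>g1\<close> or \<open>g2\<close> or a bad pair, contributes
  1.\<close>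

definition line_weight :: "nat \<Rightarrow> sextuple \<Rightarrow> real" where
  "line_weight M c = capped_weight M (g1 c) + capped_weight M (g2 c) +
     (\<Sum>(i, j)\<in>pairs. of_bool (bad_pair M c i j))"

lemma sum_line_weight:
  assumes M: "M \<ge> 2" and R: "\<And>i. i \<in> I \<Longrightarrow> R i \<ge> int M"
  shows "(\<Sum>c\<in>int_box I R. line_weight M c) \<le> vol I R * (124 / real M)"
proof -
  have vol0: "vol I R \<ge> 0" unfolding vol_def
  proof (intro prod_nonneg ballI)
    fix i assume "i \<in> I"
    then have "R i \<ge> int M" by (rule R)
    then show "0 \<le> side (R i)" by simp
  qed
  have pair: "(\<Sum>c\<in>int_box I R. of_bool (bad_pair M c i j)) \<le> vol I R * (3 / real M)"
    if ij: "i \<in> I" "j \<in> I" "i \<noteq> j" for i j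
  proof -
    have "(\<Sum>c\<in>int_box I R. of_bool (bad_pair M c i j)) \<le> (\<Sum>c\<in>int_box I R. weight0 M (c i) + 1 / real M)"
    proof (rule sum_int_box_le)
      fix c
      show "(\<Sum>x\<in>{-R j..R j}. of_bool (bad_pair M (c(j := x)) i j)) \<le> side (R j) * (weight0 M (c i) + 1 / real M)"
        unfolding bad_pair_def using sum_common_prime_divisor[of M "R j" "c i"] ij M R[OF ij(2)] by simp
    qed (use ij M R[OF ij(2)] in auto)
    also have "\<dots> = (\<Sum>c\<in>int_box I R. weight0 M (c i)) + vol I R * (1 / real M)"
      using card_int_box[of I R] R by (simp add: sum.distrib order_trans[of 0 "int M"])
    also have "\<dots> \<le> vol I R * (2 / real M) + vol I R * (1 / real M)"
      by (intro add_right_mono sum_weight0_coordinate) (use ij M R in auto)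
    finally show ?thesis by (simp add: algebra_simps)
  qed
  have "(\<Sum>c\<in>int_box I R. \<Sum>(i, j)\<in>pairs. of_bool (bad_pair M c i j)) =
      (\<Sum>(i, j)\<in>pairs. \<Sum>c\<in>int_box I R. of_bool (bad_pair M c i j) :: real)"
    by (subst sum.swap) (simp add: case_prod_unfold)
  also have "\<dots> \<le> (\<Sum>(i, j)\<in>pairs. vol I R * (3 / real M))"
    using pair by (intro sum_mono) auto
  also have "\<dots> = real (card pairs) * (vol I R * (3 / real M))"
    by simp
  \<comment> \<open>A generous bound, as there are 20 ordered pairs; it leads to 124 = 8 + 8 + 36 *
    3.\<close>
  also have "\<dots> \<le> 36 * (vol I R * (3 / real M))"
  proof (rule mult_right_mono)
    have "card pairs \<le> card ({1..6::nat} \<times> {1..6::nat})"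
      by (rule card_mono) auto
    also have "\<dots> = 36" by simp
    finally show "real (card pairs) \<le> 36" by simp
  qed (use vol0 in simp)
  finally have pairs: "(\<Sum>c\<in>int_box I R. \<Sum>(i, j)\<in>pairs. of_bool (bad_pair M c i j)) \<le>
      36 * (vol I R * (3 / real M))" .
  have "(\<Sum>c\<in>int_box I R. capped_weight M (g1 c)) \<le> vol I R * (8 / real M)"
    "(\<Sum>c\<in>int_box I R. capped_weight M (g2 c)) \<le> vol I R * (8 / real M)"
    using thin M R unfolding thin_def by blast+
  with pairs have "(\<Sum>c\<in>int_box I R. line_weight M c) \<le> vol I R * (8 / real M) + vol I R * (8 / real M) + 36 * (vol I R * (3 / real M))"
    unfolding line_weight_def sum.distrib by linarith
  then show ?thesis by (simp add: algebra_simps)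
qed

text \<open>If the weight is at least 1, counting all points suffices. Otherwise there is no
  degeneracy and the caps are inactive, so the bound for quadratic polynomials applies with error
  \<open>1 / M\<close>.\<close>

lemma line_count_le:
  assumes M: "M \<ge> 2"
  shows "\<forall>\<^sub>F T in at_top. square_count M (\<lambda>x. Res (c(n := x))) T
    \<le> side T * (line_weight M c + 3 / real M)"
proof -
  have nonneg: "(\<Sum>(i, j)\<in>pairs. of_bool (bad_pair M c i j)) \<ge> (0::real)"
    by (intro sum_nonneg) auto
  have cw: "capped_weight M g \<ge> 0" for g using weight0_nonneg[of M g] by (simp add: capped_weight_def)
  show ?thesis
  proof (cases "line_weight M c \<ge> 1")
    case True
    show ?thesis using eventually_ge_at_top[of 0]
    proof eventually_elim
      case (elim T)
      have "card {x \<in> {-T..T}. large_square M (Res (c(n := x)))} \<le> card {-T..T}"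
        by (rule card_mono) auto
      then have "square_count M (\<lambda>x. Res (c(n := x))) T \<le> real (card {-T..T})"
        by (simp only: of_nat_le_iff)
      also have "\<dots> = side T * 1" using elim by simp
      also have "\<dots> \<le> side T * (line_weight M c + 3 / real M)"
      proof (rule mult_left_mono)
        have "3 / real M \<ge> 0" by simp
        then show "1 \<le> line_weight M c + 3 / real M" using True by linarith
      qed (use elim in simp)
      finally show ?case .
    qed
  next
    case False
    have nb: "\<not> bad_pair M c i j" if ij: "i \<in> I" "j \<in> I" "i \<noteq> j" for i j
    proof
      assume b: "bad_pair M c i j"
      have fin: "finite pairs" by (rule finite_subset[of _ "I \<times> I"]) auto
      have "(case (i, j) of (i, j) \<Rightarrow> of_bool (bad_pair M c i j)) \<le> (\<Sum>(i, j)\<in>pairs. of_bool (bad_pair M c i j) :: real)"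
        by (rule member_le_sum[OF _ _ fin]) (use ij in auto)
      then show False using b False cw[of "g1 c"] cw[of "g2 c"] unfolding line_weight_def by simp
    qed
    have lt: "capped_weight M (g1 c) < 1" "capped_weight M (g2 c) < 1"
      using False nonneg cw[of "g1 c"] cw[of "g2 c"] unfolding line_weight_def by linarith+
    then have g0: "g1 c \<noteq> 0" "g2 c \<noteq> 0" by (auto simp: capped_weight_def)
    have pw: "capped_weight M (g1 c) = prime_weight M (g1 c)" "capped_weight M (g2 c) = prime_weight M (g2 c)"
      using lt g0 by (auto simp: capped_weight_def weight0_def min_def split: if_splits)
    interpret q: int_quadratic "\<alpha> c" "\<beta> c" "\<gamma> c" .
    have D: "q.D = g1 c * (g2 c)^2" unfolding q.D_def by (rule disc)
    have f: "q.f x = Res (c(n := x))" for x unfolding q.f_def by (rule Res_eq[symmetric])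
    have "\<forall>\<^sub>F T in at_top. square_count M q.f T
      \<le> side T * (2 / real M + prime_weight M q.D + 1 / real M)"
    proof (rule q.large_square_divisors[OF M])
      show "q.D \<noteq> 0" using g0 D by simp
      show "0 < 1 / real M" using M by simp
      fix p assume p: "prime p" "M < p"
      show "\<not> (int p dvd \<alpha> c \<and> int p dvd \<beta> c \<and> int p dvd \<gamma> c)"
        using content[OF p(1), of c] nb p unfolding bad_pair_def by blast
    qed
    with eventually_ge_at_top[of 0] show ?thesis
    proof eventually_elim
      case (elim T)
      have "2 / real M + prime_weight M q.D + 1 / real M \<le> line_weight M c + 3 / real M"
        using prime_weight_disc_le[of "g1 c" "g2 c" M] g0 nonneg pw unfolding D line_weight_def by simp
      then have "side T * (2 / real M + prime_weight M q.D + 1 / real M) \<le> side T * (line_weight M c + 3 / real M)"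
        by (rule mult_left_mono) (use elim in simp)
      with elim show ?case unfolding f by linarith
    qed
  qed
qed

text \<open>With the outer sides fixed there are finitely many lines, so all their eventual bounds
  hold together for large \<open>t\<close>; this is where the order of the limits enters. The
  constant is 127 = 124 + 3.\<close>

lemma large_square_divisors_box:
  assumes M: "M \<ge> 2"
  shows "\<forall>\<^sub>F r in iterated_at_top n.
    real (card {C \<in> floor_box r. large_square M (Res C)})
      \<le> floor_vol r * (127 / real M)"
  unfolding eventually_iterated_at_top
  using eventually_others_ge[of n "real M"]
proof eventually_elim
  case (elim r)
  define R where "R i = \<lfloor>r i\<rfloor>" for i
  have R: "R i \<ge> int M" if "i \<in> I" for i
    using elim that by (simp add: R_def le_floor_iff)
  have "\<forall>\<^sub>F T in at_top. \<forall>c\<in>int_box I R. square_count M (\<lambda>x. Res (c(n := x))) T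
      \<le> side T * (line_weight M c + 3 / real M)"
    by (intro eventually_ball_finite ballI line_count_le M) simp
  then have "\<forall>\<^sub>F t in at_top. \<forall>c\<in>int_box I R. real (card {x \<in> {-\<lfloor>t::real\<rfloor>..\<lfloor>t\<rfloor>}. large_square M (Res (c(n := x)))})
      \<le> side \<lfloor>t\<rfloor> * (line_weight M c + 3 / real M)"
    by (rule eventually_compose_filterlim) (rule filterlim_floor_sequentially)
  with eventually_ge_at_top[of 0] show ?case
  proof eventually_elim
    case (elim t)
    let ?R = "\<lambda>i. \<lfloor>(r(n := t)) i\<rfloor>" and ?B = "\<lambda>C. large_square M (Res C)"
    have ins: "{1..6} = insert n I" using n by auto
    have boxI: "int_box I ?R = int_box I R"
      unfolding int_box_def by (rule PiE_cong) (auto simp: R_def)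
    have vol: "vol {1..6} ?R = side \<lfloor>t\<rfloor> * vol I R"
    proof -
      have "vol {1..6} ?R = vol (insert n I) ?R" by (rule arg_cong2[OF ins refl])
      also have "\<dots> = side \<lfloor>t\<rfloor> * vol I ?R"
        unfolding vol_def by (subst prod.insert) auto
      also have "vol I ?R = vol I R" unfolding vol_def by (rule prod.cong) (auto simp: R_def)
      finally show ?thesis .
    qed
    have T0: "side \<lfloor>t\<rfloor> \<ge> 0"
    proof -
      have "\<lfloor>t\<rfloor> \<ge> 0" using elim by simp
      then show ?thesis by (simp only: of_int_0_le_iff)
    qed
    have "real (card {C \<in> int_box {1..6} ?R. ?B C}) = (\<Sum>C\<in>int_box {1..6} ?R. of_bool (?B C))"
      by (simp add: Int_def)
    also have "\<dots> = (\<Sum>c\<in>int_box I ?R. \<Sum>x\<in>{-?R n..?R n}. of_bool (?B (c(n := x))))"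
      by (rule sum_int_box_split) (use n in auto)
    also have "\<dots> = (\<Sum>c\<in>int_box I R. real (card {x \<in> {-\<lfloor>t\<rfloor>..\<lfloor>t\<rfloor>}. ?B (c(n := x))}))"
      unfolding boxI by (simp add: Int_def)
    also have "\<dots> \<le> (\<Sum>c\<in>int_box I R. side \<lfloor>t\<rfloor> * (line_weight M c + 3 / real M))"
      by (rule sum_mono) (use elim in blast)
    also have "\<dots> = side \<lfloor>t\<rfloor> * ((\<Sum>c\<in>int_box I R. line_weight M c) + vol I R * (3 / real M))"
    proof -
      have "R i \<ge> 0" if "i \<in> I" for i using R[OF that] by linarith
      then have "real (card (int_box I R)) = vol I R" by (intro card_int_box) auto
      then have "(\<Sum>c\<in>int_box I R. 3 / real M) = vol I R * (3 / real M)" by simp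
      then show ?thesis unfolding sum_distrib_left[symmetric] sum.distrib by (simp only:)
    qed
    also have "\<dots> \<le> side \<lfloor>t\<rfloor> * (vol I R * (124 / real M) + vol I R * (3 / real M))"
      by (intro mult_left_mono add_right_mono sum_line_weight M R T0)
    also have "\<dots> = vol {1..6} ?R * (127 / real M)"
      unfolding vol by (simp add: algebra_simps add_divide_distrib)
    finally show ?case .
  qed
qed

end

text \<open>
  The resultant is invariant under exchanging numerator and denominator and under exchanging
  the variables, so each of the six coordinates can be moved to the first or the second place.
\<close>

locale coordinate_system =
  fixes k1 k2 k3 k4 k5 k6 :: nat
  assumes distinct: "distinct [k1, k2, k3, k4, k5, k6]" and set: "{1..6} = {k1, k2, k3, k4, k5, k6}"
    and Res_k: "\<And>C. Res C = res6 (C k1) (C k2) (C k3) (C k4) (C k5) (C k6)"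
begin

text \<open>For the content, a prime dividing the leading coefficient divides \<open>c k6\<close>;
  modulo it the linear coefficient is \<open>c k3 * (c k5)^2\<close>, which supplies the second
  coordinate.\<close>

lemma fibration_first:
  "quadratic_fibration k1 (\<lambda>c. (c k6)^2)
     (\<lambda>c. c k3 * (c k5)^2 - c k2 * c k5 * c k6 - 2 * c k3 * c k4 * c k6)
     (\<lambda>c. (c k3)^2 * (c k4)^2 + c k2 * c k4 * (c k2 * c k6 - c k3 * c k5))
     (\<lambda>c. (c k5)^2 - 4 * c k4 * c k6) (\<lambda>c. c k2 * c k6 - c k3 * c k5)"
proof
  show "k1 \<in> {1..6}" unfolding set by simp
  have I: "{1..6} - {k1} = {k2, k3, k4, k5, k6}" unfolding set using distinct by auto
  show "thin ({1..6} - {k1}) (\<lambda>c. (c k5)^2 - 4 * c k4 * c k6)"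
    by (rule thin_discriminant) (use distinct in \<open>auto simp: I simp del: One_nat_def\<close>)
  show "thin ({1..6} - {k1}) (\<lambda>c. c k2 * c k6 - c k3 * c k5)"
    by (rule thin_minor) (use distinct in \<open>auto simp: I simp del: One_nat_def\<close>)
  show "Res (c(k1 := x)) = (c k6)^2 * x^2 +
      (c k3 * (c k5)^2 - c k2 * c k5 * c k6 - 2 * c k3 * c k4 * c k6) * x +
      ((c k3)^2 * (c k4)^2 + c k2 * c k4 * (c k2 * c k6 - c k3 * c k5))" for c x
  proof -
    have "(c(k1 := x)) k1 = x" "(c(k1 := x)) k2 = c k2" "(c(k1 := x)) k3 = c k3" "(c(k1 := x)) k4 = c k4"
      "(c(k1 := x)) k5 = c k5" "(c(k1 := x)) k6 = c k6" using distinct by auto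
    then show ?thesis
      unfolding Res_k res6_def by (simp only:) (simp add: algebra_simps power2_eq_square)
  qed
  show "(c k3 * (c k5)^2 - c k2 * c k5 * c k6 - 2 * c k3 * c k4 * c k6)^2 -
      4 * (c k6)^2 * ((c k3)^2 * (c k4)^2 + c k2 * c k4 * (c k2 * c k6 - c k3 * c k5)) =
      ((c k5)^2 - 4 * c k4 * c k6) * (c k2 * c k6 - c k3 * c k5)^2" for c :: sextuple
    by (simp add: algebra_simps power2_eq_square)
  fix c :: sextuple and p assume p: "prime p"
    and \<alpha>: "int p dvd (c k6)^2"
    and \<beta>: "int p dvd c k3 * (c k5)^2 - c k2 * c k5 * c k6 - 2 * c k3 * c k4 * c k6"
    and \<gamma>: "int p dvd (c k3)^2 * (c k4)^2 + c k2 * c k4 * (c k2 * c k6 - c k3 * c k5)"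
  have P: "prime (int p)" using p by simp
  have 6: "int p dvd c k6" using \<alpha> P prime_dvd_power by blast
  have "int p dvd (c k3 * (c k5)^2 - c k2 * c k5 * c k6 - 2 * c k3 * c k4 * c k6) +
      (c k2 * c k5 + 2 * c k3 * c k4) * c k6"
    using \<beta> 6 by (intro dvd_add dvd_mult) auto
  then have "int p dvd c k3 * (c k5)^2" by (simp add: algebra_simps)
  then have 35: "int p dvd c k3 \<or> int p dvd c k5"
    using P by (auto simp: prime_dvd_mult_iff prime_dvd_power_iff)
  have two: "\<exists>i\<in>{1..6} - {k1}. \<exists>j\<in>{1..6} - {k1}. i \<noteq> j \<and> int p dvd c i \<and> int p dvd c j"
    if "i \<noteq> j" "int p dvd c i" "int p dvd c j" "i \<in> {k2, k3, k4, k5, k6}" "j \<in> {k2, k3, k4, k5, k6}" for i j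
    unfolding I using that by blast
  from 35 6 show "\<exists>i\<in>{1..6} - {k1}. \<exists>j\<in>{1..6} - {k1}. i \<noteq> j \<and> int p dvd c i \<and> int p dvd c j"
    using two[of k3 k6] two[of k5 k6] distinct by auto
qed

text \<open>For the content, the leading coefficient gives \<open>c k4\<close> or
  \<open>c k6\<close>. The linear one gives either \<open>c k5\<close> or a congruence between
  \<open>c k1 * c k6\<close> and \<open>c k3 * c k4\<close> up to sign; one of these products then
  vanishes, and with it the other.\<close>

lemma fibration_second:
  "quadratic_fibration k2 (\<lambda>c. c k4 * c k6)
     (\<lambda>c. - c k5 * (c k1 * c k6 + c k3 * c k4))
     (\<lambda>c. (c k1 * c k6 - c k3 * c k4)^2 + c k1 * c k3 * (c k5)^2)
     (\<lambda>c. (c k5)^2 - 4 * c k4 * c k6) (\<lambda>c. c k1 * c k6 - c k3 * c k4)"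
proof
  show "k2 \<in> {1..6}" unfolding set by simp
  have I: "{1..6} - {k2} = {k1, k3, k4, k5, k6}" unfolding set using distinct by auto
  show "thin ({1..6} - {k2}) (\<lambda>c. (c k5)^2 - 4 * c k4 * c k6)"
    by (rule thin_discriminant) (use distinct in \<open>auto simp: I simp del: One_nat_def\<close>)
  show "thin ({1..6} - {k2}) (\<lambda>c. c k1 * c k6 - c k3 * c k4)"
    by (rule thin_minor) (use distinct in \<open>auto simp: I simp del: One_nat_def\<close>)
  show "Res (c(k2 := x)) = c k4 * c k6 * x^2 + (- c k5 * (c k1 * c k6 + c k3 * c k4)) * x +
      ((c k1 * c k6 - c k3 * c k4)^2 + c k1 * c k3 * (c k5)^2)" for c x
  proof -
    have "(c(k2 := x)) k1 = c k1" "(c(k2 := x)) k2 = x" "(c(k2 := x)) k3 = c k3" "(c(k2 := x)) k4 = c k4"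
      "(c(k2 := x)) k5 = c k5" "(c(k2 := x)) k6 = c k6" using distinct by auto
    then show ?thesis
      unfolding Res_k res6_def by (simp only:) (simp add: algebra_simps power2_eq_square)
  qed
  show "(- c k5 * (c k1 * c k6 + c k3 * c k4))^2 -
      4 * (c k4 * c k6) * ((c k1 * c k6 - c k3 * c k4)^2 + c k1 * c k3 * (c k5)^2) =
      ((c k5)^2 - 4 * c k4 * c k6) * (c k1 * c k6 - c k3 * c k4)^2" for c :: sextuple
    by (simp add: algebra_simps power2_eq_square)
  fix c :: sextuple and p assume p: "prime p"
    and \<alpha>: "int p dvd c k4 * c k6"
    and \<beta>: "int p dvd - c k5 * (c k1 * c k6 + c k3 * c k4)"
    and \<gamma>: "int p dvd (c k1 * c k6 - c k3 * c k4)^2 + c k1 * c k3 * (c k5)^2"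
  have P: "prime (int p)" using p by simp
  have two: "\<exists>i\<in>{1..6} - {k2}. \<exists>j\<in>{1..6} - {k2}. i \<noteq> j \<and> int p dvd c i \<and> int p dvd c j"
    if "i \<noteq> j" "int p dvd c i" "int p dvd c j" "i \<in> {k1, k3, k4, k5, k6}" "j \<in> {k1, k3, k4, k5, k6}" for i j
    unfolding I using that by blast
  have sum: "int p dvd a \<longleftrightarrow> int p dvd b" if "int p dvd a + b" for a b
    using that dvd_add_right_iff dvd_add_left_iff by blast
  have 46: "int p dvd c k4 \<or> int p dvd c k6" using \<alpha> P by (simp add: prime_dvd_mult_iff)
  have 5: "int p dvd c k5 \<or> int p dvd c k1 * c k6 + c k3 * c k4"
    using \<beta> P by (simp add: prime_dvd_mult_iff)
  have "\<exists>i j. i \<noteq> j \<and> int p dvd c i \<and> int p dvd c j \<and> i \<in> {k1, k3, k4, k5, k6} \<and> j \<in> {k1, k3, k4, k5, k6}"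
  proof (cases "int p dvd c k5")
    case True
    then show ?thesis using 46 distinct by auto
  next
    case False
    then have s: "int p dvd c k1 * c k6 \<longleftrightarrow> int p dvd c k3 * c k4" using 5 sum by blast
    from 46 show ?thesis
    proof
      assume 4: "int p dvd c k4"
      then have "int p dvd c k1 * c k6" using s by simp
      then have "int p dvd c k1 \<or> int p dvd c k6" using P by (simp add: prime_dvd_mult_iff)
      then show ?thesis using 4 distinct by auto
    next
      assume 6: "int p dvd c k6"
      then have "int p dvd c k3 * c k4" using s by simp
      then have "int p dvd c k3 \<or> int p dvd c k4" using P by (simp add: prime_dvd_mult_iff)
      then show ?thesis using 6 distinct by auto
    qed
  qed
  then show "\<exists>i\<in>{1..6} - {k2}. \<exists>j\<in>{1..6} - {k2}. i \<noteq> j \<and> int p dvd c i \<and> int p dvd c j"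
    using two by blast
qed

end

text \<open>The first entries are 1, 3, 4, 6 and the second entries include 2 and 5, so every
  coordinate is reached.\<close>

lemma coordinate_systems:
  "coordinate_system 1 2 3 4 5 6" "coordinate_system 3 2 1 6 5 4"
  "coordinate_system 4 5 6 1 2 3" "coordinate_system 6 5 4 3 2 1"
  by standard (auto simp: Res_res6 res6_def algebra_simps power2_eq_square)

lemma eventually_large_square_divisors:
  assumes n: "n \<in> {1..6}" and M: "M \<ge> 2"
  shows "\<forall>\<^sub>F r in iterated_at_top n.
    real (card {C \<in> floor_box r. large_square M (Res C)})
      \<le> floor_vol r * (127 / real M)"
proof -
  note fib1 = coordinate_systems[THEN coordinate_system.fibration_first]
  note fib2 = coordinate_systems(1,3)[THEN coordinate_system.fibration_second]
  have "n = 1 \<or> n = 2 \<or> n = 3 \<or> n = 4 \<or> n = 5 \<or> n = 6" using n by auto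
  then show ?thesis
    using fib1[THEN quadratic_fibration.large_square_divisors_box[OF _ M]]
      fib2[THEN quadratic_fibration.large_square_divisors_box[OF _ M]] by blast
qed

section \<open>The density\<close>

lemma squarefree_int_iff: "squarefree (m::int) \<longleftrightarrow> (\<forall>p::nat. prime p \<longrightarrow> \<not> int p ^ 2 dvd m)"
proof (cases "m = 0")
  case True
  then show ?thesis using two_is_prime_nat by auto
next
  case False
  have "squarefree m \<longleftrightarrow> (\<forall>p. prime p \<longrightarrow> \<not> p ^ 2 dvd m)"
    using squarefree_factorial_semiring[OF False] by blast
  also have "\<dots> \<longleftrightarrow> (\<forall>p::nat. prime p \<longrightarrow> \<not> int p ^ 2 dvd m)"
  proof (intro iffI allI impI)
    fix p :: int assume *: "\<forall>p::nat. prime p \<longrightarrow> \<not> int p ^ 2 dvd m" and p: "prime p"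
    have i: "int (nat p) = p" using prime_ge_0_int[OF p] by simp
    have "prime (nat p)" using p unfolding prime_int_nat_transfer by blast
    with * have "\<not> int (nat p) ^ 2 dvd m" by blast
    then show "\<not> p ^ 2 dvd m" unfolding i .
  qed auto
  finally show ?thesis .
qed

lemma Gcd_eq_1_iff:
  fixes C :: sextuple
  shows "Gcd (C ` {1..6}) = 1 \<longleftrightarrow> (\<forall>p::nat. prime p \<longrightarrow> (\<exists>i\<in>{1..6}. \<not> int p dvd C i))"
proof -
  have dvd: "int p dvd Gcd (C ` {1..6}) \<longleftrightarrow> (\<forall>i\<in>{1..6}. int p dvd C i)" for p :: nat
    by (auto simp: dvd_Gcd_iff)
  have G: "int (nat (Gcd (C ` {1..6}))) = Gcd (C ` {1..6})" by (simp add: Gcd_int_greater_eq_0)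
  show ?thesis
  proof
    assume "Gcd (C ` {1..6}) = 1"
    then show "\<forall>p::nat. prime p \<longrightarrow> (\<exists>i\<in>{1..6}. \<not> int p dvd C i)"
      using dvd by (metis not_prime_unit prime_nat_int_transfer)
  next
    assume *: "\<forall>p::nat. prime p \<longrightarrow> (\<exists>i\<in>{1..6}. \<not> int p dvd C i)"
    have "nat (Gcd (C ` {1..6})) = 1"
    proof (rule ccontr)
      assume "nat (Gcd (C ` {1..6})) \<noteq> 1"
      then obtain p where p: "prime p" "p dvd nat (Gcd (C ` {1..6}))" using prime_factor_nat by blast
      then have "int p dvd int (nat (Gcd (C ` {1..6})))" by (simp only: int_dvd_int_iff)
      then have "\<forall>i\<in>{1..6}. int p dvd C i" unfolding G dvd .
      then show False using * p(1) by blast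
    qed
    then show "Gcd (C ` {1..6}) = 1" using G by (simp only: of_nat_1)
  qed
qed

section \<open>From normalised points to vectors\<close>

definition leading :: "sextuple \<Rightarrow> int" where
  "leading C = C (LEAST i. i \<in> {1..6} \<and> C i \<noteq> 0)"

definition neg6 :: "sextuple \<Rightarrow> sextuple" where
  "neg6 C = (\<lambda>i\<in>{1..6}. - C i)"

lemma leading_neg6:
  assumes "\<exists>i\<in>{1..6}. C i \<noteq> 0"
  shows "leading (neg6 C) = - leading C"
proof -
  have eq: "(\<lambda>i. i \<in> {1..6} \<and> neg6 C i \<noteq> 0) = (\<lambda>i. i \<in> {1..6} \<and> C i \<noteq> 0)"
    by (auto simp: neg6_def)
  obtain i where "i \<in> {1..6} \<and> C i \<noteq> 0" using assms by blast
  then have "(LEAST i. i \<in> {1..6} \<and> C i \<noteq> 0) \<in> {1..6}" by (rule LeastI2) simp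
  then show ?thesis unfolding leading_def eq by (simp add: neg6_def)
qed

lemma leading_nonzero:
  assumes "\<exists>i\<in>{1..6}. C i \<noteq> 0"
  shows "leading C \<noteq> 0"
proof -
  obtain i where "i \<in> {1..6} \<and> C i \<noteq> 0" using assms by blast
  then show ?thesis unfolding leading_def by (rule LeastI2) simp
qed

text \<open>Negation is an involution exchanging positive and negative leading coordinate, so
  exactly half of the vectors are normalised.\<close>

lemma card_sign_normalized:
  assumes Q: "\<And>C. Q (neg6 C) = Q C" and nz: "\<And>C. Q C \<Longrightarrow> \<exists>i\<in>{1..6}. C i \<noteq> 0"
  shows "card {C \<in> int_box {1..6} R. Q C} = 2 * card {C \<in> int_box {1..6} R. Q C \<and> leading C > 0}"
proof -
  let ?B = "int_box {1..6} R"
  let ?P = "{C \<in> ?B. Q C \<and> leading C > 0}" and ?N = "{C \<in> ?B. Q C \<and> leading C < 0}"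
  have box: "neg6 C \<in> ?B" if "C \<in> ?B" for C
    using that by (auto simp: neg6_def int_box_def PiE_iff)
  have neg: "neg6 (neg6 C) = C" if "C \<in> ?B" for C
    using that by (intro ext) (auto simp: neg6_def int_box_def PiE_iff extensional_def)
  have "leading C < 0 \<or> leading C > 0" if "Q C" for C
    using leading_nonzero[OF nz[OF that]] by linarith
  then have "{C \<in> ?B. Q C} = ?P \<union> ?N" by blast
  moreover have "card (?P \<union> ?N) = card ?P + card ?N" by (rule card_Un_disjoint) auto
  moreover have "card ?N = card ?P"
  proof (rule bij_betw_same_card, rule bij_betw_byWitness[of _ neg6 neg6])
    show "\<forall>C\<in>?N. neg6 (neg6 C) = C" "\<forall>C\<in>?P. neg6 (neg6 C) = C" using neg by auto
    show "neg6 ` ?N \<subseteq> ?P" "neg6 ` ?P \<subseteq> ?N" using box Q leading_neg6 nz by auto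
  qed
  ultimately show ?thesis by simp
qed

text \<open>The factor 2 from the signs cancels, and a squarefree resultant already implies that the
  vector is primitive and the resultant nonzero.\<close>

lemma box_ratio_eq:
  "box_ratio squarefree_res_maps r =
     real (card {C \<in> floor_box r. squarefree (Res C)}) /
     real (card {C \<in> floor_box r. Gcd (C ` {1..6}) = 1})"
proof -
  let ?B = "floor_box r"
  have mem: "C \<in> ?B \<longleftrightarrow> C \<in> {1..6} \<rightarrow>\<^sub>E UNIV \<and> (\<forall>i\<in>{1..6}. real_of_int \<bar>C i\<bar> \<le> r i)" for C
  proof -
    have "real_of_int \<bar>x\<bar> \<le> s \<longleftrightarrow> - \<lfloor>s\<rfloor> \<le> x \<and> x \<le> \<lfloor>s\<rfloor>" for x s
      unfolding le_floor_iff[symmetric] by linarith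
    then show ?thesis unfolding int_box_def PiE_iff by auto
  qed
  have sf: "Gcd (C ` {1..6}) = 1 \<and> Res C \<noteq> 0" if "squarefree (Res C)" for C
    using that square_dvd_Res unfolding Gcd_eq_1_iff squarefree_int_iff
    by (auto simp: squarefree_int_iff) (use two_is_prime_nat in blast)
  have Resneg: "Res (neg6 C) = Res C" for C
    by (simp add: Res_res6 res6_def neg6_def)
  have nz: "\<exists>i\<in>{1..6}. C i \<noteq> 0" if "Gcd (C ` {1..6}) = 1" for C :: sextuple
    using that two_is_prime_nat unfolding Gcd_eq_1_iff by (metis dvd_0_right)
  have "box_points squarefree_res_maps r = {C \<in> ?B. squarefree (Res C) \<and> leading C > 0}"
    using mem sf unfolding box_points_def squarefree_res_maps_def rational_maps2_def P5Q_def leading_def by auto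
  moreover have "box_points P5Q r = {C \<in> ?B. Gcd (C ` {1..6}) = 1 \<and> leading C > 0}"
    using mem unfolding box_points_def P5Q_def leading_def by auto
  moreover have "card {C \<in> ?B. squarefree (Res C)} = 2 * card {C \<in> ?B. squarefree (Res C) \<and> leading C > 0}"
    by (rule card_sign_normalized) (use sf nz Resneg in auto)
  moreover have "card {C \<in> ?B. Gcd (C ` {1..6}) = 1} = 2 * card {C \<in> ?B. Gcd (C ` {1..6}) = 1 \<and> leading C > 0}"
  proof (rule card_sign_normalized[OF _ nz])
    show "(Gcd (neg6 C ` {1..6}) = 1) = (Gcd (C ` {1..6}) = 1)" for C
      unfolding Gcd_eq_1_iff by (simp add: neg6_def)
  qed
  ultimately show ?thesis unfolding box_ratio_def by simp
qed

lemma periodic6_Res: "periodic6 (int p ^ 2) (\<lambda>C. \<not> int p ^ 2 dvd Res C)"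
  unfolding periodic6_def
proof (intro allI impI)
  fix C D :: sextuple assume "\<forall>i\<in>{1..6}. C i mod int p ^ 2 = D i mod int p ^ 2"
  then have c: "[C i = D i] (mod int p ^ 2)" if "i \<in> {1..6}" for i using that by (simp add: cong_def)
  have "[Res C = Res D] (mod int p ^ 2)"
    unfolding Res_res6 res6_def by (intro cong_diff cong_mult cong_pow c) auto
  then show "(\<not> int p ^ 2 dvd Res C) = (\<not> int p ^ 2 dvd Res D)" by (simp add: cong_dvd_iff)
qed

lemma periodic6_primitive: "periodic6 (int p ^ 2) (\<lambda>C. \<exists>i\<in>{1..6}. \<not> int p dvd C i)"
  unfolding periodic6_def
proof (intro allI impI)
  fix C D :: sextuple assume *: "\<forall>i\<in>{1..6}. C i mod int p ^ 2 = D i mod int p ^ 2"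
  have "int p dvd C i \<longleftrightarrow> int p dvd D i" if "i \<in> {1..6}" for i
  proof -
    have "int p ^ 2 dvd C i - D i" using * that by (simp add: mod_eq_dvd_iff)
    then have "int p dvd C i - D i" by (rule dvd_trans[rotated]) (simp add: power2_eq_square)
    then have "int p dvd (C i - D i) + D i \<longleftrightarrow> int p dvd D i" by (rule dvd_add_right_iff)
    then show ?thesis by simp
  qed
  then show "(\<exists>i\<in>{1..6}. \<not> int p dvd C i) = (\<exists>i\<in>{1..6}. \<not> int p dvd D i)" by blast
qed

section \<open>Local densities and their products\<close>

definition res_density :: "nat \<Rightarrow> real" where
  "res_density p = residue_density (int p ^ 2) (\<lambda>C. \<not> int p ^ 2 dvd Res C)"

definition prim_density :: "nat \<Rightarrow> real" where
  "prim_density p = residue_density (int p ^ 2) (\<lambda>C. \<exists>i\<in>{1..6}. \<not> int p dvd C i)"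

lemma prim_density_eq: "prime p \<Longrightarrow> prim_density p = 1 - 1 / real p ^ 6"
proof -
  assume P: "prime p"
  then interpret prime_square "int p" by unfold_locales simp
  have "{C \<in> residues6 (int p ^ 2). \<exists>i\<in>{1..6}. \<not> int p dvd C i} = unimodular_sextuples (p^2)"
    unfolding unimodular_eq[OF P] residues6_def q_def by auto
  moreover have "real (card (unimodular_sextuples (p^2))) = real p ^ 12 - real p ^ 6"
    using arg_cong[OF card_unimodular[OF P], of real_of_int] by simp
  moreover have "real p > 0" using P prime_gt_0_nat by simp
  ultimately show ?thesis
    by (simp add: prim_density_def residue_density_def diff_divide_distrib flip: power_mult)
      (simp add: power_diff[symmetric] field_simps flip: power_add)
qed

text \<open>Vectors with resultant nonzero modulo \<open>p^2\<close> are primitive at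
  \<open>p\<close>, so \<open>local_proportion\<close> is the conditional density among the
  primitive ones.\<close>

lemma res_density_eq: "prime p \<Longrightarrow> res_density p = prim_density p * local_proportion p"
proof -
  assume P: "prime p"
  then interpret prime_square "int p" by unfold_locales simp
  have p1: "real p > 1" using P prime_gt_1_nat by simp
  have "{C \<in> residues6 (int p ^ 2). \<not> int p ^ 2 dvd Res C} = {C \<in> unimodular_sextuples (p^2). \<not> q dvd Res C}"
    unfolding unimodular_eq[OF P] residues6_def q_def using square_dvd_Res[of "int p"] by blast
  then have "res_density p = (real p ^ 12 - (2 * real p ^ 10 + real p ^ 9 - 2 * real p ^ 8 - real p ^ 7 + real p ^ 6)) / real p ^ 12"
    using arg_cong[OF card_unimodular_good[OF P], of real_of_int]
    by (simp add: res_density_def residue_density_def flip: power_mult)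
  moreover have "prim_density p = (real p ^ 12 - real p ^ 6) / real p ^ 12"
  proof -
    define x where "x = real p ^ 6"
    have "real p ^ 12 = x * x" "x \<noteq> 0" using p1 by (simp_all add: x_def flip: power_add)
    then show ?thesis unfolding prim_density_eq[OF P] x_def[symmetric] by (simp add: field_simps)
  qed
  moreover have "real p ^ 12 - real p ^ 6 \<noteq> 0"
    using power_strict_increasing[of 6 12 "real p"] p1 by simp
  moreover have "real p ^ 12 - 2 * real p ^ 10 - real p ^ 9 + 2 * real p ^ 8 + real p ^ 7 - real p ^ 6 =
      real p ^ 12 - (2 * real p ^ 10 + real p ^ 9 - 2 * real p ^ 8 - real p ^ 7 + real p ^ 6)" by simp
  ultimately show ?thesis unfolding local_proportion_eq[OF P] by simp
qed

lemma residue_density_bounds: "q > 0 \<Longrightarrow> 0 \<le> residue_density q A \<and> residue_density q A \<le> 1"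
proof -
  assume q: "q > 0"
  have "card {C \<in> residues6 q. A C} \<le> card (residues6 q)" by (rule card_mono) auto
  then have "real (card {C \<in> residues6 q. A C}) \<le> real_of_int q ^ 6"
    using card_residues6[OF q] by (metis of_nat_le_iff)
  then show ?thesis using q by (simp add: residue_density_def divide_le_eq_1)
qed

lemma prime_prods_convergent:
  fixes f :: "nat \<Rightarrow> real"
  assumes "\<And>p. prime p \<Longrightarrow> 0 \<le> f p" "\<And>p. prime p \<Longrightarrow> f p \<le> 1"
  shows "convergent (\<lambda>M. \<Prod>p\<in>primes_le M. f p)"
proof (rule Bseq_monoseq_convergent)
  have nn: "0 \<le> (\<Prod>p\<in>primes_le M. f p)" for M by (intro prod_nonneg) (use assms in auto)
  have le: "(\<Prod>p\<in>primes_le M. f p) \<le> 1" for M by (intro prod_le_1) (use assms in auto)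
  show "Bseq (\<lambda>M. \<Prod>p\<in>primes_le M. f p)"
    by (rule BseqI'[of _ 1]) (use nn le in simp)
  have "decseq (\<lambda>M. \<Prod>p\<in>primes_le M. f p)"
  proof (rule decseq_SucI)
    fix M
    show "(\<Prod>p | prime p \<and> p \<le> Suc M. f p) \<le> (\<Prod>p\<in>primes_le M. f p)"
    proof (cases "prime (Suc M)")
      case True
      then have "{p. prime p \<and> p \<le> Suc M} = insert (Suc M) (primes_le M)" by (auto simp: le_Suc_eq)
      then show ?thesis using mult_right_mono[OF assms(2)[OF True] nn[of M]] by simp
    next
      case False
      then have "{p. prime p \<and> p \<le> Suc M} = primes_le M" by (auto simp: le_Suc_eq)
      then show ?thesis by simp
    qed
  qed
  then show "monoseq (\<lambda>M. \<Prod>p\<in>primes_le M. f p)" by (simp add: decseq_imp_monoseq)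
qed

text \<open>Keeps the limit in the denominator away from 0. Since \<open>p \<ge> 2\<close>,
  \<open>1 / p^6\<close> is at most \<open>1 / 16\<close> of \<open>1 / p^2\<close>, so the deficits
  sum to at most \<open>1 / 16\<close>.\<close>

lemma prod_prim_density_ge: "(\<Prod>p\<in>primes_le M. prim_density p) \<ge> 1 / 2"
proof -
  let ?P = "primes_le M"
  have "(\<Prod>p\<in>?P. prim_density p) = (\<Prod>p\<in>?P. 1 - 1 / real p ^ 6)"
    by (rule prod.cong) (auto simp: prim_density_eq)
  also have "\<dots> \<ge> 1 - (\<Sum>p\<in>?P. 1 / real p ^ 6)"
    by (rule prod_one_minus_ge) (auto simp: prime_gt_0_nat Suc_le_eq)
  finally have "(\<Prod>p\<in>?P. prim_density p) \<ge> 1 - (\<Sum>p\<in>?P. 1 / real p ^ 6)" .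
  moreover have "(\<Sum>p\<in>?P. 1 / real p ^ 6) \<le> (\<Sum>p\<in>?P. 1 / 16 * (1 / real p ^ 2))"
  proof (rule sum_mono)
    fix p assume "p \<in> ?P"
    then have "real p \<ge> 2" using prime_ge_2_nat by auto
    then have "2 ^ 4 * real p ^ 2 \<le> real p ^ 4 * real p ^ 2" by (intro mult_right_mono power_mono) auto
    then have "16 * real p ^ 2 \<le> real p ^ 6" by (simp flip: power_add)
    then show "1 / real p ^ 6 \<le> 1 / 16 * (1 / real p ^ 2)"
      using \<open>real p \<ge> 2\<close> by (simp add: frac_le)
  qed
  moreover have "\<dots> = 1 / 16 * (\<Sum>p\<in>?P. 1 / real p ^ 2)" by (rule sum_distrib_left[symmetric])
  moreover have "(\<Sum>p\<in>?P. 1 / real p ^ 2) \<le> 1 / real 1"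
    by (rule sum_inverse_squares_le) (auto simp: prime_gt_Suc_0_nat)
  ultimately show ?thesis by simp
qed

text \<open>The sieve in abstract form: \<open>N\<close> lies between \<open>A M - T M\<close> and
  \<open>A M\<close>. One fixes \<open>M\<close> with \<open>K / M\<close> small and
  \<open>d M\<close> near \<open>L\<close>, and only then moves along \<open>F\<close>.\<close>

lemma tendsto_of_tail_bound:
  fixes N S B V :: "'a \<Rightarrow> real" and A :: "nat \<Rightarrow> 'a \<Rightarrow> real" and d :: "nat \<Rightarrow> real"
  assumes V: "\<forall>\<^sub>F r in F. V r > 0"
    and le: "\<And>M r. N r \<le> A M r" and ge: "\<And>M r. A M r \<le> N r + T M r"
    and T: "\<And>M. M \<ge> 2 \<Longrightarrow> \<forall>\<^sub>F r in F. T M r \<le> V r * (K / real M)"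
    and A: "\<And>M. ((\<lambda>r. A M r / V r) \<longlongrightarrow> d M) F" and d: "d \<longlonglongrightarrow> L"
  shows "((\<lambda>r. N r / V r) \<longlongrightarrow> L) F"
proof (rule tendstoI)
  fix e :: real assume e: "e > 0"
  have "\<forall>\<^sub>F M in sequentially. dist (d M) L < e / 3" using d e by (intro tendstoD) auto
  moreover have "((\<lambda>M. K / real M) \<longlongrightarrow> 0) sequentially" by (rule lim_const_over_n)
  then have "\<forall>\<^sub>F M in sequentially. K / real M < e / 3" by (rule order_tendstoD) (use e in simp)
  ultimately have "\<forall>\<^sub>F M in sequentially. dist (d M) L < e / 3 \<and> K / real M < e / 3 \<and> M \<ge> 2"
    using eventually_ge_at_top[of 2] by eventually_elim auto
  then obtain M where M: "dist (d M) L < e / 3" "K / real M < e / 3" "M \<ge> 2"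
    using eventually_happens by fastforce
  have "\<forall>\<^sub>F r in F. dist (A M r / V r) (d M) < e / 3" using A[of M] e by (intro tendstoD) auto
  with T[OF M(3)] V show "\<forall>\<^sub>F r in F. dist (N r / V r) L < e"
  proof eventually_elim
    case (elim r)
    have 1: "N r / V r \<le> A M r / V r" using le[of r M] elim by (intro divide_right_mono) auto
    have "A M r / V r \<le> (N r + T M r) / V r" using ge[of M r] elim by (intro divide_right_mono) auto
    also have "\<dots> = N r / V r + T M r / V r" by (rule add_divide_distrib)
    also have "T M r / V r \<le> K / real M" using elim by (simp add: divide_le_eq mult.commute)
    finally have 2: "A M r / V r \<le> N r / V r + K / real M" by simp
    have "\<bar>A M r / V r - d M\<bar> < e / 3" "\<bar>d M - L\<bar> < e / 3"
      using elim M by (simp_all add: dist_real_def)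
    then show ?case using 1 2 M(2) unfolding dist_real_def by linarith
  qed
qed

lemma vol_pos: "n \<in> {1..6} \<Longrightarrow> \<forall>\<^sub>F r in iterated_at_top n. floor_vol r > 0"
proof -
  have "\<forall>\<^sub>F r in iterated_at_top n. \<forall>i\<in>{1..6}. r i \<ge> 0"
    using filterlim_iterated_at_top[unfolded filterlim_at_top]
    by (intro eventually_ball_finite) auto
  then show ?thesis
  proof eventually_elim
    case (elim r)
    show ?case unfolding vol_def
    proof (rule prod_pos)
      fix i :: nat assume "i \<in> {1..6}"
      then have "\<lfloor>r i\<rfloor> \<ge> 0" using elim by simp
      then show "0 < side \<lfloor>r i\<rfloor>" by (simp only: of_int_0_less_iff)
    qed
  qed
qed

lemma tendsto_prime_conditions:
  assumes "\<And>p. prime p \<Longrightarrow> periodic6 (int p ^ 2) (A p)"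
  shows "((\<lambda>r. real (card {C \<in> floor_box r. \<forall>p\<in>primes_le M. A p C}) / floor_vol r)
    \<longlongrightarrow> (\<Prod>p\<in>primes_le M. residue_density (int p ^ 2) (A p))) (iterated_at_top n)"
proof -
  let ?q = "\<Prod>p\<in>primes_le M. int p ^ 2" and ?A = "\<lambda>C. \<forall>p\<in>primes_le M. A p C"
  have *: "periodic6 ?q ?A \<and> residue_density ?q ?A = (\<Prod>p\<in>primes_le M. residue_density (int p ^ 2) (A p))"
    by (rule residue_density_prod) (use assms in simp_all)
  show ?thesis unfolding conjunct2[OF *, symmetric]
    by (intro tendsto_periodic_density conjunct1[OF *] filterlim_iterated_at_top prod_pos) (auto simp: prime_gt_0_nat)
qed

text \<open>Numerator and denominator are sieved with the same tail, since a prime above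
  \<open>M\<close> dividing all coordinates has its square dividing the resultant. The limits can be
  divided because \<open>e \<ge> 1 / 2\<close>.\<close>

lemma tendsto_box_ratio:
  assumes n: "n \<in> {1..6}"
  obtains \<mu> where "(box_ratio squarefree_res_maps \<longlongrightarrow> \<mu>) (iterated_at_top n)"
    "(\<lambda>M. \<Prod>p\<in>primes_le M. local_proportion p) \<longlonglongrightarrow> \<mu>"
proof -
  let ?B = "\<lambda>r :: nat \<Rightarrow> real. floor_box r"
  let ?V = "\<lambda>r :: nat \<Rightarrow> real. floor_vol r"
  let ?T = "\<lambda>M r. real (card {C \<in> ?B r. large_square M (Res C)})"
  let ?N = "\<lambda>r. real (card {C \<in> ?B r. squarefree (Res C)})"
  let ?G = "\<lambda>r. real (card {C \<in> ?B r. Gcd (C ` {1..6}) = 1})"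
  let ?AR = "\<lambda>M r. real (card {C \<in> ?B r. \<forall>p\<in>primes_le M. \<not> int p ^ 2 dvd Res C})"
  let ?AG = "\<lambda>M r. real (card {C \<in> ?B r. \<forall>p\<in>primes_le M. \<exists>i\<in>{1..6}. \<not> int p dvd C i})"
  have card3: "real (card {C \<in> ?B r. X C}) \<le> real (card {C \<in> ?B r. Y C}) + real (card {C \<in> ?B r. Z C})"
    if "\<And>C. X C \<Longrightarrow> Y C \<or> Z C" for X Y Z r
  proof -
    have "card {C \<in> ?B r. X C} \<le> card ({C \<in> ?B r. Y C} \<union> {C \<in> ?B r. Z C})"
      by (rule card_mono) (use that in auto)
    also have "\<dots> \<le> card {C \<in> ?B r. Y C} + card {C \<in> ?B r. Z C}" by (rule card_Un_le)
    finally show ?thesis by linarith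
  qed
  have card2: "real (card {C \<in> ?B r. X C}) \<le> real (card {C \<in> ?B r. Y C})" if "\<And>C. X C \<Longrightarrow> Y C" for X Y r
    by (intro of_nat_mono card_mono) (use that in auto)
  have pos: "int p ^ 2 > 0" if "prime p" for p using that by (simp add: prime_gt_0_nat)
  have cr: "convergent (\<lambda>M. prod res_density (primes_le M))"
    by (rule prime_prods_convergent) (use residue_density_bounds pos in \<open>auto simp: res_density_def\<close>)
  have cg: "convergent (\<lambda>M. prod prim_density (primes_le M))"
    by (rule prime_prods_convergent) (use residue_density_bounds pos in \<open>auto simp: prim_density_def\<close>)
  obtain d where d: "(\<lambda>M. prod res_density (primes_le M)) \<longlonglongrightarrow> d" using cr convergent_def by blast
  obtain e where e: "(\<lambda>M. prod prim_density (primes_le M)) \<longlonglongrightarrow> e" using cg convergent_def by blast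
  have e0: "e \<ge> 1 / 2" by (rule LIMSEQ_le_const[OF e]) (use prod_prim_density_ge in auto)
  have N: "((\<lambda>r. ?N r / ?V r) \<longlongrightarrow> d) (iterated_at_top n)"
  proof (rule tendsto_of_tail_bound[OF vol_pos[OF n], where A = ?AR and T = ?T and K = 127, OF _ _ _ _ d])
    show "?N r \<le> ?AR M r" for M r by (rule card2) (auto simp: squarefree_int_iff)
    show "?AR M r \<le> ?N r + ?T M r" for M r
      by (rule card3) (use not_le in \<open>unfold squarefree_int_iff mem_Collect_eq, blast\<close>)
    show "\<forall>\<^sub>F r in iterated_at_top n. ?T M r \<le> ?V r * (127 / real M)" if "M \<ge> 2" for M
      by (rule eventually_large_square_divisors[OF n that])
    show "((\<lambda>r. ?AR M r / ?V r) \<longlongrightarrow> (prod res_density (primes_le M))) (iterated_at_top n)" for M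
      unfolding res_density_def by (rule tendsto_prime_conditions) (rule periodic6_Res)
  qed
  have G: "((\<lambda>r. ?G r / ?V r) \<longlongrightarrow> e) (iterated_at_top n)"
  proof (rule tendsto_of_tail_bound[OF vol_pos[OF n], where A = ?AG and T = ?T and K = 127, OF _ _ _ _ e])
    show "?G r \<le> ?AG M r" for M r by (rule card2) (unfold Gcd_eq_1_iff, blast)
    show "?AG M r \<le> ?G r + ?T M r" for M r
    proof (rule card3)
      fix C :: sextuple assume *: "\<forall>p\<in>primes_le M. \<exists>i\<in>{1..6}. \<not> int p dvd C i"
      show "Gcd (C ` {1..6}) = 1 \<or> (large_square M (Res C))"
      proof (cases "Gcd (C ` {1..6}) = 1")
        case False
        then obtain p where p: "prime p" "\<forall>i\<in>{1..6}. int p dvd C i" unfolding Gcd_eq_1_iff by blast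
        then have "\<not> p \<le> M" using * by blast
        then show ?thesis using p square_dvd_Res[OF p(2)] by auto
      qed blast
    qed
    show "\<forall>\<^sub>F r in iterated_at_top n. ?T M r \<le> ?V r * (127 / real M)" if "M \<ge> 2" for M
      by (rule eventually_large_square_divisors[OF n that])
    show "((\<lambda>r. ?AG M r / ?V r) \<longlongrightarrow> (prod prim_density (primes_le M))) (iterated_at_top n)" for M
      unfolding prim_density_def by (rule tendsto_prime_conditions) (rule periodic6_primitive)
  qed
  have "((\<lambda>r. (?N r / ?V r) / (?G r / ?V r)) \<longlongrightarrow> d / e) (iterated_at_top n)"
    using e0 by (intro tendsto_divide N G) auto
  moreover have "\<forall>\<^sub>F r in iterated_at_top n. (?N r / ?V r) / (?G r / ?V r) = box_ratio squarefree_res_maps r"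
    using vol_pos[OF n] by eventually_elim (simp add: box_ratio_eq)
  ultimately have 1: "(box_ratio squarefree_res_maps \<longlongrightarrow> d / e) (iterated_at_top n)"
    by (rule Lim_transform_eventually)
  have "(\<lambda>M. (prod res_density (primes_le M)) / (prod prim_density (primes_le M))) \<longlonglongrightarrow> d / e"
    using e0 by (intro tendsto_divide d e) auto
  moreover have "(prod res_density (primes_le M)) / (prod prim_density (primes_le M)) =
      (\<Prod>p\<in>primes_le M. local_proportion p)" for M
  proof -
    have "(prod res_density (primes_le M)) = (prod prim_density (primes_le M)) * (\<Prod>p\<in>primes_le M. local_proportion p)"
      unfolding prod.distrib[symmetric] by (rule prod.cong) (auto simp: res_density_eq)
    moreover have "(prod prim_density (primes_le M)) \<noteq> 0"
      by (rule less_imp_neq[symmetric], rule less_le_trans[OF _ prod_prim_density_ge]) simp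
    ultimately show ?thesis by simp
  qed
  ultimately have "(\<lambda>M. \<Prod>p\<in>primes_le M. local_proportion p) \<longlonglongrightarrow> d / e" by simp
  with 1 show ?thesis by (rule that)
qed

theorem theorem5p4:
  fixes n :: nat
  assumes "n \<in> {1..6}"
  shows "\<exists>\<mu>. has_weak_box_density n squarefree_res_maps \<mu> \<and>
     \<mu> > (\<Prod>p. if prime p \<and> p \<ge> 23
               then (real p ^ 12 - 3 * real p ^ 10 - 2 * real p ^ 9 + 4 * real p ^ 8)
                      / (real p ^ 12 * (1 - 1 / real p ^ 6))
               else 1) * (\<Prod>p | prime p \<and> p < 20. local_proportion p) \<and>
     (\<Prod>p. if prime p \<and> p \<ge> 23
               then (real p ^ 12 - 3 * real p ^ 10 - 2 * real p ^ 9 + 4 * real p ^ 8)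
                      / (real p ^ 12 * (1 - 1 / real p ^ 6))
               else 1) * (\<Prod>p | prime p \<and> p < 20. local_proportion p) > 0.327 \<and>
     (\<Prod>p | prime p \<and> p < 20. local_proportion p) \<in> {0.33843144838..<0.33843144839} \<and>
     squarefree_res_maps \<subseteq> {C \<in> rational_maps2. globally_minimal C}"
proof -
  obtain \<mu> where lim: "(box_ratio squarefree_res_maps \<longlongrightarrow> \<mu>) (iterated_at_top n)"
    "(\<lambda>M. \<Prod>p\<in>primes_le M. local_proportion p) \<longlonglongrightarrow> \<mu>"
    using tendsto_box_ratio[OF assms] .
  have "(\<Prod>p | prime p \<and> p < 20. local_proportion p) \<in> {0.33843144838..<0.33843144839}"
    unfolding prod_local_proportion_small by simp
  then show ?thesis
    using has_weak_box_densityI[OF lim(1)] density_bounds[OF lim(2)] squarefree_res_globally_minimal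
    unfolding tail_factor_def[abs_def] by blast
qed

end
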